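(* Let $X$ be a complex Banach space, let $A$ be a strongly positive linear operator in $X$ with spectral parameters $(\rho,\theta)$, let $f\in L^1((0,T),X)$, $u_0\in X$, $\alpha_1,\dots,\alpha_n\in\mathbb{C}$, and let $0<t_1<\dots<t_n\le T$ be rational numbers. Consider the nonlocal problem $$u'_t+Au=f(t),\quad t\in[0,T],\qquad u(0)+\sum_{k=1}^n\alpha_k u(t_k)=u_0 .$$ Let $Q$, $c_k$, $\varphi$, $P$, $O_1$, $r$, $P_1(w)=P(O_1+rw)$, $P_2(w)=P(O_1+w)$, the Schur–Cohn condition and the quantities $R_1,R_2,R_3,R_4$ be as defined in the context. Then the generalized solution $$u(t)=e^{-At}\left[B^{-1}(A)u_0-B^{-1}(A)\sum_{i=1}^n\alpha_i\int_0^{t_i}e^{-A(t_i-\tau)}f(\tau)\,d\tau\right]+\int_0^t e^{-A(t-\tau)}f(\tau)\,d\tau$$ of the nonlocal problem exists if at least one of the following is true: 1. the polynomial $w\mapsto P(\varphi(\rho)w)$ satisfies the Schur–Cohn condition, or for this polynomial at least one of the lower bounds $R_1,\ R_2\ (\text{for some admissible } p,q),\ R_3,\ R_4$ is greater than $1$; 2. the polynomial $P_1$ satisfies the Schur–Cohn condition, or for this polynomial at least one of the lower bounds $R_1,\ R_2\ (\text{for some admissible } p,q),\ R_3,\ R_4$ is greater than $1$; 3. for the polynomial $P_2$ at least one of the lower bounds $R_1,\ R_2\ (\text{for some admissible } p,q),\ R_3,\ R_4$ is greater than $r$.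
   Context: Strongly positive operator with spectral parameters $(\rho,\theta)$: a closed densely defined linear operator $A$ with domain $D(A)\subseteq X$ whose spectrum lies in the sector $\Sigma=\{\rho+re^{i\varphi}: r\in[0,\infty),\ |\varphi|\le\theta\}$, $\rho>0$, $0\le\theta<\pi/2$, and whose resolvent $R(z,A)=(zI-A)^{-1}$ satisfies $\|(zI-A)^{-1}\|\le\frac{M}{1+|z|}$ on the boundary of $\Sigma$ and outside $\Sigma$. Such an $A$ generates the semigroup $e^{-tA}$. Generalized (mild) solution: a function $u$ satisfying $u(t)=e^{-At}u(0)+\int_0^te^{-A(t-\tau)}f(\tau)\,d\tau$ and the nonlocal condition $u(0)+\sum_{k=1}^n\alpha_ku(t_k)=u_0$ (not necessarily $u(t)\in D(A)$). Let $B(z)=1+\sum_{k=1}^n\alpha_ke^{-t_kz}$ and $B(A)=I+\sum_{k=1}^n\alpha_ke^{-t_kA}$; $B^{-1}(A)$ is the operator inverse to $B(A)$, given by the Dunford–Cauchy formula $B^{-1}(A)x=x+\frac1{2\pi i}\int_\Gamma\frac{1}{B(z)}R(z,A)x\,dz$ with $\Gamma$ the positively oriented boundary (possibly passing through $\infty$) of an open set $V\supset\Sigma$ such that $1/B$ is analytic in $V\cup\Gamma$. Existence of the generalized solution means that $B^{-1}(A)$ is properly defined, so that the displayed formula defines a function $u$, and that this $u$ is a generalized solution. Associated polynomial. Write $t_k=\lambda_k/\mu_k$ with $\lambda_k\in\mathbb{Z}$, $\mu_k\in\mathbb{N}$, let $Q=\operatorname{LCM}(\mu_1,\dots,\mu_n)$,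 $c_k=Q\lambda_k/\mu_k$, $\varphi(z)=\exp(-z/Q)$ and $$P(z)=1+\sum_{k=1}^n\alpha_kz^{c_k},$$ so that $B(z)=P(\varphi(z))$. Encompassing circle. For $x>0$ with $x\tan\theta<Q\pi$ put $C_{1/2}=\varphi(\rho+x\pm ix\tan\theta)$; let $O_1$ be the (real) circumcentre of the triangle with vertices $\varphi(\rho)=e^{-\rho/Q}$, $C_1$, $C_2$. The value $x=x_d$ is chosen so as to maximize $|O_1-\varphi(\rho)|$; it is a positive solution of $$e^{-2x/Q}\left[\cos\tfrac{x\tan\theta}{Q}-\tan\theta\,\sin\tfrac{x\tan\theta}{Q}\right]+\cos\tfrac{x\tan\theta}{Q}+\tan\theta\,\sin\tfrac{x\tan\theta}{Q}=2e^{-x/Q}.$$ With $C_1=\varphi(\rho+x_d+ix_d\tan\theta)$ one sets $$O_1=\frac{\varphi(2\rho)-(\operatorname{Re}C_1)^2-(\operatorname{Im}C_1)^2}{2(\varphi(\rho)-\operatorname{Re}C_1)},\qquad r=\varphi(\rho)-O_1 .$$ Schur–Cohn condition. For a polynomial $p(z)=\sum_{k=0}^Na_kz^k$ of degree $N>0$, the Schur transform is $Tp(z)=\overline{a_0}p(z)-a_Np^\star(z)=\sum_{k=0}^{N-1}(\overline{a_0}a_k-a_N\overline{a_{N-k}})z^k$, where $p^\star(z)=z^N\overline{p(1/\overline z)}$; $Tp$ is regarded as a polynomial of nominal degree $N-1$, and $T^kp=T(T^{k-1}p)$. The polynomial $p$ satisfies the Schur–Cohn condition if $\gamma_k:=T^kp(0)>0$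 for all $k=1,\dots,N$. Lower bounds. For a polynomial $p(z)=\sum_{k=0}^Na_kz^k$ of degree $N$: $R_1=\dfrac{|a_0|}{|a_0|+\max_{1\le k\le N}|a_k|}$; $R_2=\dfrac{|a_0|}{\left[|a_0|^{\,}+M^q\right]^{1/q}}$ with $M=\left(\sum_{k=1}^N|a_k|^p\right)^{1/p}$, where the admissible $p,q>0$ satisfy $\frac1p+\frac1q=1$, and where the term $|a_0|$ inside the bracket is to be read as $|a_0|^q$, i.e. $R_2=|a_0|\left[|a_0|^q+M^q\right]^{-1/q}$; $R_3=\dfrac12\min_{a_i\ne0}\left\{\left|\frac{a_0}{a_1}\right|,\left|\frac{a_0}{a_2}\right|^{1/2},\dots,\left|\frac{a_0}{a_{N-1}}\right|^{1/(N-1)},\left|\frac{2a_0}{a_N}\right|^{1/N}\right\}$ (terms with $a_i=0$ omitted); $R_4=\max\{V_1^{-1},V_2^{-1}\}$, where $$V_1=\cos\frac{\pi}{N+1}+\frac{|a_N|}{2|a_0|}\left(\left|\frac{a_1}{a_N}\right|+\sqrt{1+\sum_{k=1}^{N-1}\left|\frac{a_k}{a_N}\right|^2}\right),$$ $$V_2=\frac12\left(\left|\frac{a_1}{a_0}\right|+\cos\frac{\pi}{N}\right)+\frac12\left[\left(\left|\frac{a_1}{a_0}\right|-\cos\frac{\pi}{N}\right)^2+\left(1+\left|\frac{a_N}{a_0}\right|\sqrt{1+\sum_{k=2}^{N-1}\left|\frac{a_k}{a_N}\right|^2}\right)^2\right]^{1/2}.$$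
   Formalization: In the Dunford–Cauchy formula for B^{-1}(A), 1/B(z) is replaced by 1/B(z) − 1: as printed, the integral over Γ through infinity diverges since 1/B tends to 1 and R(z,A) decays only like 1/z; V is taken to be a slightly larger open sector. *)

theory Defs
  imports "HOL-Analysis.Analysis" "HOL-Computational_Algebra.Polynomial"
begin

section \<open>Complex Banach spaces\<close>

class complex_banach = banach +
  fixes scaleC :: "complex \<Rightarrow> 'a \<Rightarrow> 'a" (infixr \<open>*\<^sub>C\<close> 75)
  assumes scaleC_add_right: "c *\<^sub>C (x + y) = c *\<^sub>C x + c *\<^sub>C y"
    and scaleC_add_left: "(c + d) *\<^sub>C x = c *\<^sub>C x + d *\<^sub>C x"
    and scaleC_scaleC: "c *\<^sub>C (d *\<^sub>C x) = (c * d) *\<^sub>C x"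
    and scaleC_of_real: "of_real a *\<^sub>C x = a *\<^sub>R x"
    and norm_scaleC: "norm (c *\<^sub>C x) = cmod c * norm x"


section \<open>Bochner integral in arbitrary Banach spaces\<close>

text \<open>
  The Bochner integral of the library is restricted to second countable (separable) target spaces.
  This is the usual definition by simple functions without that restriction; almost everywhere
  convergence provides strong measurability.
\<close>

definition has_bochner_int :: "'b measure \<Rightarrow> ('b \<Rightarrow> 'a::banach) \<Rightarrow> 'a \<Rightarrow> bool" where
  "has_bochner_int M f y \<longleftrightarrow>
     (\<exists>s. (\<forall>i::nat. Bochner_Integration.simple_bochner_integrable M (s i)) \<and>
          (AE x in M. (\<lambda>i. s i x) \<longlonglongrightarrow> f x) \<and>
          (\<lambda>i. \<integral>\<^sup>+x. ennreal (norm (f x - s i x)) \<partial>M) \<longlonglongrightarrow> 0 \<and>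
          (\<lambda>i. Bochner_Integration.simple_bochner_integral M (s i)) \<longlonglongrightarrow> y)"

definition bochner_integrable :: "'b measure \<Rightarrow> ('b \<Rightarrow> 'a::banach) \<Rightarrow> bool" where
  "bochner_integrable M f \<longleftrightarrow> (\<exists>y. has_bochner_int M f y)"

definition bochner_integral :: "'b measure \<Rightarrow> ('b \<Rightarrow> 'a::banach) \<Rightarrow> 'a" where
  "bochner_integral M f = (THE y. has_bochner_int M f y)"


section \<open>Strongly positive operators and their semigroups\<close>

text \<open>
  An unbounded operator is given by its domain \<open>D\<close> and a function \<open>A\<close> whose values outside \<open>D\<close>
  are irrelevant.
\<close>

definition linear_operator_on :: "'a::complex_banach set \<Rightarrow> ('a \<Rightarrow> 'a) \<Rightarrow> bool" where
  "linear_operator_on D A \<longleftrightarrow>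
     0 \<in> D \<and>
     (\<forall>x\<in>D. \<forall>y\<in>D. x + y \<in> D \<and> A (x + y) = A x + A y) \<and>
     (\<forall>c. \<forall>x\<in>D. c *\<^sub>C x \<in> D \<and> A (c *\<^sub>C x) = c *\<^sub>C A x)"

definition resolvent :: "'a::complex_banach set \<Rightarrow> ('a \<Rightarrow> 'a) \<Rightarrow> complex \<Rightarrow> 'a \<Rightarrow> 'a" where
  "resolvent D A z = inv_into D (\<lambda>x. z *\<^sub>C x - A x)"

definition resolvent_set :: "'a::complex_banach set \<Rightarrow> ('a \<Rightarrow> 'a) \<Rightarrow> complex set" where
  "resolvent_set D A =
     {z. bij_betw (\<lambda>x. z *\<^sub>C x - A x) D UNIV \<and> bounded_linear (resolvent D A z)}"

definition spectrum :: "'a::complex_banach set \<Rightarrow> ('a \<Rightarrow> 'a) \<Rightarrow> complex set" where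
  "spectrum D A = - resolvent_set D A"

definition sector :: "real \<Rightarrow> real \<Rightarrow> complex set" where
  "sector \<rho> \<theta> = {of_real \<rho> + of_real r * cis \<phi> | r \<phi>. 0 \<le> r \<and> \<bar>\<phi>\<bar> \<le> \<theta>}"

definition strongly_positive ::
    "'a::complex_banach set \<Rightarrow> ('a \<Rightarrow> 'a) \<Rightarrow> real \<Rightarrow> real \<Rightarrow> bool" where
  "strongly_positive D A \<rho> \<theta> \<longleftrightarrow>
     0 < \<rho> \<and> 0 \<le> \<theta> \<and> \<theta> < pi / 2 \<and>
     linear_operator_on D A \<and> closure D = UNIV \<and> closed {(x, A x) | x. x \<in> D} \<and>
     spectrum D A \<subseteq> sector \<rho> \<theta> \<and>
     (\<exists>M. \<forall>z \<in> frontier (sector \<rho> \<theta>) \<union> - sector \<rho> \<theta>.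
        z \<in> resolvent_set D A \<and> onorm (resolvent D A z) \<le> M / (1 + cmod z))"

definition C0_semigroup :: "(real \<Rightarrow> 'a::complex_banach \<Rightarrow> 'a) \<Rightarrow> bool" where
  "C0_semigroup S \<longleftrightarrow>
     (\<forall>t\<ge>0. bounded_linear (S t) \<and> (\<forall>c x. S t (c *\<^sub>C x) = c *\<^sub>C S t x)) \<and>
     (\<forall>x. S 0 x = x) \<and>
     (\<forall>s\<ge>0. \<forall>t\<ge>0. \<forall>x. S (s + t) x = S s (S t x)) \<and>
     (\<forall>x. ((\<lambda>t. S t x) \<longlongrightarrow> x) (at_right 0))"

definition has_generator ::
    "(real \<Rightarrow> 'a::complex_banach \<Rightarrow> 'a) \<Rightarrow> 'a set \<Rightarrow> ('a \<Rightarrow> 'a) \<Rightarrow> bool" where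
  "has_generator S D G \<longleftrightarrow>
     (\<forall>x y. ((\<lambda>h. (S h x - x) /\<^sub>R h) \<longlongrightarrow> y) (at_right 0) \<longleftrightarrow> x \<in> D \<and> y = G x)"

text \<open>
  \<open>opexp D A t\<close> is \<open>e\<^sup>-\<^sup>t\<^sup>A\<close>: the \<open>C\<^sub>0\<close>-semigroup with generator \<open>- A\<close>, which is unique on \<open>t \<ge> 0\<close>.
  Values at negative times are unspecified and never used.
\<close>

definition opexp :: "'a::complex_banach set \<Rightarrow> ('a \<Rightarrow> 'a) \<Rightarrow> real \<Rightarrow> 'a \<Rightarrow> 'a" where
  "opexp D A = (SOME S. C0_semigroup S \<and> has_generator S D (\<lambda>x. - A x))"


section \<open>The nonlocal problem\<close>

definition duhamel :: "'a::complex_banach set \<Rightarrow> ('a \<Rightarrow> 'a) \<Rightarrow> (real \<Rightarrow> 'a) \<Rightarrow> real \<Rightarrow> 'a" where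
  "duhamel D A f s = bochner_integral (lebesgue_on {0<..<s}) (\<lambda>\<tau>. opexp D A (s - \<tau>) (f \<tau>))"

definition generalized_solution ::
    "'a::complex_banach set \<Rightarrow> ('a \<Rightarrow> 'a) \<Rightarrow> real \<Rightarrow> (real \<Rightarrow> 'a) \<Rightarrow> 'a \<Rightarrow> nat \<Rightarrow>
     (nat \<Rightarrow> complex) \<Rightarrow> (nat \<Rightarrow> real) \<Rightarrow> (real \<Rightarrow> 'a) \<Rightarrow> bool" where
  "generalized_solution D A T f u0 n \<alpha> t u \<longleftrightarrow>
     (\<forall>s\<in>{0..T}.
        bochner_integrable (lebesgue_on {0<..<s}) (\<lambda>\<tau>. opexp D A (s - \<tau>) (f \<tau>)) \<and>
        u s = opexp D A s (u 0) + duhamel D A f s) \<and>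
     u 0 + (\<Sum>k=1..n. \<alpha> k *\<^sub>C u (t k)) = u0"

definition B_fun :: "nat \<Rightarrow> (nat \<Rightarrow> complex) \<Rightarrow> (nat \<Rightarrow> real) \<Rightarrow> complex \<Rightarrow> complex" where
  "B_fun n \<alpha> t z = 1 + (\<Sum>k=1..n. \<alpha> k * exp (- of_real (t k) * z))"

definition B_op ::
    "'a::complex_banach set \<Rightarrow> ('a \<Rightarrow> 'a) \<Rightarrow> nat \<Rightarrow> (nat \<Rightarrow> complex) \<Rightarrow> (nat \<Rightarrow> real) \<Rightarrow> 'a \<Rightarrow> 'a" where
  "B_op D A n \<alpha> t x = x + (\<Sum>k=1..n. \<alpha> k *\<^sub>C opexp D A (t k) x)"

text \<open>
  Integrals over the boundary of \<open>sector \<rho>' \<theta>'\<close> with the sector on the left: along the upper ray from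
  \<open>\<infinity>\<close> to \<open>\<rho>'\<close> and then along the lower ray from \<open>\<rho>'\<close> to \<open>\<infinity>\<close>.
\<close>

definition ray_integrand ::
    "real \<Rightarrow> real \<Rightarrow> (complex \<Rightarrow> 'a::complex_banach) \<Rightarrow> real \<Rightarrow> 'a" where
  "ray_integrand \<rho>' \<psi> g = (\<lambda>r. cis \<psi> *\<^sub>C g (of_real \<rho>' + of_real r * cis \<psi>))"

definition sector_integral :: "real \<Rightarrow> real \<Rightarrow> (complex \<Rightarrow> 'a::complex_banach) \<Rightarrow> 'a" where
  "sector_integral \<rho>' \<theta>' g =
     integral {0..} (ray_integrand \<rho>' (- \<theta>') g) - integral {0..} (ray_integrand \<rho>' \<theta>' g)"

definition sector_integrable :: "real \<Rightarrow> real \<Rightarrow> (complex \<Rightarrow> 'a::complex_banach) \<Rightarrow> bool" where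
  "sector_integrable \<rho>' \<theta>' g \<longleftrightarrow>
     (\<forall>\<psi>\<in>{- \<theta>', \<theta>'}. ray_integrand \<rho>' \<psi> g integrable_on {0..} \<and>
        (\<lambda>r. norm (ray_integrand \<rho>' \<psi> g r)) integrable_on {0..})"

text \<open>
  The open set \<open>V \<supset> \<Sigma>\<close> is the interior of \<open>sector \<rho>' \<theta>'\<close>. At a zero of \<open>B\<close> the function \<open>1 / B\<close>
  (with \<open>1 / 0 = 0\<close>) is not analytic.
\<close>

definition admissible_sector ::
    "real \<Rightarrow> real \<Rightarrow> nat \<Rightarrow> (nat \<Rightarrow> complex) \<Rightarrow> (nat \<Rightarrow> real) \<Rightarrow> real \<Rightarrow> real \<Rightarrow> bool" where
  "admissible_sector \<rho> \<theta> n \<alpha> t \<rho>' \<theta>' \<longleftrightarrow>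
     \<rho>' < \<rho> \<and> \<theta> < \<theta>' \<and> \<theta>' < pi / 2 \<and> (\<lambda>z. 1 / B_fun n \<alpha> t z) analytic_on sector \<rho>' \<theta>'"

text \<open>
  Dunford--Cauchy formula \<open>h(A) = h(\<infinity>) I + (2\<pi>i)\<^sup>-\<^sup>1 \<integral> h(z) R(z,A) dz\<close> for \<open>h = 1 / B\<close>, \<open>h(\<infinity>) = 1\<close>.
  If the domain of \<open>h\<close> contains a neighbourhood of \<open>\<infinity>\<close>, the integral of \<open>R(z,A)\<close> alone vanishes and
  \<open>h\<close> may be replaced by \<open>h - h(\<infinity>)\<close>. On a contour through \<open>\<infinity>\<close> the subtraction is necessary:
  \<open>R(z,A)\<close> only decays like \<open>1 / z\<close>, and the integral without it diverges.
\<close>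

definition B_integrand ::
    "'a::complex_banach set \<Rightarrow> ('a \<Rightarrow> 'a) \<Rightarrow> nat \<Rightarrow> (nat \<Rightarrow> complex) \<Rightarrow> (nat \<Rightarrow> real) \<Rightarrow>
     'a \<Rightarrow> complex \<Rightarrow> 'a" where
  "B_integrand D A n \<alpha> t x z = (1 / B_fun n \<alpha> t z - 1) *\<^sub>C resolvent D A z x"

definition B_inv ::
    "'a::complex_banach set \<Rightarrow> ('a \<Rightarrow> 'a) \<Rightarrow> nat \<Rightarrow> (nat \<Rightarrow> complex) \<Rightarrow> (nat \<Rightarrow> real) \<Rightarrow>
     real \<Rightarrow> real \<Rightarrow> 'a \<Rightarrow> 'a" where
  "B_inv D A n \<alpha> t \<rho>' \<theta>' x =
     x + (1 / (2 * of_real pi * \<i>)) *\<^sub>C sector_integral \<rho>' \<theta>' (B_integrand D A n \<alpha> t x)"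

definition solution_formula ::
    "'a::complex_banach set \<Rightarrow> ('a \<Rightarrow> 'a) \<Rightarrow> (real \<Rightarrow> 'a) \<Rightarrow> 'a \<Rightarrow> nat \<Rightarrow>
     (nat \<Rightarrow> complex) \<Rightarrow> (nat \<Rightarrow> real) \<Rightarrow> ('a \<Rightarrow> 'a) \<Rightarrow> real \<Rightarrow> 'a" where
  "solution_formula D A f u0 n \<alpha> t Binv s =
     opexp D A s (Binv u0 - Binv (\<Sum>i=1..n. \<alpha> i *\<^sub>C duhamel D A f (t i))) + duhamel D A f s"


section \<open>The associated polynomial and the encompassing circle\<close>

definition denom_lcm :: "nat \<Rightarrow> (nat \<Rightarrow> nat) \<Rightarrow> nat" where
  "denom_lcm n \<mu> = Lcm (\<mu> ` {1..n})"

definition c_exp :: "nat \<Rightarrow> (nat \<Rightarrow> int) \<Rightarrow> (nat \<Rightarrow> nat) \<Rightarrow> nat \<Rightarrow> nat" where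
  "c_exp n lam \<mu> k = nat (int (denom_lcm n \<mu>) * lam k div int (\<mu> k))"

definition assoc_poly ::
    "nat \<Rightarrow> (nat \<Rightarrow> complex) \<Rightarrow> (nat \<Rightarrow> int) \<Rightarrow> (nat \<Rightarrow> nat) \<Rightarrow> complex poly" where
  "assoc_poly n \<alpha> lam \<mu> = 1 + (\<Sum>k=1..n. monom (\<alpha> k) (c_exp n lam \<mu> k))"

definition phi :: "nat \<Rightarrow> complex \<Rightarrow> complex" where
  "phi Q z = exp (- z / of_nat Q)"

definition circle_center :: "nat \<Rightarrow> real \<Rightarrow> real \<Rightarrow> real \<Rightarrow> real" where
  "circle_center Q \<rho> \<theta> x =
     (let C = phi Q (Complex (\<rho> + x) (x * tan \<theta>)) in
      (Re (phi Q (of_real (2 * \<rho>))) - (Re C)\<^sup>2 - (Im C)\<^sup>2) /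
      (2 * (Re (phi Q (of_real \<rho>)) - Re C)))"

definition circle_radius :: "nat \<Rightarrow> real \<Rightarrow> real \<Rightarrow> real \<Rightarrow> real" where
  "circle_radius Q \<rho> \<theta> x = Re (phi Q (of_real \<rho>)) - circle_center Q \<rho> \<theta> x"

definition is_x_d :: "nat \<Rightarrow> real \<Rightarrow> real \<Rightarrow> real \<Rightarrow> bool" where
  "is_x_d Q \<rho> \<theta> x \<longleftrightarrow>
     is_arg_max (\<lambda>x. \<bar>circle_center Q \<rho> \<theta> x - Re (phi Q (of_real \<rho>))\<bar>)
       (\<lambda>x. 0 < x \<and> x * tan \<theta> < real Q * pi) x"


section \<open>Schur--Cohn condition and lower bounds\<close>

text \<open>The transform takes the nominal degree \<open>N\<close>, since the actual degree may drop.\<close>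

definition schur_transform :: "nat \<Rightarrow> complex poly \<Rightarrow> complex poly" where
  "schur_transform N p =
     (\<Sum>k<N. monom (cnj (coeff p 0) * coeff p k - coeff p N * cnj (coeff p (N - k))) k)"

primrec schur_iter :: "complex poly \<Rightarrow> nat \<Rightarrow> complex poly" where
  "schur_iter p 0 = p"
| "schur_iter p (Suc k) = schur_transform (degree p - k) (schur_iter p k)"

definition schur_cohn :: "complex poly \<Rightarrow> bool" where
  "schur_cohn p \<longleftrightarrow>
     (\<forall>k\<in>{1..degree p}. poly (schur_iter p k) 0 \<in> \<real> \<and> 0 < Re (poly (schur_iter p k) 0))"

definition lower_bound_1 :: "complex poly \<Rightarrow> real" where
  "lower_bound_1 P =
     cmod (coeff P 0) / (cmod (coeff P 0) + Max ((\<lambda>k. cmod (coeff P k)) ` {1..degree P}))"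

definition lower_bound_2 :: "real \<Rightarrow> real \<Rightarrow> complex poly \<Rightarrow> real" where
  "lower_bound_2 p q P =
     (let M = (\<Sum>k=1..degree P. cmod (coeff P k) powr p) powr (1 / p) in
      cmod (coeff P 0) / (cmod (coeff P 0) powr q + M powr q) powr (1 / q))"

definition lower_bound_3 :: "complex poly \<Rightarrow> real" where
  "lower_bound_3 P =
     (let N = degree P; a = coeff P in
      1 / 2 * Min (insert (root N (cmod (2 * a 0 / a N)))
                     ((\<lambda>i. root i (cmod (a 0 / a i))) ` {i\<in>{1..<N}. a i \<noteq> 0})))"

text \<open>
  If \<open>a\<^sub>0 = 0\<close>, then \<open>V\<^sub>1 = V\<^sub>2 = \<infinity>\<close> and the bound is \<open>0\<close>; this case is separated because the
  convention \<open>x / 0 = 0\<close> would turn the formulas into something else.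
\<close>

definition lower_bound_4 :: "complex poly \<Rightarrow> real" where
  "lower_bound_4 P =
     (let N = degree P; a = coeff P;
          V1 = cos (pi / (N + 1)) +
               cmod (a N) / (2 * cmod (a 0)) *
                 (cmod (a 1 / a N) + sqrt (1 + (\<Sum>k=1..N-1. (cmod (a k / a N))\<^sup>2)));
          V2 = 1 / 2 * (cmod (a 1 / a 0) + cos (pi / N)) +
               1 / 2 * sqrt ((cmod (a 1 / a 0) - cos (pi / N))\<^sup>2 +
                 (1 + cmod (a N / a 0) * sqrt (1 + (\<Sum>k=2..N-1. (cmod (a k / a N))\<^sup>2)))\<^sup>2)
      in if a 0 = 0 then 0 else max (inverse V1) (inverse V2))"

definition some_lower_bound_exceeds :: "complex poly \<Rightarrow> real \<Rightarrow> bool" where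
  "some_lower_bound_exceeds P s \<longleftrightarrow>
     0 < degree P \<and>
     (lower_bound_1 P > s \<or>
      (\<exists>p>0. \<exists>q>0. 1 / p + 1 / q = 1 \<and> lower_bound_2 p q P > s) \<or>
      lower_bound_3 P > s \<or>
      lower_bound_4 P > s)"

end

theory Submission
  imports Defs "HOL-Complex_Analysis.Complex_Analysis"
    "HOL-Computational_Algebra.Fundamental_Theorem_Algebra" "HOL-Real_Asymp.Real_Asymp"
begin

text \<open>
  Each of the three conditions keeps the zeros of \<open>P\<close> away from a disc that contains \<open>\<phi>(\<Sigma>)\<close>: the disc
  around \<open>0\<close> through \<open>\<phi>(\<rho>)\<close>, or the disc around \<open>O\<^sub>1\<close>, which contains the whole spiral \<open>\<phi>(\<partial>\<Sigma>)\<close>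
  because its radius is maximal among the circles through \<open>\<phi>(\<rho>)\<close> and a pair of conjugate points of the
  spiral. Hence \<open>B\<close> has no zeros on \<open>\<Sigma>\<close>, and since \<open>B \<rightarrow> 1\<close> for \<open>Re z \<rightarrow> \<infinity>\<close>, none on a slightly larger
  sector.

  On the boundary of such a sector \<open>\<Phi>(h) = (2\<pi>i)\<^sup>-\<^sup>1 \<integral> h(z) R(z,A) dz\<close> is studied directly. Cauchy's theorem
  is only needed in the form that the two boundary rays may be rotated into each other, which follows by
  differentiating under the integral. The family \<open>U(t) = \<Phi>(e\<^sup>-\<^sup>t\<^sup>z)\<close> is a \<open>C\<^sub>0\<close>-semigroup generated by
  \<open>-A\<close>; uniqueness for \<open>w' = -Aw\<close> identifies it with every such semigroup, and yields
  \<open>U(t) \<Phi>(h) = \<Phi>(e\<^sup>-\<^sup>t\<^sup>z h)\<close> without a product formula for the calculus. With \<open>h = 1/B - 1\<close> the identity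
  \<open>(B - 1) + h B = 0\<close> then gives \<open>B(A) (I + \<Phi>(h)) = I\<close>.
\<close>

section \<open>Zero-free discs of polynomials\<close>

text \<open>The resolvent decays only like 1 / |z|, so the scalar factor has to make the integral
  converge. As \<open>t 1\<close> is the smallest time, 1 / B - 1 is exp (- t_1 z) times a function
  bounded on the sector; all functions inserted into the calculus carry such an exponential. Scalar
  integrands of this kind integrate to 0 by closing the contour through the sector, and integrands
  built from the resolvent can be closed on the other side, where the resolvent is analytic. The
  constant 2 pi i enters once, through two poles separated by the contour. \<open>opexp\<close> is
  an arbitrary choice among the semigroups generated by -A, so uniqueness must cover every
  C_0-semigroup, of which only the strong right limit at 0 is known; Baire's theorem supplies a
  local bound. The space need not be separable, so the convolution is approximated by explicit
  simple functions. The conclusion speaks of every admissible sector: that B has no zero there is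
  recovered from the analyticity of 1 / B, since with 1 / 0 = 0 this function is discontinuous at a
  zero of B.\<close>

lemma cmod_coeff_0_le_if_root:
  fixes p :: "complex poly"
  assumes "poly p z = 0"
  shows "cmod (coeff p 0) \<le> (\<Sum>k=1..degree p. cmod (coeff p k) * cmod z ^ k)"
proof -
  have "coeff p 0 = - (\<Sum>k=1..degree p. coeff p k * z ^ k)"
    using assms
    by (simp add: poly_altdef atMost_atLeast0 sum.atLeast_Suc_atMost add_eq_0_iff2)
  then have "cmod (coeff p 0) = cmod (\<Sum>k=1..degree p. coeff p k * z ^ k)"
    by simp
  also have "\<dots> \<le> (\<Sum>k=1..degree p. cmod (coeff p k) * cmod z ^ k)"
    by (rule order_trans[OF norm_sum]) (simp add: norm_mult norm_power)
  finally show ?thesis .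
qed

lemma sum_powers_le:
  fixes x :: real
  assumes "0 \<le> x" "x < 1"
  shows "(\<Sum>k=1..n. x ^ k) \<le> x / (1 - x)"
proof -
  have "(\<Sum>k=1..n. x ^ k) = (x - x ^ Suc n) / (1 - x)"
    using assms by (simp add: sum_gp)
  also have "\<dots> \<le> x / (1 - x)"
    using assms by (intro divide_right_mono) auto
  finally show ?thesis .
qed

text \<open>At a root, |a_0| is at most the sum of the |a_k| |z|^k; all four bounds start from this.
  Here every |a_k| is replaced by the maximum M, and the geometric series gives |a_0| \<le> M |z| /
  (1 - |z|), that is |z| \<ge> |a_0| / (|a_0| + M).\<close>

lemma no_root_if_lower_bound_1:
  assumes "0 < degree p" "s < lower_bound_1 p" "cmod z \<le> s"
  shows "poly p z \<noteq> 0"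
proof
  assume root: "poly p z = 0"
  define a where "a = cmod (coeff p 0)"
  define M where "M = Max ((\<lambda>k. cmod (coeff p k)) ` {1..degree p})"
  have s: "0 \<le> s" using assms(3) norm_ge_zero order_trans by blast
  have le_M: "cmod (coeff p k) \<le> M" if "k \<in> {1..degree p}" for k
    unfolding M_def using that by (intro Max_ge) auto
  have "0 < cmod (coeff p (degree p))" using assms(1) by auto
  also have "\<dots> \<le> M" using assms(1) by (intro le_M) auto
  finally have M: "0 < M" .
  have b: "s < a / (a + M)" using assms(2) by (simp add: lower_bound_1_def a_def M_def)
  have a: "0 < a" using b s M by (cases "a = 0") (auto simp: a_def)
  have "cmod z < a / (a + M)" using b assms(3) by simp
  then have lt: "cmod z * (a + M) < a" using a M by (simp add: field_simps)
  then have "cmod z * a < a"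
  proof -
    have "0 \<le> cmod z * M" using M by simp
    then show ?thesis using lt by (simp only: distrib_left)
  qed
  then have z1: "cmod z < 1" using a by simp
  have "a \<le> (\<Sum>k=1..degree p. cmod (coeff p k) * cmod z ^ k)"
    unfolding a_def using root by (rule cmod_coeff_0_le_if_root)
  also have "\<dots> \<le> (\<Sum>k=1..degree p. M * cmod z ^ k)"
    by (intro sum_mono mult_right_mono le_M) auto
  also have "\<dots> = M * (\<Sum>k=1..degree p. cmod z ^ k)" by (simp add: sum_distrib_left)
  also have "\<dots> \<le> M * (cmod z / (1 - cmod z))"
    using M z1 by (intro mult_left_mono sum_powers_le) auto
  also have "\<dots> < a" using lt z1 by (simp add: field_simps)
  finally show False by simp
qed

text \<open>Both vectors are scaled to norm 1, which positivity of the two sums permits; Young's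
  inequality, summed over the index, then has right-hand side 1 / p + 1 / q = 1.\<close>

lemma Holder_sum:
  fixes a b :: "'i \<Rightarrow> real"
  assumes "p > 1" "q > 1" "1 / p + 1 / q = 1"
    and nonneg: "\<And>i. i \<in> I \<Longrightarrow> 0 \<le> a i" "\<And>i. i \<in> I \<Longrightarrow> 0 \<le> b i"
    and pos: "0 < (\<Sum>i\<in>I. a i powr p)" "0 < (\<Sum>i\<in>I. b i powr q)"
  shows "(\<Sum>i\<in>I. a i * b i) \<le> (\<Sum>i\<in>I. a i powr p) powr (1 / p) * (\<Sum>i\<in>I. b i powr q) powr (1 / q)"
proof -
  define \<alpha> where "\<alpha> = (\<Sum>i\<in>I. a i powr p) powr (1 / p)"
  define \<beta> where "\<beta> = (\<Sum>i\<in>I. b i powr q) powr (1 / q)"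
  have \<alpha>: "0 < \<alpha>" "\<alpha> powr p = (\<Sum>i\<in>I. a i powr p)"
    using pos assms(1) by (auto simp: \<alpha>_def powr_powr)
  have \<beta>: "0 < \<beta>" "\<beta> powr q = (\<Sum>i\<in>I. b i powr q)"
    using pos assms(2) by (auto simp: \<beta>_def powr_powr)
  have "(\<Sum>i\<in>I. (a i / \<alpha>) * (b i / \<beta>)) \<le> (\<Sum>i\<in>I. (a i / \<alpha>) powr p / p + (b i / \<beta>) powr q / q)"
    using assms \<alpha> \<beta> by (intro sum_mono Youngs_inequality) auto
  also have "\<dots> = (\<Sum>i\<in>I. a i powr p / \<alpha> powr p / p + b i powr q / \<beta> powr q / q)"
    using nonneg \<alpha> \<beta> by (intro sum.cong) (auto simp: powr_divide)
  also have "\<dots> = (\<Sum>i\<in>I. a i powr p) / \<alpha> powr p / p + (\<Sum>i\<in>I. b i powr q) / \<beta> powr q / q"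
    by (simp add: sum.distrib sum_divide_distrib)
  also have "\<dots> = 1" using \<alpha>(2) \<beta>(2) pos assms(3) by simp
  finally have "(\<Sum>i\<in>I. a i * b i) / (\<alpha> * \<beta>) \<le> 1" by (simp add: sum_divide_distrib)
  then show ?thesis using \<alpha> \<beta> by (simp add: \<alpha>_def[symmetric] \<beta>_def[symmetric] field_simps)
qed

text \<open>Hoelder's inequality takes the place of the maximum over the coefficients. After raising
  to the power q the remaining series is geometric in y = |z|^q, and |a_0|^q \<le> M^q y / (1 - y)
  contradicts |z| < R_2.\<close>

lemma no_root_if_lower_bound_2:
  assumes "0 < degree p" "s < lower_bound_2 e q p" "cmod z \<le> s"
    and "e > 0" "q > 0" "1 / e + 1 / q = 1"
  shows "poly p z \<noteq> 0"
proof
  assume root: "poly p z = 0"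
  have "1 / q > 0" "1 / e > 0" using assms(4,5) by auto
  then have "1 / e < 1" "1 / q < 1" using assms(6) by linarith+
  then have eq: "e > 1" "q > 1" using assms(4,5) by auto
  define a where "a = cmod (coeff p 0)"
  define x where "x = cmod z"
  define I where "I = {1..degree p}"
  define S where "S = (\<Sum>k\<in>I. cmod (coeff p k) powr e)"
  define M where "M = S powr (1 / e)"
  have s: "0 \<le> s" using assms(3) norm_ge_zero order_trans by blast
  have "0 < S" unfolding S_def
    by (rule sum_pos2[where i = "degree p"]) (use assms(1) in \<open>auto simp: I_def\<close>)
  then have M: "0 < M" by (simp add: M_def)
  have b: "s < a / (a powr q + M powr q) powr (1 / q)"
    using assms(2) by (simp add: lower_bound_2_def a_def M_def S_def I_def Let_def)
  have a: "0 < a" using b s by (cases "a = 0") (auto simp: a_def)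
  have pp: "0 < a powr q + M powr q" using a M by (intro add_pos_pos) auto
  have x: "x < a / (a powr q + M powr q) powr (1 / q)" using b assms(3) by (simp add: x_def)
  have "coeff p 0 = 0" if "x = 0" using root that by (simp add: x_def poly_0_coeff_0)
  then have x0: "0 < x" using a by (cases "x = 0") (auto simp: a_def x_def)
  have "x powr q < (a / (a powr q + M powr q) powr (1 / q)) powr q"
    using x x0 assms(5) by (intro powr_less_mono2) auto
  also have "\<dots> = a powr q / (a powr q + M powr q)"
    using a pp assms(5) by (simp add: powr_divide powr_powr)
  finally have lt: "x powr q * (a powr q + M powr q) < a powr q" using pp by (simp add: field_simps)
  define y where "y = x powr q"
  have "y * a powr q < a powr q"
    proof -
    have "0 < x powr q * M powr q" using M x0 by simp
    then show ?thesis using lt by (simp add: algebra_simps y_def)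
  qed
  then have y: "0 < y" "y < 1" using a x0 by (auto simp: y_def)
  have pow: "(x ^ k) powr q = y ^ k" for k
    using x0 by (simp add: y_def powr_realpow[symmetric] powr_powr mult.commute)
  define G where "G = (\<Sum>k\<in>I. (x ^ k) powr q)"
  have G0: "0 < G" unfolding G_def by (rule sum_pos) (use assms(1) x0 in \<open>auto simp: I_def\<close>)
  have G: "G \<le> y / (1 - y)" unfolding G_def pow I_def using y by (intro sum_powers_le) auto
  have "a \<le> (\<Sum>k\<in>I. cmod (coeff p k) * x ^ k)"
    unfolding a_def I_def x_def using root by (rule cmod_coeff_0_le_if_root)
  also have "\<dots> \<le> M * G powr (1 / q)" unfolding M_def G_def S_def
    by (rule Holder_sum) (use eq assms(6) x0 \<open>0 < S\<close> G0 in \<open>auto simp: S_def G_def\<close>)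
  finally have "a powr q \<le> (M * G powr (1 / q)) powr q" using a assms(5) by (intro powr_mono2) auto
  also have "\<dots> = M powr q * G" using M G0 assms(5) by (simp add: powr_mult powr_powr)
  also have "\<dots> \<le> M powr q * (y / (1 - y))" using G by (intro mult_left_mono) auto
  also have "\<dots> < a powr q" using lt y by (simp add: y_def[symmetric] field_simps)
  finally show False by simp
qed

lemma sum_half_powers: "(\<Sum>k=1..n. (1/2::real) ^ k) = 1 - (1/2) ^ n"
  by (induction n) (auto simp: field_simps)

text \<open>With m = 2 R_3 the minimum says |a_k| \<le> |a_0| / m^k for 0 < k < N and |a_N| \<le> 2
  |a_0| / m^N. For |z| < m / 2 the terms are dominated by |a_0| 2^(-k), the last one with weight 2;
  these weights sum to exactly 1, which explains the 2 in the last entry of the minimum.\<close>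

lemma no_root_if_lower_bound_3:
  assumes "0 < degree p" "s < lower_bound_3 p" "cmod z \<le> s"
  shows "poly p z \<noteq> 0"
proof
  assume root: "poly p z = 0"
  define N where "N = degree p"
  define a where "a = cmod (coeff p 0)"
  define m where "m = 2 * lower_bound_3 p"
  define J where "J = {i\<in>{1..<N}. coeff p i \<noteq> 0}"
  define Q where "Q = insert (root N (cmod (2 * coeff p 0 / coeff p N)))
    ((\<lambda>i. root i (cmod (coeff p 0 / coeff p i))) ` J)"
  have s: "0 \<le> s" using assms(3) norm_ge_zero order_trans by blast
  have m: "m = Min Q" by (simp add: m_def lower_bound_3_def Q_def N_def J_def Let_def)
  have fin: "finite Q" by (simp add: Q_def J_def)
  have m0: "0 < m" using assms(2) s by (simp add: m_def)
  have N: "0 < N" "coeff p N \<noteq> 0" using assms(1) by (auto simp: N_def)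
  have "m \<le> root N (cmod (2 * coeff p 0 / coeff p N))" unfolding m using fin
    by (intro Min_le) (auto simp: Q_def)
  then have "m ^ N \<le> root N (cmod (2 * coeff p 0 / coeff p N)) ^ N" using m0 by (intro power_mono) auto
  also have "\<dots> = 2 * a / cmod (coeff p N)" using N by (simp add: norm_divide norm_mult a_def)
  finally have cN: "cmod (coeff p N) \<le> 2 * a / m ^ N" using N m0 by (simp add: field_simps)
  have ck: "cmod (coeff p k) \<le> a / m ^ k" if k: "k \<in> {1..<N}" for k
  proof (cases "coeff p k = 0")
    case False
    then have "m \<le> root k (cmod (coeff p 0 / coeff p k))" unfolding m using fin k
      by (intro Min_le) (auto simp: Q_def J_def)
    then have "m ^ k \<le> root k (cmod (coeff p 0 / coeff p k)) ^ k" using m0 by (intro power_mono) auto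
    also have "\<dots> = a / cmod (coeff p k)" using k by (simp add: norm_divide a_def)
    finally show ?thesis using False m0 by (simp add: field_simps)
  qed (use m0 in \<open>auto simp: a_def\<close>)
  define y where "y = cmod z / (m / 2)"
  have y: "0 \<le> y" "y < 1" using assms(2,3) m0 by (auto simp: y_def m_def)
  have z: "cmod z = y * m / 2" using m0 by (simp add: y_def)
  have "coeff p 0 = 0" if "cmod z = 0" using root that by (simp add: poly_0_coeff_0)
  then have a0: "0 < a" using N m \<open>0 < m\<close> fin
    by (cases "coeff p 0 = 0") (use \<open>m \<le> root N _\<close> in \<open>auto simp: a_def\<close>)
  have "a \<le> (\<Sum>k=1..N. cmod (coeff p k) * cmod z ^ k)"
    unfolding a_def N_def using root by (rule cmod_coeff_0_le_if_root)
  also have "\<dots> = (\<Sum>k=1..<N. cmod (coeff p k) * cmod z ^ k) + cmod (coeff p N) * cmod z ^ N"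
    using N by (subst sum.last_plus) (auto simp: atLeastLessThanSuc_atLeastAtMost[symmetric] simp del: sum.op_ivl_Suc)
  also have "\<dots> \<le> (\<Sum>k=1..<N. y * a * (1/2) ^ k) + y * (2 * a) * (1/2) ^ N"
  proof (intro add_mono sum_mono)
    \<comment> \<open>One factor y < 1 is kept from every power; it makes the final estimate a \<le>
      y a contradictory.\<close>
    have pw: "y ^ k \<le> y" if "0 < k" for k using y that by (metis power_decreasing power_one_right less_imp_le Suc_leI One_nat_def)
    show "cmod (coeff p k) * cmod z ^ k \<le> y * a * (1/2) ^ k" if "k \<in> {1..<N}" for k
    proof -
      have "cmod (coeff p k) * cmod z ^ k \<le> a / m ^ k * (y * m / 2) ^ k"
        unfolding z by (intro mult_right_mono ck that) (use y m0 in auto)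
      also have "\<dots> = y ^ k * (a * (1/2) ^ k)" using m0 by (simp add: power_mult_distrib power_divide)
      also have "\<dots> \<le> y * (a * (1/2) ^ k)" using a0 that by (intro mult_right_mono pw) auto
      finally show ?thesis by simp
    qed
    show "cmod (coeff p N) * cmod z ^ N \<le> y * (2 * a) * (1/2) ^ N"
    proof -
      have "cmod (coeff p N) * cmod z ^ N \<le> 2 * a / m ^ N * (y * m / 2) ^ N"
        unfolding z by (intro mult_right_mono cN) (use y m0 in auto)
      also have "\<dots> = y ^ N * (2 * a * (1/2) ^ N)" using m0 by (simp add: power_mult_distrib power_divide)
      also have "\<dots> \<le> y * (2 * a * (1/2) ^ N)" using a0 N by (intro mult_right_mono pw) auto
      finally show ?thesis by simp
    qed
  qed
  also have "\<dots> = y * a * ((\<Sum>k=1..<N. (1/2) ^ k) + 2 * (1/2) ^ N)"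
    by (simp add: sum_distrib_left algebra_simps)
  also have "(\<Sum>k=1..<N. (1/2) ^ k) + 2 * (1/2::real) ^ N = 1"
    using N sum_half_powers[of "N - 1"]
    by (cases N) (auto simp: atLeastLessThanSuc_atLeastAtMost)
  finally show False using y a0 by simp
qed

section \<open>Quadratic forms and the fourth lower bound\<close>

text \<open>The left side is half the quadratic form of the adjacency matrix of a path with m + 1
  vertices, whose largest eigenvalue is 2 cos (pi / (m + 2)), with eigenvector entries sin ((j + 1)
  h). Each product is split by the arithmetic-geometric mean inequality, weighted with ratios of
  neighbouring entries; by the three-term recurrence of the sine the weights at each vertex add up
  to 2 cos h.\<close>

lemma sum_mult_Suc_le:
  fixes v :: "nat \<Rightarrow> real"
  shows "(\<Sum>i<m. v i * v (Suc i)) \<le> cos (pi / real (m + 2)) * (\<Sum>i\<le>m. (v i)\<^sup>2)"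
proof -
  define h where "h = pi / real (m + 2)"
  define S where "S j = sin (real j * h)" for j
  have Spos: "0 < S (Suc j)" if "j \<le> m" for j
  proof -
    have "real (Suc j) * pi < real (m + 2) * pi" using that by (intro mult_strict_right_mono) auto
    then have "real (Suc j) * h < pi" by (simp add: h_def field_simps)
    then show ?thesis unfolding S_def by (intro sin_gt_zero) (auto simp: h_def)
  qed
  \<comment> \<open>\<open>S\<close> vanishes just outside both ends of the path, so the two shifted
    sums below may be extended to the common range i \<le> m.\<close>
  have S0: "S 0 = 0" by (simp add: S_def)
  have "real (m + 2) * h = pi" by (simp add: h_def)
  then have Sm: "S (Suc (Suc m)) = 0" unfolding S_def by (metis add_2_eq_Suc' sin_pi)
  have rec: "S (Suc (Suc j)) + S j = 2 * cos h * S (Suc j)" for j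
    using sin_add[of "real (Suc j) * h" h] sin_diff[of "real (Suc j) * h" h]
    by (simp add: S_def algebra_simps)
  have "(\<Sum>i<m. 2 * (v i * v (Suc i))) \<le>
      (\<Sum>i<m. S (Suc (Suc i)) / S (Suc i) * (v i)\<^sup>2 + S (Suc i) / S (Suc (Suc i)) * (v (Suc i))\<^sup>2)"
  proof (rule sum_mono)
    fix i assume "i \<in> {..<m}"
    then have i: "0 < S (Suc i)" "0 < S (Suc (Suc i))" using Spos[of i] Spos[of "Suc i"] by auto
    have "0 \<le> (S (Suc (Suc i)) * v i - S (Suc i) * v (Suc i))\<^sup>2 / (S (Suc i) * S (Suc (Suc i)))"
      using i by simp
    also have "\<dots> = S (Suc (Suc i)) / S (Suc i) * (v i)\<^sup>2 + S (Suc i) / S (Suc (Suc i)) * (v (Suc i))\<^sup>2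
        - 2 * (v i * v (Suc i))"
      using i by (simp add: field_simps power2_eq_square)
    finally show "2 * (v i * v (Suc i)) \<le>
        S (Suc (Suc i)) / S (Suc i) * (v i)\<^sup>2 + S (Suc i) / S (Suc (Suc i)) * (v (Suc i))\<^sup>2" by simp
  qed
  also have "\<dots> = (\<Sum>i<m. S (Suc (Suc i)) / S (Suc i) * (v i)\<^sup>2)
      + (\<Sum>i<m. S (Suc i) / S (Suc (Suc i)) * (v (Suc i))\<^sup>2)"
    by (simp add: sum.distrib)
  also have "(\<Sum>i<m. S (Suc (Suc i)) / S (Suc i) * (v i)\<^sup>2) = (\<Sum>i\<le>m. S (Suc (Suc i)) / S (Suc i) * (v i)\<^sup>2)"
    by (simp add: Sm flip: lessThan_Suc_atMost)
  also have "(\<Sum>i<m. S (Suc i) / S (Suc (Suc i)) * (v (Suc i))\<^sup>2) = (\<Sum>i\<le>m. S i / S (Suc i) * (v i)\<^sup>2)"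
    by (simp add: S0 sum.lessThan_Suc_shift flip: lessThan_Suc_atMost del: sum.lessThan_Suc)
  also have "(\<Sum>i\<le>m. S (Suc (Suc i)) / S (Suc i) * (v i)\<^sup>2) + \<dots> = (\<Sum>i\<le>m. 2 * cos h * (v i)\<^sup>2)"
    unfolding sum.distrib[symmetric]
  proof (rule sum.cong)
    fix i assume "i \<in> {..m}"
    then have "0 < S (Suc i)" using Spos by auto
    then show "S (Suc (Suc i)) / S (Suc i) * (v i)\<^sup>2 + S i / S (Suc i) * (v i)\<^sup>2 = 2 * cos h * (v i)\<^sup>2"
      using rec[of i] by (simp add: field_simps flip: distrib_right)
  qed simp
  finally show ?thesis by (simp add: h_def sum_distrib_left[symmetric] mult.assoc)
qed

text \<open>The factor on the right is the larger eigenvalue of the symmetric matrix with diagonal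
  p, r and off-diagonal entry q / 2. Subtracting the form leaves X a^2 - q a w + Y w^2 with 4 X Y =
  q^2, a degenerate form with nonnegative diagonal, hence a multiple of a square.\<close>

lemma quadratic_form_le:
  fixes p q r a w :: real
  shows "p * a\<^sup>2 + q * a * w + r * w\<^sup>2 \<le>
    (1 / 2 * (p + r) + 1 / 2 * sqrt ((p - r)\<^sup>2 + q\<^sup>2)) * (a\<^sup>2 + w\<^sup>2)"
proof -
  define S where "S = sqrt ((p - r)\<^sup>2 + q\<^sup>2)"
  define X where "X = (r - p + S) / 2"
  define Y where "Y = (p - r + S) / 2"
  have S: "\<bar>p - r\<bar> \<le> S" unfolding S_def by (rule real_le_rsqrt) auto
  have S2: "S\<^sup>2 = (p - r)\<^sup>2 + q\<^sup>2" by (simp add: S_def)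
  have XY: "0 \<le> X" "0 \<le> Y" using S by (auto simp: X_def Y_def)
  have prod: "4 * (X * Y) = q\<^sup>2" using S2 by (simp add: X_def Y_def field_simps power2_eq_square)
  have "0 \<le> X * a\<^sup>2 - q * a * w + Y * w\<^sup>2"
  proof (cases "X = 0")
    case True
    then show ?thesis using prod XY by simp
  next
    case False
    have "X * (X * a\<^sup>2 - q * a * w + Y * w\<^sup>2) = (X * a - q * w / 2)\<^sup>2 + (X * Y - q\<^sup>2 / 4) * w\<^sup>2"
      by (simp add: power2_eq_square field_simps)
    also have "\<dots> \<ge> 0" using prod by (simp add: field_simps)
    finally show ?thesis using False XY by (simp add: zero_le_mult_iff)
  qed
  then show ?thesis unfolding S_def[symmetric] by (simp add: X_def Y_def field_simps power2_eq_square)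
qed

text \<open>
  With \<open>y = 1 / |z|\<close> for a root \<open>z\<close>, the vector \<open>(y\<^sup>i)\<close> plays the role of an eigenvector of the
  companion matrix of the reversed polynomial; the bounds are estimates of its numerical radius.
\<close>

lemma no_root_if_lower_bound_4:
  assumes "0 < degree p" "s < lower_bound_4 p" "cmod z \<le> s"
  shows "poly p z \<noteq> 0"
proof
  assume root: "poly p z = 0"
  define N where "N = degree p"
  define m where "m = N - 1"
  define \<beta> where "\<beta> k = cmod (coeff p k / coeff p 0)" for k
  define y where "y = inverse (cmod z)"
  define b' where "b' = L2_set \<beta> {2..N}"
  define w where "w = L2_set (\<lambda>i. y ^ i) {..<m}"
  define V1 where "V1 = cos (pi / (N + 1)) + 1 / 2 * (\<beta> 1 + L2_set \<beta> {1..N})"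
  define V2 where "V2 = 1 / 2 * (\<beta> 1 + cos (pi / N)) + 1 / 2 * sqrt ((\<beta> 1 - cos (pi / N))\<^sup>2 + (1 + b')\<^sup>2)"
  have s: "0 \<le> s" using assms(3) norm_ge_zero order_trans by blast
  have N: "0 < N" "coeff p N \<noteq> 0" "N = Suc m" using assms(1) by (auto simp: N_def m_def)
  have a0: "coeff p 0 \<noteq> 0" using assms(2) s by (auto simp: lower_bound_4_def Let_def)
  have "z \<noteq> 0" using root a0 by (auto simp: poly_0_coeff_0)
  then have y: "0 < y" by (simp add: y_def)
  have \<beta>0: "0 \<le> \<beta> k" for k by (simp add: \<beta>_def)
  \<comment> \<open>The root expressions in V_1 and V_2, which are normalised by a_N, are Euclidean
    norms of the ratios a_k / a_0.\<close>
  have L2_eq: "cmod (coeff p N / coeff p 0) * sqrt (1 + (\<Sum>k=j..m. (cmod (coeff p k / coeff p N))\<^sup>2)) =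
      L2_set \<beta> {j..N}" if "j \<le> N" for j
  proof -
    have "cmod (coeff p N / coeff p 0) * sqrt (1 + (\<Sum>k=j..m. (cmod (coeff p k / coeff p N))\<^sup>2)) =
        sqrt ((\<beta> N)\<^sup>2 * (1 + (\<Sum>k=j..m. (cmod (coeff p k / coeff p N))\<^sup>2)))"
      by (simp add: real_sqrt_mult \<beta>_def)
    also have "(\<beta> N)\<^sup>2 * (1 + (\<Sum>k=j..m. (cmod (coeff p k / coeff p N))\<^sup>2)) = (\<Sum>k=j..N. (\<beta> k)\<^sup>2)"
      using N that by (simp add: \<beta>_def distrib_left sum_distrib_left norm_divide power_divide)
    finally show ?thesis by (simp add: L2_set_def)
  qed
  \<comment> \<open>For N = 1 the range {2..N} is empty and b' = 0, while the formula for V_2 still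
    contains |a_N / a_0|. So only b' \<le> c holds in general, which is the direction
    needed.\<close>
  define c where "c = cmod (coeff p N / coeff p 0) * sqrt (1 + (\<Sum>k=2..m. (cmod (coeff p k / coeff p N))\<^sup>2))"
  have b'_le: "b' \<le> c"
  proof (cases "2 \<le> N")
    case True
    then show ?thesis using L2_eq[of 2] by (simp add: b'_def c_def)
  qed (use N in \<open>auto simp: b'_def c_def intro!: mult_nonneg_nonneg real_sqrt_ge_zero\<close>)
  have split1: "L2_set \<beta> {1..N} = sqrt ((\<beta> 1)\<^sup>2 + b'\<^sup>2)"
    using N by (simp add: L2_set_def b'_def sum_nonneg sum.atLeast_Suc_atMost numeral_2_eq_2)
  \<comment> \<open>The root inequality is multiplied by y^N, Cauchy-Schwarz is applied to the
    indices k \<ge> 2, and a further factor y^m makes both sides quadratic in the vector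
    (y^i).\<close>
  have yN: "y * (y ^ m)\<^sup>2 \<le> \<beta> 1 * (y ^ m)\<^sup>2 + b' * y ^ m * w"
  proof -
    have "cmod (coeff p 0) \<le> (\<Sum>k=1..N. cmod (coeff p k) * cmod z ^ k)"
      unfolding N_def using root by (rule cmod_coeff_0_le_if_root)
    then have "1 \<le> (\<Sum>k=1..N. cmod (coeff p k) * cmod z ^ k) / cmod (coeff p 0)"
      using a0 by simp
    also have "\<dots> = (\<Sum>k=1..N. \<beta> k * cmod z ^ k)"
      by (simp add: \<beta>_def norm_divide sum_divide_distrib)
    finally have "y ^ N \<le> y ^ N * (\<Sum>k=1..N. \<beta> k * cmod z ^ k)" using y by simp
    also have "\<dots> = (\<Sum>k=1..N. \<beta> k * y ^ (N - k))"
      unfolding sum_distrib_left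
    proof (rule sum.cong)
      fix k assume "k \<in> {1..N}"
      then have "y ^ N = y ^ (N - k) * y ^ k" by (simp flip: power_add)
      moreover have "y ^ k * cmod z ^ k = 1" using \<open>z \<noteq> 0\<close> by (simp add: y_def flip: power_mult_distrib)
      ultimately show "y ^ N * (\<beta> k * cmod z ^ k) = \<beta> k * y ^ (N - k)"
        by (simp add: mult_ac)
    qed simp
    also have "\<dots> = \<beta> 1 * y ^ m + (\<Sum>k=2..N. \<beta> k * y ^ (N - k))"
      using N by (simp add: sum.atLeast_Suc_atMost numeral_2_eq_2)
    also have "(\<Sum>k=2..N. \<beta> k * y ^ (N - k)) \<le> L2_set \<beta> {2..N} * L2_set (\<lambda>k. y ^ (N - k)) {2..N}"
      using L2_set_mult_ineq[of \<beta> "\<lambda>k. y ^ (N - k)" "{2..N}"] y \<beta>0 by simp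
    also have "L2_set (\<lambda>k. y ^ (N - k)) {2..N} = w"
      unfolding w_def L2_set_def
      by (intro arg_cong[where f = sqrt] sum.reindex_bij_witness[of _ "\<lambda>i. N - i" "\<lambda>k. N - k"])
        (use N in auto)
    finally have "y ^ N * y ^ m \<le> (\<beta> 1 * y ^ m + b' * w) * y ^ m"
      using y by (intro mult_right_mono) (auto simp: b'_def)
    then show ?thesis using N by (simp add: power2_eq_square algebra_simps)
  qed
  have w2: "w\<^sup>2 = (\<Sum>i<m. (y ^ i)\<^sup>2)" by (simp add: w_def L2_set_def sum_nonneg)
  have nv: "(\<Sum>i\<le>m. (y ^ i)\<^sup>2) = (y ^ m)\<^sup>2 + w\<^sup>2"
    by (simp add: w2 flip: lessThan_Suc_atMost)
  \<comment> \<open>The part with i < m is the shift part of the companion matrix; the remaining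
    entry y (y^m)^2 is its coefficient row, estimated by \<open>yN\<close>.\<close>
  have eig: "y * ((y ^ m)\<^sup>2 + w\<^sup>2) = y * (y ^ m)\<^sup>2 + (\<Sum>i<m. y ^ i * y ^ Suc i)"
    unfolding w2 by (simp add: distrib_left sum_distrib_left power2_eq_square mult_ac)
  have pos: "0 < (y ^ m)\<^sup>2 + w\<^sup>2" using y by (intro add_pos_nonneg) auto
  have "y \<le> V1"
  proof -
    have "y * ((y ^ m)\<^sup>2 + w\<^sup>2) \<le> (\<beta> 1 * (y ^ m)\<^sup>2 + b' * y ^ m * w) +
        cos (pi / real (m + 2)) * ((y ^ m)\<^sup>2 + w\<^sup>2)"
      unfolding eig using sum_mult_Suc_le[of "\<lambda>i. y ^ i" m] yN unfolding nv by linarith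
    also have "\<beta> 1 * (y ^ m)\<^sup>2 + b' * y ^ m * w \<le> (1 / 2 * (\<beta> 1 + L2_set \<beta> {1..N})) * ((y ^ m)\<^sup>2 + w\<^sup>2)"
      using quadratic_form_le[of "\<beta> 1" "y ^ m" b' w 0] unfolding split1 by (simp add: algebra_simps)
    finally have "y * ((y ^ m)\<^sup>2 + w\<^sup>2) \<le> V1 * ((y ^ m)\<^sup>2 + w\<^sup>2)"
      using N by (simp add: V1_def algebra_simps)
    then show ?thesis using pos by simp
  qed
  moreover have "y \<le> V2"
  proof -
    \<comment> \<open>For V_2 the last coupling y^(m-1) y^m is moved into the off-diagonal entry,
      which becomes 1 + b'. The rest of the shift acts on m entries only, hence the angle pi / N
      instead of pi / (N + 1).\<close>
    have "(\<Sum>i<m. y ^ i * y ^ Suc i) \<le> cos (pi / N) * w\<^sup>2 + y ^ m * w"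
    proof (cases m)
      case 0
      then show ?thesis by (simp add: w_def)
    next
      case (Suc l)
      have "y ^ l \<le> w" unfolding w_def using Suc y
        by (intro member_le_L2_set) auto
      then have "y ^ l * y ^ m \<le> w * y ^ m" using y by (intro mult_right_mono) auto
      moreover have "(\<Sum>i<l. y ^ i * y ^ Suc i) \<le> cos (pi / N) * w\<^sup>2"
        using sum_mult_Suc_le[of "\<lambda>i. y ^ i" l] N Suc by (simp add: w2 lessThan_Suc_atMost)
      ultimately show ?thesis using Suc by (simp add: algebra_simps)
    qed
    then have "y * ((y ^ m)\<^sup>2 + w\<^sup>2) \<le> \<beta> 1 * (y ^ m)\<^sup>2 + (1 + b') * y ^ m * w + cos (pi / N) * w\<^sup>2"
      unfolding eig using yN by (simp add: algebra_simps)
    also have "\<dots> \<le> V2 * ((y ^ m)\<^sup>2 + w\<^sup>2)"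
      unfolding V2_def by (rule quadratic_form_le)
    finally show ?thesis using pos by simp
  qed
  ultimately have y_le: "y \<le> V1" "y \<le> V2" by auto
  define V2' where "V2' = 1 / 2 * (\<beta> 1 + cos (pi / N)) + 1 / 2 * sqrt ((\<beta> 1 - cos (pi / N))\<^sup>2 + (1 + c)\<^sup>2)"
  have "0 \<le> b'" by (simp add: b'_def)
  then have "V2 \<le> V2'" unfolding V2_def V2'_def using b'_le
    by (intro add_left_mono mult_left_mono real_sqrt_le_mono power_mono) auto
  then have V2': "y \<le> V2'" using y_le by simp
  have "cmod (coeff p N) / (2 * cmod (coeff p 0)) * (cmod (coeff p 1 / coeff p N) +
      sqrt (1 + (\<Sum>k=1..m. (cmod (coeff p k / coeff p N))\<^sup>2))) = 1 / 2 * (\<beta> 1 + L2_set \<beta> {1..N})"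
    using N a0 by (subst L2_eq[of 1, symmetric]) (auto simp: \<beta>_def norm_divide field_simps)
  then have V1': "V1 = cos (pi / (N + 1)) + cmod (coeff p N) / (2 * cmod (coeff p 0)) *
      (cmod (coeff p 1 / coeff p N) + sqrt (1 + (\<Sum>k=1..m. (cmod (coeff p k / coeff p N))\<^sup>2)))"
    by (simp only: V1_def)
  have "lower_bound_4 p = max (inverse V1) (inverse V2')"
    using a0 unfolding V1' V2'_def c_def \<beta>_def m_def N_def
    by (simp only: lower_bound_4_def Let_def if_False)
  also have "\<dots> \<le> inverse y"
    using y y_le V2' by (intro max.boundedI le_imp_inverse_le) auto
  finally show False using assms(2,3) by (simp add: y_def)
qed


section \<open>The Schur transform and the Schur-Cohn condition\<close>

lemma poly_eq_sum_le:
  fixes p :: "'a::comm_semiring_1 poly"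
  assumes "degree p \<le> N"
  shows "poly p x = (\<Sum>k\<le>N. coeff p k * x ^ k)"
  unfolding poly_altdef
  by (rule sum.mono_neutral_left) (use assms in \<open>auto simp: coeff_eq_0\<close>)

lemma schur_transform_degree:
  assumes "0 < N" shows "degree (schur_transform N p) \<le> N - 1"
  unfolding schur_transform_def
  by (rule degree_sum_le) (use assms in \<open>auto intro: order_trans[OF degree_monom_le]\<close>)

lemma star_eq:
  fixes p :: "complex poly"
  assumes "degree p \<le> N" "z \<noteq> 0"
  shows "z ^ N * cnj (poly p (1 / cnj z)) = (\<Sum>k\<le>N. cnj (coeff p (N - k)) * z ^ k)"
proof -
  have "poly p (1 / cnj z) = (\<Sum>k\<le>N. coeff p k * (1 / cnj z) ^ k)"
    using assms(1) by (rule poly_eq_sum_le)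
  then have "z ^ N * cnj (poly p (1 / cnj z)) = (\<Sum>k\<le>N. cnj (coeff p k) * (z ^ N * (1 / z) ^ k))"
    by (simp add: sum_distrib_left mult_ac)
  also have "\<dots> = (\<Sum>k\<le>N. cnj (coeff p k) * z ^ (N - k))"
    using assms(2) by (intro sum.cong) (auto simp: power_diff power_divide)
  also have "\<dots> = (\<Sum>k\<le>N. cnj (coeff p (N - k)) * z ^ k)"
    by (rule sum.reindex_bij_witness[of _ "\<lambda>k. N - k" "\<lambda>k. N - k"]) auto
  finally show ?thesis .
qed

lemma poly_schur_transform:
  assumes "degree p \<le> N" "z \<noteq> 0"
  shows "poly (schur_transform N p) z =
    cnj (coeff p 0) * poly p z - coeff p N * (z ^ N * cnj (poly p (1 / cnj z)))"
proof -
  have "cnj (coeff p 0) * poly p z - coeff p N * (z ^ N * cnj (poly p (1 / cnj z))) =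
      (\<Sum>k\<le>N. (cnj (coeff p 0) * coeff p k - coeff p N * cnj (coeff p (N - k))) * z ^ k)"
    unfolding star_eq[OF assms] poly_eq_sum_le[OF assms(1), of z]
    by (simp add: sum_distrib_left sum_subtractf algebra_simps)
  \<comment> \<open>The coefficient of z^N cancels: cnj a_0 a_N - a_N cnj a_0 = 0.\<close>
  also have "\<dots> = (\<Sum>k<N. (cnj (coeff p 0) * coeff p k - coeff p N * cnj (coeff p (N - k))) * z ^ k)"
    by (simp flip: lessThan_Suc_atMost)
  finally show ?thesis by (simp add: schur_transform_def poly_sum poly_monom)
qed

text \<open>Each root contributes a Blaschke factor: z cnj (1 / cnj z - w) = 1 - cnj w z, and |1 -
  cnj w z|^2 = |z - w|^2 - (|w|^2 - 1) (1 - |z|^2).\<close>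

lemma norm_prod_mset_reflect_le:
  fixes z :: complex
  assumes "\<forall>w\<in>#W. 1 < cmod w" "z \<noteq> 0" "cmod z \<le> 1"
  shows "cmod (z ^ size W * cnj (\<Prod>w\<in>#W. 1 / cnj z - w)) \<le> cmod (\<Prod>w\<in>#W. z - w)"
  using assms(1)
proof (induction W)
  case (add w W)
  have "(cmod (1 - cnj w * z))\<^sup>2 = (cmod (z - w))\<^sup>2 - ((cmod w)\<^sup>2 - 1) * (1 - (cmod z)\<^sup>2)"
    unfolding cmod_power2 by (simp add: power2_eq_square algebra_simps)
  also have "\<dots> \<le> (cmod (z - w))\<^sup>2"
  proof -
    have "1 \<le> (cmod w)\<^sup>2" "(cmod z)\<^sup>2 \<le> 1" using add.prems assms(3) by (auto simp: power_le_one one_le_power)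
    then show ?thesis by simp
  qed
  finally have 1: "cmod (1 - cnj w * z) \<le> cmod (z - w)" by (rule power2_le_imp_le) simp
  have eq: "z ^ size (add_mset w W) * cnj (\<Prod>w\<in>#add_mset w W. 1 / cnj z - w) =
      (1 - cnj w * z) * (z ^ size W * cnj (\<Prod>w\<in>#W. 1 / cnj z - w))"
    using assms(2) by (simp add: field_simps)
  show ?case unfolding eq using 1 add by (auto simp: norm_mult intro!: mult_mono)
qed auto

text \<open>All roots of q lie outside the closed unit disc, so the estimate holds factor by factor.
  The excess of the nominal degree N over the actual degree contributes only a power of z, of
  modulus at most 1.\<close>

lemma norm_star_le:
  fixes q :: "complex poly"
  assumes "degree q \<le> N" and no_root: "\<And>z. cmod z \<le> 1 \<Longrightarrow> poly q z \<noteq> 0"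
    and z: "z \<noteq> 0" "cmod z \<le> 1"
  shows "cmod (z ^ N * cnj (poly q (1 / cnj z))) \<le> cmod (poly q z)"
proof -
  have "q \<noteq> 0" using no_root[of 0] by auto
  then obtain W where W: "size W = degree q" "q = smult (lead_coeff q) (\<Prod>w\<in>#W. [:- w, 1:])"
    using alg_closed_imp_factorization by blast
  define c where "c = lead_coeff q"
  have q: "poly q x = c * (\<Prod>w\<in>#W. x - w)" for x
    by (subst W(2)) (simp add: c_def poly_prod_mset image_mset.compositionality o_def)
  have "1 < cmod w" if "w \<in># W" for w
  proof (rule ccontr)
    assume "\<not> 1 < cmod w"
    then have "poly q w \<noteq> 0" by (intro no_root) auto
    moreover have "(\<Prod>u\<in>#W. w - u) = 0" using that by (auto simp: prod_mset_zero_iff)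
    ultimately show False by (simp add: q)
  qed
  then have le: "cmod (z ^ size W * cnj (\<Prod>w\<in>#W. 1 / cnj z - w)) \<le> cmod (\<Prod>w\<in>#W. z - w)"
    using z by (intro norm_prod_mset_reflect_le) auto
  have "z ^ N * cnj (poly q (1 / cnj z)) =
      z ^ (N - size W) * (cnj c * (z ^ size W * cnj (\<Prod>w\<in>#W. 1 / cnj z - w)))"
    using assms(1) W(1) by (simp add: q mult_ac flip: power_add)
  also have "cmod \<dots> \<le> 1 * (cmod c * cmod (\<Prod>w\<in>#W. z - w))"
    unfolding norm_mult[of "z ^ (N - size W)"] norm_mult[of "cnj c"]
    using z le by (intro mult_mono) (auto simp: norm_power power_le_one)
  finally show ?thesis by (simp add: q norm_mult)
qed

text \<open>
  From \<open>T p = cnj a\<^sub>0 p - a\<^sub>N p\<^sup>*\<close> one gets \<open>(T p)\<^sup>* = a\<^sub>0 p\<^sup>* - cnj a\<^sub>N p\<close>, so at a root of \<open>p\<close> in the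
  disc \<open>|(T p)\<^sup>*| \<le> |T p|\<close> becomes \<open>|a\<^sub>0| \<le> |a\<^sub>N|\<close>, which contradicts \<open>T p (0) > 0\<close>.
\<close>

lemma no_root_schur_step:
  assumes N: "0 < N" "degree p \<le> N" and pos: "0 < Re (poly (schur_transform N p) 0)"
    and no_root: "\<And>z. cmod z \<le> 1 \<Longrightarrow> poly (schur_transform N p) z \<noteq> 0"
    and z: "cmod z \<le> 1"
  shows "poly p z \<noteq> 0"
proof
  assume root: "poly p z = 0"
  define q where "q = schur_transform N p"
  define s where "s = z ^ N * cnj (poly p (1 / cnj z))"
  have "poly q 0 = cnj (coeff p 0) * coeff p 0 - coeff p N * cnj (coeff p N)"
  proof -
    have "coeff q 0 = (\<Sum>k<N. if k = 0 then cnj (coeff p 0) * coeff p k - coeff p N * cnj (coeff p (N - k)) else 0)"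
      by (simp add: q_def schur_transform_def coeff_sum if_distrib cong: if_cong)
    then show ?thesis using N by (simp add: poly_0_coeff_0)
  qed
  also have "\<dots> = of_real ((cmod (coeff p 0))\<^sup>2 - (cmod (coeff p N))\<^sup>2)"
    by (simp only: of_real_diff complex_norm_square mult.commute)
  finally have "(cmod (coeff p N))\<^sup>2 < (cmod (coeff p 0))\<^sup>2" using pos by (simp add: q_def)
  then have lt: "cmod (coeff p N) < cmod (coeff p 0)" by (rule power2_less_imp_less) simp
  then have z0: "z \<noteq> 0" using root by (auto simp: poly_0_coeff_0)
  have q: "poly q z = - coeff p N * s"
    using poly_schur_transform[OF N(2) z0] root by (simp add: q_def s_def)
  \<comment> \<open>The reflection of 1 / cnj z is z itself, so the reflected term of the transform
    vanishes because z is a root.\<close>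
  have "poly q (1 / cnj z) = cnj (coeff p 0) * poly p (1 / cnj z)"
    using poly_schur_transform[OF N(2), of "1 / cnj z"] root z0 by (simp add: q_def)
  then have "z ^ N * cnj (poly q (1 / cnj z)) = coeff p 0 * s"
    by (simp add: s_def mult_ac)
  moreover have "cmod (z ^ N * cnj (poly q (1 / cnj z))) \<le> cmod (poly q z)"
    using schur_transform_degree[OF N(1), of p] no_root z0 z
    by (intro norm_star_le) (auto simp: q_def)
  ultimately have "cmod (coeff p 0) * cmod s \<le> cmod (coeff p N) * cmod s"
    using q by (simp add: norm_mult)
  moreover have "s \<noteq> 0" using q no_root[OF z] by (auto simp: q_def)
  ultimately show False using lt by simp
qed

text \<open>T^N p has degree 0 and a positive value, hence no zero. Zero-freeness is then passed
  down from T^(k+1) p to T^k p, each with its nominal degree N - k, until k = 0.\<close>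

lemma no_root_if_schur_cohn:
  assumes "schur_cohn p" "p \<noteq> 0" "cmod z \<le> 1"
  shows "poly p z \<noteq> 0"
proof (cases "degree p = 0")
  \<comment> \<open>For a constant the Schur-Cohn condition is vacuous; here only p \<noteq> 0
    excludes zeros.\<close>
  case True
  then show ?thesis using assms(2) by (auto elim!: degree_eq_zeroE)
next
  case False
  define N where "N = degree p"
  have pos: "0 < Re (poly (schur_iter p k) 0)" if "k \<in> {1..N}" for k
    using assms(1) that by (auto simp: schur_cohn_def N_def)
  have deg: "degree (schur_iter p k) \<le> N - k" if "k \<le> N" for k
    using that
  proof (induction k)
    case (Suc k)
    then show ?case using schur_transform_degree[of "N - k" "schur_iter p k"] by (simp add: N_def)
  qed (simp add: N_def)
  have "\<forall>z. cmod z \<le> 1 \<longrightarrow> poly (schur_iter p k) z \<noteq> 0" if "k \<le> N" for k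
    using that
  proof (induction k rule: inc_induct)
    case base
    have "degree (schur_iter p N) = 0" using deg[of N] by simp
    then obtain c where "schur_iter p N = [:c:]" by (auto elim: degree_eq_zeroE)
    then show ?case using pos[of N] False by (auto simp: N_def)
  next
    case (step k)
    have pos_k: "0 < Re (poly (schur_transform (N - k) (schur_iter p k)) 0)"
      using pos[of "Suc k"] step(2) by (simp add: N_def)
    have IH: "poly (schur_transform (N - k) (schur_iter p k)) z \<noteq> 0" if "cmod z \<le> 1" for z
      using step(3) that by (simp add: N_def)
    show ?case
      using no_root_schur_step[OF _ _ pos_k IH] step(2) deg[of k] by simp
  qed
  from this[of 0] show ?thesis using assms(3) by simp
qed

lemma no_root_if_lower_bound_exceeds:
  assumes "some_lower_bound_exceeds p s" "cmod z \<le> s"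
  shows "poly p z \<noteq> 0"
  using assms no_root_if_lower_bound_1 no_root_if_lower_bound_2 no_root_if_lower_bound_3
    no_root_if_lower_bound_4
  unfolding some_lower_bound_exceeds_def by blast

section \<open>The sector and the encompassing circle\<close>

text \<open>For |\<phi>| \<le> \<theta> < pi / 2 the inequality sin (\<theta> - |\<phi>|) \<ge> 0 is
  the slope condition. Conversely the angle is \<open>Arg\<close> of z - \<rho>, replaced by 0 at
  the vertex.\<close>

lemma sector_iff:
  assumes "0 \<le> \<theta>" "\<theta> < pi / 2"
  shows "z \<in> sector \<rho> \<theta> \<longleftrightarrow> \<rho> \<le> Re z \<and> \<bar>Im z\<bar> \<le> (Re z - \<rho>) * tan \<theta>"
proof
  assume "z \<in> sector \<rho> \<theta>"
  then obtain r \<phi> where z: "z = of_real \<rho> + of_real r * cis \<phi>" "0 \<le> r" "\<bar>\<phi>\<bar> \<le> \<theta>"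
    by (auto simp: sector_def)
  have c: "0 < cos \<theta>" using assms by (intro cos_gt_zero_pi) auto
  have c': "0 < cos \<phi>" using assms z(3) by (intro cos_gt_zero_pi) auto
  have "0 \<le> sin (\<theta> - \<bar>\<phi>\<bar>)" using assms z(3) by (intro sin_ge_zero) auto
  then have "\<bar>sin \<phi>\<bar> * cos \<theta> \<le> cos \<phi> * sin \<theta>"
  proof -
    have "\<bar>sin \<phi>\<bar> = sin \<bar>\<phi>\<bar>"
      using assms z(3) sin_ge_zero[of "\<bar>\<phi>\<bar>"] by (cases "0 \<le> \<phi>") auto
    with \<open>0 \<le> sin (\<theta> - \<bar>\<phi>\<bar>)\<close> show ?thesis by (simp add: sin_diff mult.commute)
  qed
  then have "\<bar>sin \<phi>\<bar> \<le> cos \<phi> * tan \<theta>" using c by (simp add: tan_def field_simps)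
  then have "r * \<bar>sin \<phi>\<bar> \<le> r * (cos \<phi> * tan \<theta>)" using z(2) by (intro mult_left_mono)
  then show "\<rho> \<le> Re z \<and> \<bar>Im z\<bar> \<le> (Re z - \<rho>) * tan \<theta>"
    using z(1,2) c' by (auto simp: abs_mult mult.assoc)
next
  assume z: "\<rho> \<le> Re z \<and> \<bar>Im z\<bar> \<le> (Re z - \<rho>) * tan \<theta>"
  define w where "w = z - of_real \<rho>"
  have tan0: "0 \<le> tan \<theta>" using assms by (intro tan_pos_pi2_le) auto
  have "\<bar>Arg w\<bar> \<le> \<theta>" if "w \<noteq> 0"
  proof -
    have re: "0 < Re w" using z that by (cases "Re w = 0") (auto simp: w_def complex_eq_iff)
    have "\<bar>Im w / Re w\<bar> \<le> tan \<theta>" using z re by (simp add: w_def abs_divide field_simps)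
    then have "Im w / Re w \<le> tan \<theta>" "- tan \<theta> \<le> Im w / Re w" by linarith+
    then have "arctan (Im w / Re w) \<le> arctan (tan \<theta>)" "arctan (- tan \<theta>) \<le> arctan (Im w / Re w)"
      by (simp_all only: arctan_le_iff)
    moreover have "arctan (tan \<theta>) = \<theta>" using assms by (intro arctan_tan) auto
    ultimately show ?thesis using re by (simp add: arg_conv_arctan arctan_minus)
  qed
  then have "\<bar>if w = 0 then 0 else Arg w\<bar> \<le> \<theta>" using assms by auto
  moreover have "z = of_real \<rho> + of_real (cmod w) * cis (if w = 0 then 0 else Arg w)" "0 \<le> cmod w"
    using rcis_cmod_Arg[of w] by (auto simp: w_def rcis_def)
  ultimately show "z \<in> sector \<rho> \<theta>" unfolding sector_def by blast
qed

lemma Re_phi: "Re (phi Q z) = exp (- Re z / Q) * cos (Im z / Q)"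
  and Im_phi: "Im (phi Q z) = - exp (- Re z / Q) * sin (Im z / Q)"
  and norm_phi: "cmod (phi Q z) = exp (- Re z / Q)"
  by (simp_all add: phi_def Re_exp Im_exp)

text \<open>\<open>O\<^sub>1\<close> is characterised by \<open>r = |C - a|\<^sup>2 / (2 (a - Re C))\<close>, where \<open>a = \<phi>(\<rho>)\<close>.\<close>

lemma circle_radius_eq:
  fixes Q :: nat and x \<rho> \<theta> :: real
  assumes "0 < Q" "0 < x"
  defines "a \<equiv> exp (- \<rho> / Q)" and "C \<equiv> phi Q (Complex (\<rho> + x) (x * tan \<theta>))"
  shows "circle_radius Q \<rho> \<theta> x = (cmod (C - of_real a))\<^sup>2 / (2 * (a - Re C))"
    and "Re C < a" and "0 < circle_radius Q \<rho> \<theta> x"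
proof -
  have "cmod C < a" 
  proof -
    have "- (\<rho> + x) / Q < - \<rho> / Q" using assms(1,2) by (intro divide_strict_right_mono) auto
    then show ?thesis by (simp add: C_def norm_phi a_def)
  qed
  then show less: "Re C < a" using complex_Re_le_cmod[of C] by linarith
  have a: "Re (phi Q (of_real \<rho>)) = a" by (simp add: Re_phi a_def)
  have a2: "Re (phi Q (of_real (2 * \<rho>))) = a\<^sup>2"
    by (simp add: Re_phi a_def power2_eq_square flip: exp_add add_divide_distrib)
  have cc: "circle_center Q \<rho> \<theta> x = (a\<^sup>2 - (Re C)\<^sup>2 - (Im C)\<^sup>2) / (2 * (a - Re C))"
    unfolding circle_center_def Let_def a a2 C_def[symmetric] ..
  show eq: "circle_radius Q \<rho> \<theta> x = (cmod (C - of_real a))\<^sup>2 / (2 * (a - Re C))"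
    unfolding circle_radius_def a cc cmod_power2 using less
    by (simp add: field_simps power2_eq_square)
  have "C \<noteq> of_real a" using less by auto
  then show "0 < circle_radius Q \<rho> \<theta> x" unfolding eq using less by auto
qed

text \<open>The circle with centre a - r and radius r passes through a. In this form the condition
  on w is linear in r, and therefore monotone in r as long as Re w \<le> a.\<close>

lemma mem_real_disc_iff:
  "cmod (w - of_real (a - r)) \<le> r \<longleftrightarrow> (cmod (w - of_real a))\<^sup>2 \<le> 2 * r * (a - Re w)" if "0 \<le> r"
proof -
  have "cmod (w - of_real (a - r)) \<le> r \<longleftrightarrow> (cmod (w - of_real (a - r)))\<^sup>2 \<le> r\<^sup>2"
    using that by (metis abs_le_square_iff abs_norm_cancel abs_of_nonneg)
  also have "(cmod (w - of_real (a - r)))\<^sup>2 = (cmod (w - of_real a))\<^sup>2 - 2 * r * (a - Re w) + r\<^sup>2"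
    unfolding cmod_power2 by (simp add: power2_eq_square algebra_simps)
  finally show ?thesis by simp
qed

text \<open>For \<theta> = 0 the sector is a ray and every x > 0 competes. The radius
  (\<phi>(\<rho>) - \<phi>(\<rho> + x)) / 2 then increases strictly, so no maximiser exists.\<close>

lemma is_x_d_theta_pos:
  assumes "0 < Q" "0 \<le> \<theta>" "is_x_d Q \<rho> \<theta> x"
  shows "\<theta> \<noteq> 0"
proof
  assume [simp]: "\<theta> = 0"
  have c: "circle_center Q \<rho> 0 y - Re (phi Q (of_real \<rho>)) = - circle_radius Q \<rho> 0 y" for y
    by (simp add: circle_radius_def)
  have r: "circle_radius Q \<rho> 0 y = (exp (- \<rho> / Q) - exp (- (\<rho> + y) / Q)) / 2" if "0 < y" for y
  proof -
    define E1 E2 where E: "E1 = exp (- \<rho> / Q)" "E2 = exp (- (\<rho> + y) / Q)"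
    have "phi Q (Complex (\<rho> + y) (y * tan 0)) = of_real E2"
      by (intro complex_eqI) (auto simp: Re_phi Im_phi E)
    then have "circle_radius Q \<rho> 0 y = (cmod (of_real E2 - of_real E1))\<^sup>2 / (2 * (E1 - E2))" "E2 < E1"
      using circle_radius_eq(1,2)[OF assms(1) that, of \<rho> 0] by (simp_all add: E(1))
    then have "circle_radius Q \<rho> 0 y = (E1 - E2) / 2"
      by (simp only: norm_of_real flip: of_real_diff) (simp add: divide_simps power2_eq_square algebra_simps)
    then show ?thesis by (simp add: E)
  qed
  have x: "0 < x" "\<not> (\<exists>y>0. circle_radius Q \<rho> 0 x < circle_radius Q \<rho> 0 y)"
  proof -
    have "\<not> (\<exists>y>0. \<bar>circle_radius Q \<rho> 0 x\<bar> < \<bar>circle_radius Q \<rho> 0 y\<bar>)" and "0 < x"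
      using assms by (auto simp: is_x_d_def is_arg_max_def c)
    then show "0 < x" "\<not> (\<exists>y>0. circle_radius Q \<rho> 0 x < circle_radius Q \<rho> 0 y)"
      using circle_radius_eq(3)[OF assms(1), of _ \<rho> 0] by (auto simp: abs_of_pos)
  qed
  have "circle_radius Q \<rho> 0 x < circle_radius Q \<rho> 0 (x + 1)"
    using x(1) assms(1) by (simp add: r divide_strict_right_mono)
  then show False using x by (metis add_pos_pos zero_less_one)
qed

text \<open>Maximality speaks only of the spiral points C y with 0 < y < L = Q pi / tan \<theta>,
  before the spiral has made half a turn. The limit y -> L gives r \<ge> a (1 + e) / 2, so the disc
  also contains all |w| \<le> e a, and the image of the points with |Im z| \<ge> Q pi lies there.
  Every other image point lies on a segment from 0 to a spiral point.\<close>

lemma is_x_d_disc: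
  assumes "0 < Q" "0 \<le> \<theta>" "\<theta> < pi / 2" and x: "is_x_d Q \<rho> \<theta> x" and z: "z \<in> sector \<rho> \<theta>"
  shows "cmod (phi Q z - of_real (circle_center Q \<rho> \<theta> x)) \<le> circle_radius Q \<rho> \<theta> x"
proof -
  define k where "k = tan \<theta>"
  define r where "r = circle_radius Q \<rho> \<theta> x"
  define a where "a = exp (- \<rho> / Q)"
  define L where "L = Q * pi / k"
  have "0 < \<theta>" using is_x_d_theta_pos[OF assms(1,2) x] assms(2) by simp
  then have k: "0 < k" unfolding k_def using assms(3) by (intro tan_gt_zero)
  have L: "0 < L" using k assms(1) by (simp add: L_def)
  have a0: "0 < a" by (simp add: a_def)
  have center: "circle_center Q \<rho> \<theta> x = a - r"
    by (simp add: r_def circle_radius_def Re_phi a_def)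
  have c: "circle_center Q \<rho> \<theta> y - Re (phi Q (of_real \<rho>)) = - circle_radius Q \<rho> \<theta> y" for y
    by (simp add: circle_radius_def)
  have x0: "0 < x" using x by (auto simp: is_x_d_def is_arg_max_def)
  have r0: "0 < r" using circle_radius_eq(3)[OF assms(1) x0] by (simp add: r_def)
  have r_ge: "circle_radius Q \<rho> \<theta> y \<le> r" if "0 < y" "y < L" for y
  proof -
    have "y * tan \<theta> < Q * pi" using that k by (simp add: L_def k_def field_simps)
    then have "\<bar>circle_radius Q \<rho> \<theta> y\<bar> \<le> \<bar>circle_radius Q \<rho> \<theta> x\<bar>"
      using x that by (auto simp: is_x_d_def is_arg_max_linorder c)
    then show ?thesis using circle_radius_eq(3)[OF assms(1), of _ \<rho> \<theta>] r0 by (auto simp: r_def)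
  qed
  define C where "C y = phi Q (Complex (\<rho> + y) (y * k))" for y
  have C_le: "(cmod (C y - of_real a))\<^sup>2 \<le> 2 * r * (a - Re (C y))" if y: "0 < y" "y < L" for y
  proof -
    have "Re (C y) < a" "(cmod (C y - of_real a))\<^sup>2 / (2 * (a - Re (C y))) \<le> r"
      using circle_radius_eq(1,2)[OF assms(1) y(1), of \<rho> \<theta>] r_ge[OF y]
      by (auto simp: C_def k_def a_def)
    then show ?thesis by (simp add: field_simps)
  qed
  \<comment> \<open>The factor by which the spiral has shrunk after half a turn, where it meets the
    negative real axis at - e a.\<close>
  define e where "e = exp (- pi / k)"
  have e: "0 < e" "e < 1" using k by (auto simp: e_def)
  have "(cmod (C L - of_real a))\<^sup>2 \<le> 2 * r * (a - Re (C L))"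
  proof -
    have cont: "isCont C L" unfolding C_def phi_def complex_eq_cancel_iff2
      by (auto simp: Complex_eq intro!: continuous_intros simp: assms(1))
    have "((\<lambda>y. 2 * r * (a - Re (C y)) - (cmod (C y - of_real a))\<^sup>2)
        \<longlongrightarrow> 2 * r * (a - Re (C L)) - (cmod (C L - of_real a))\<^sup>2) (at_left L)"
      using cont by (intro tendsto_intros) (auto simp: isCont_def intro: tendsto_within_subset)
    moreover have "\<forall>\<^sub>F y in at_left L. 0 \<le> 2 * r * (a - Re (C y)) - (cmod (C y - of_real a))\<^sup>2"
      using eventually_at_left_real[OF L] by eventually_elim (use C_le in auto)
    ultimately have "0 \<le> 2 * r * (a - Re (C L)) - (cmod (C L - of_real a))\<^sup>2"
      by (rule tendsto_lowerbound) simp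
    then show ?thesis by simp
  qed
  moreover have "C L = of_real (- (e * a))"
  proof -
    have "Q * pi / k / Q = pi / k" "L * k / Q = pi" using k assms(1) by (auto simp: L_def)
    then show ?thesis
      by (intro complex_eqI)
        (simp_all add: C_def Re_phi Im_phi a_def e_def L_def add_divide_distrib exp_add[symmetric] diff_divide_distrib)
  qed
  moreover have "cmod (of_real (- (e * a)) - of_real a) = a * (1 + e)"
  proof -
    have "- (e * a) - a = - (a * (1 + e))" by (simp add: algebra_simps)
    moreover have "0 < a * (1 + e)" using e a0 by (intro mult_pos_pos) auto
    ultimately show ?thesis by (simp only: norm_of_real abs_minus_cancel abs_of_pos flip: of_real_diff)
  qed
  ultimately have "(a * (1 + e)) * (a * (1 + e)) \<le> 2 * r * (a * (1 + e))"
    by (simp add: power2_eq_square algebra_simps)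
  moreover have ae: "0 < a * (1 + e)" using e a0 by (intro mult_pos_pos) auto
  ultimately have r2: "a * (1 + e) \<le> 2 * r" using mult_le_cancel_right_pos by blast
  \<comment> \<open>The claim is |a - r| + e a \<le> r: for r \<le> a this is 2 r \<ge> a (1 + e),
    otherwise it follows from e \<le> 1.\<close>
  have small: "cmod (w - of_real (a - r)) \<le> r" if "cmod w \<le> e * a" for w
  proof -
    have "cmod (w - of_real (a - r)) \<le> cmod w + \<bar>a - r\<bar>"
      using norm_triangle_ineq4[of w "of_real (a - r)"] by (simp only: norm_of_real)
    also have "\<dots> \<le> r"
    proof (cases "r \<le> a")
      case True
      then show ?thesis using r2 that by (simp add: algebra_simps)
    next
      case False
      have "e * a \<le> 1 * a" using e a0 by (intro mult_right_mono) auto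
      then show ?thesis using False that by simp
    qed
    finally show ?thesis .
  qed
  have zs: "\<rho> \<le> Re z" "\<bar>Im z\<bar> \<le> (Re z - \<rho>) * k"
    using z by (auto simp: sector_iff[OF assms(2,3)] k_def)
  define u where "u = Re z - \<rho>"
  show ?thesis
  proof (cases "Q * pi \<le> \<bar>Im z\<bar>")
    case True
    then have "pi / k \<le> u / Q" using zs k assms(1) by (simp add: u_def field_simps)
    then have "cmod (phi Q z) \<le> e * a"
      by (simp add: norm_phi e_def a_def u_def diff_divide_distrib flip: exp_add)
    then show ?thesis unfolding center r_def[symmetric] by (rule small)
  next
    case False
    define y where "y = \<bar>Im z\<bar> / k"
    have y: "0 \<le> y" "y < L" "y \<le> u" "y * k = \<bar>Im z\<bar>"
      using False k zs assms(1) by (auto simp: y_def L_def u_def field_simps)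
    define w where "w = phi Q (Complex (\<rho> + y) (Im z))"
    have w_le: "cmod (w - of_real (a - r)) \<le> r"
    proof (cases "y = 0")
      case True
      then have "w = of_real a" using y by (intro complex_eqI) (auto simp: w_def Re_phi Im_phi a_def)
      then show ?thesis using r0 by simp
    next
      case F: False
      have "w = C y \<or> w = cnj (C y)"
        unfolding complex_eq_iff using y(4)
        by (cases "0 \<le> Im z") (auto simp: w_def C_def Re_phi Im_phi)
      moreover have "cmod (cnj (C y) - of_real a) = cmod (C y - of_real a)"
        by (metis complex_cnj_complex_of_real complex_cnj_diff complex_mod_cnj)
      ultimately show ?thesis using C_le[of y] y F r0
        by (subst mem_real_disc_iff) auto
    qed
    \<comment> \<open>Moving right from the boundary point with the same imaginary part multiplies
      \<open>phi\<close> by s in [0, 1]. So the image of z is the convex combination of w and 0 with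
      weights s and 1 - s, and both end points lie in the disc.\<close>
    define s where "s = exp (- (u - y) / Q)"
    have s: "0 \<le> s" "s \<le> 1" using y assms(1) by (auto simp: s_def divide_le_0_iff)
    have zw: "phi Q z = of_real s * w"
      unfolding w_def s_def u_def
      by (intro complex_eqI) (simp_all add: Re_phi Im_phi diff_divide_distrib add_divide_distrib flip: exp_add mult.assoc)
    have "phi Q z - of_real (a - r) = of_real s * (w - of_real (a - r)) - of_real (1 - s) * of_real (a - r)"
      unfolding zw by (simp add: algebra_simps)
    also have "cmod \<dots> \<le> s * cmod (w - of_real (a - r)) + (1 - s) * cmod (0 - of_real (a - r))"
      using s by (intro order_trans[OF norm_triangle_ineq4]) (simp add: norm_mult del: of_real_diff)
    also have "\<dots> \<le> s * r + (1 - s) * r"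
      using s e a0 by (intro add_mono mult_left_mono w_le small) auto
    finally show ?thesis unfolding center r_def[symmetric] by (simp add: algebra_simps)
  qed
qed

section \<open>The function B and its admissible sectors\<close>

lemma poly_assoc_poly:
  assumes "\<And>k. k \<in> {1..n} \<Longrightarrow> 0 < \<mu> k \<and> t k = real_of_int (lam k) / real (\<mu> k) \<and> 0 < t k"
  shows "poly (assoc_poly n \<alpha> lam \<mu>) (phi (denom_lcm n \<mu>) z) = B_fun n \<alpha> t z"
    and "0 < denom_lcm n \<mu>" and "poly (assoc_poly n \<alpha> lam \<mu>) 0 = 1"
proof -
  define Q where "Q = denom_lcm n \<mu>"
  have "0 \<notin> \<mu> ` {1..n}" using assms by (metis imageE less_irrefl)
  then have "Q \<noteq> 0" by (auto simp: Q_def denom_lcm_def Lcm_0_iff)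
  then show Q: "0 < denom_lcm n \<mu>" by (simp add: Q_def)
  have ck: "real (c_exp n lam \<mu> k) = Q * t k" "0 < c_exp n lam \<mu> k" if k: "k \<in> {1..n}" for k
  proof -
    have "\<mu> k dvd Q" using k by (auto simp: Q_def denom_lcm_def)
    then obtain j where j: "Q = \<mu> k * j" by (elim dvdE)
    have "0 < real_of_int (lam k) / real (\<mu> k)" using assms[OF k] by metis
    then have "0 < lam k" using assms[OF k] by (simp add: zero_less_divide_iff)
    moreover have "c_exp n lam \<mu> k = nat (int j * lam k)"
      using assms[OF k] by (simp add: c_exp_def Q_def[symmetric] j)
    moreover have "0 < j" using j \<open>Q \<noteq> 0\<close> by (cases "j = 0") auto
    ultimately show "real (c_exp n lam \<mu> k) = Q * t k" "0 < c_exp n lam \<mu> k"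
      using assms[OF k] j by (auto simp: field_simps)
  qed
  have "phi Q z ^ c_exp n lam \<mu> k = exp (- of_real (t k) * z)" if k: "k \<in> {1..n}" for k
  proof -
    have "phi Q z ^ c_exp n lam \<mu> k = exp (of_real (real (c_exp n lam \<mu> k)) * (- z / Q))"
      by (simp add: phi_def flip: exp_of_nat_mult)
    then show ?thesis using \<open>Q \<noteq> 0\<close> unfolding ck[OF k] by simp
  qed
  then show "poly (assoc_poly n \<alpha> lam \<mu>) (phi (denom_lcm n \<mu>) z) = B_fun n \<alpha> t z"
    by (simp add: assoc_poly_def B_fun_def poly_sum poly_monom Q_def[symmetric])
  show "poly (assoc_poly n \<alpha> lam \<mu>) 0 = 1"
    using ck(2) by (auto simp: assoc_poly_def poly_sum poly_monom intro!: sum.neutral)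
qed

text \<open>Used with \<tau> = \<open>t 1\<close>: it shows that B - 1 decays like exp (- t_1 z),
  the exponential that is later split off from 1 / B - 1.\<close>

lemma B_fun_norm_le:
  assumes t: "\<And>k. k \<in> {1..n} \<Longrightarrow> \<tau> \<le> t k" and z: "R \<le> Re z"
  shows "cmod (B_fun n \<alpha> t z - 1) \<le> exp (- \<tau> * Re z) * (\<Sum>k=1..n. cmod (\<alpha> k) * exp (- (t k - \<tau>) * R))"
proof -
  have "cmod (B_fun n \<alpha> t z - 1) \<le> (\<Sum>k=1..n. cmod (\<alpha> k) * exp (- t k * Re z))"
    unfolding B_fun_def by (simp, rule order_trans[OF norm_sum]) (simp add: norm_mult)
  also have "\<dots> = exp (- \<tau> * Re z) * (\<Sum>k=1..n. cmod (\<alpha> k) * exp (- (t k - \<tau>) * Re z))"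
    by (simp add: sum_distrib_left mult_ac exp_add[symmetric] algebra_simps)
  also have "\<dots> \<le> exp (- \<tau> * Re z) * (\<Sum>k=1..n. cmod (\<alpha> k) * exp (- (t k - \<tau>) * R))"
  proof (intro mult_left_mono sum_mono)
    fix k assume "k \<in> {1..n}"
    then have "(t k - \<tau>) * R \<le> (t k - \<tau>) * Re z" using t z by (intro mult_left_mono) auto
    then show "exp (- (t k - \<tau>) * Re z) \<le> exp (- (t k - \<tau>) * R)"
      unfolding exp_le_cancel_iff mult_minus_left by simp
  qed auto
  finally show ?thesis .
qed

lemma B_fun_far:
  assumes t: "\<And>k. k \<in> {1..n} \<Longrightarrow> 0 < t k"
  obtains R where "\<And>z. R \<le> Re z \<Longrightarrow> cmod (B_fun n \<alpha> t z - 1) \<le> 1 / 2"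
proof -
  have "((\<lambda>x. \<Sum>k=1..n. cmod (\<alpha> k) * exp (- t k * x)) \<longlongrightarrow> (\<Sum>k=1..n. cmod (\<alpha> k) * 0)) at_top"
  proof (intro tendsto_intros)
    fix k assume "k \<in> {1..n}"
    then have "0 < t k" by (rule t)
    then show "((\<lambda>x. exp (- t k * x)) \<longlongrightarrow> 0) at_top" by real_asymp
  qed
  then have "\<forall>\<^sub>F x in at_top. (\<Sum>k=1..n. cmod (\<alpha> k) * exp (- t k * x)) < 1 / 2"
    by (rule order_tendstoD) auto
  then obtain R where R: "\<And>x. R \<le> x \<Longrightarrow> (\<Sum>k=1..n. cmod (\<alpha> k) * exp (- t k * x)) < 1 / 2"
    by (auto simp: eventually_at_top_linorder)
  have "cmod (B_fun n \<alpha> t z - 1) \<le> (\<Sum>k=1..n. cmod (\<alpha> k) * exp (- t k * Re z))" for z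
    unfolding B_fun_def by (simp, rule order_trans[OF norm_sum]) (simp add: norm_mult)
  with R show ?thesis by (intro that[of R]) (meson less_imp_le order_trans)
qed

lemma B_fun_holomorphic: "B_fun n \<alpha> t holomorphic_on S"
  unfolding B_fun_def by (intro holomorphic_intros)

text \<open>Otherwise each of a sequence of sectors shrinking to the given one contains a zero of B.
  These zeros have bounded real part because B is close to 1 far to the right, and bounded imaginary
  part because the angles stay below \<theta>' 0 < pi / 2. A limit point is a zero of B in the
  original sector.\<close>

lemma admissible_sector_exists:
  assumes \<theta>: "0 \<le> \<theta>" "\<theta> < pi / 2" and t: "\<And>k. k \<in> {1..n} \<Longrightarrow> 0 < t k"
    and nz: "\<And>z. z \<in> sector \<rho> \<theta> \<Longrightarrow> B_fun n \<alpha> t z \<noteq> 0"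
  shows "\<exists>\<rho>' \<theta>'. admissible_sector \<rho> \<theta> n \<alpha> t \<rho>' \<theta>'"
proof -
  define \<rho>' where "\<rho>' j = \<rho> - 1 / real (Suc j)" for j :: nat
  define \<theta>' where "\<theta>' j = \<theta> + (pi / 2 - \<theta>) / real (j + 2)" for j :: nat
  have \<theta>': "\<theta> < \<theta>' j" "\<theta>' j < pi / 2" "\<theta>' j \<le> \<theta>' 0" for j
  proof -
    show "\<theta> < \<theta>' j" using \<theta> by (simp add: \<theta>'_def)
    have "(pi / 2 - \<theta>) / real (j + 2) \<le> (pi / 2 - \<theta>) / 2"
      using \<theta> by (intro divide_left_mono) auto
    then show "\<theta>' j \<le> \<theta>' 0" by (simp add: \<theta>'_def)
    have "(pi / 2 - \<theta>) / real (j + 2) < (pi / 2 - \<theta>) / 1"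
      using \<theta> by (intro divide_strict_left_mono) auto
    then show "\<theta>' j < pi / 2" unfolding \<theta>'_def div_by_1 by linarith
  qed
  have "\<exists>j. \<forall>z\<in>sector (\<rho>' j) (\<theta>' j). B_fun n \<alpha> t z \<noteq> 0"
  proof (rule ccontr)
    assume "\<not> ?thesis"
    then obtain z where z: "\<And>j. z j \<in> sector (\<rho>' j) (\<theta>' j)" "\<And>j. B_fun n \<alpha> t (z j) = 0"
      by metis
    have z': "\<rho>' j \<le> Re (z j)" "\<bar>Im (z j)\<bar> \<le> (Re (z j) - \<rho>' j) * tan (\<theta>' j)" for j
      using z(1)[of j] \<theta>'(1,2)[of j] \<theta> by (auto simp: sector_iff)
    obtain R where R: "\<And>z. R \<le> Re z \<Longrightarrow> cmod (B_fun n \<alpha> t z - 1) \<le> 1 / 2"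
      using B_fun_far[of n t \<alpha>, OF t] by blast
    have ReR: "Re (z j) \<le> R" for j using R[of "z j"] z(2)[of j] by fastforce
    have "bounded (range z)"
    proof (rule boundedI)
      fix w assume "w \<in> range z"
      then obtain j where w: "w = z j" by auto
      have \<rho>j: "\<rho> - 1 \<le> \<rho>' j" by (simp add: \<rho>'_def)
      have "tan (\<theta>' j) \<le> tan (\<theta>' 0)" using \<theta>'[of j] \<theta>'[of 0] \<theta> by (intro tan_mono_le) auto
      moreover have "0 \<le> tan (\<theta>' j)" using \<theta>'[of j] \<theta> by (intro tan_pos_pi2_le) auto
      ultimately have "(Re (z j) - \<rho>' j) * tan (\<theta>' j) \<le> (R - \<rho> + 1) * tan (\<theta>' 0)"
        using \<rho>j ReR[of j] z'(1)[of j] by (intro mult_mono) auto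
      then have "\<bar>Im (z j)\<bar> \<le> (R - \<rho> + 1) * tan (\<theta>' 0)" using z'(2)[of j] by simp
      moreover have "\<bar>Re (z j)\<bar> \<le> \<bar>\<rho>\<bar> + 1 + \<bar>R\<bar>" using \<rho>j ReR[of j] z'(1)[of j] by linarith
      ultimately show "norm w \<le> \<bar>\<rho>\<bar> + 1 + \<bar>R\<bar> + (R - \<rho> + 1) * tan (\<theta>' 0)"
        using cmod_le[of "z j"] unfolding w by linarith
    qed
    then obtain l s where s: "strict_mono (s :: nat \<Rightarrow> nat)" and l: "(z \<circ> s) \<longlonglongrightarrow> l"
      using bounded_imp_convergent_subsequence by blast
    have "\<rho>' \<longlonglongrightarrow> \<rho> - 0" unfolding \<rho>'_def
      by (intro tendsto_intros LIMSEQ_inverse_real_of_nat[unfolded inverse_eq_divide])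
    then have \<rho>l: "(\<rho>' \<circ> s) \<longlonglongrightarrow> \<rho>" using s LIMSEQ_subseq_LIMSEQ by force
    have "\<theta>' \<longlonglongrightarrow> \<theta>" unfolding \<theta>'_def by real_asymp
    then have \<theta>l: "(\<theta>' \<circ> s) \<longlonglongrightarrow> \<theta>" using s LIMSEQ_subseq_LIMSEQ by blast
    have "cos \<theta> \<noteq> 0" using \<theta> cos_gt_zero_pi[of \<theta>] by auto
    then have tl: "(\<lambda>j. tan ((\<theta>' \<circ> s) j)) \<longlonglongrightarrow> tan \<theta>"
      by (intro isCont_tendsto_compose[OF isCont_tan \<theta>l])
    have 1: "\<rho> \<le> Re l"
      using \<rho>l tendsto_Re[OF l] by (rule LIMSEQ_le) (use z'(1) in auto)
    have 2: "\<bar>Im l\<bar> \<le> (Re l - \<rho>) * tan \<theta>"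
    proof (rule LIMSEQ_le)
      show "(\<lambda>j. \<bar>Im ((z \<circ> s) j)\<bar>) \<longlonglongrightarrow> \<bar>Im l\<bar>" using l by (intro tendsto_intros)
      show "(\<lambda>j. (Re ((z \<circ> s) j) - (\<rho>' \<circ> s) j) * tan ((\<theta>' \<circ> s) j)) \<longlonglongrightarrow> (Re l - \<rho>) * tan \<theta>"
        using l \<rho>l tl by (intro tendsto_intros)
    qed (use z'(2) in auto)
    have "l \<in> sector \<rho> \<theta>" using 1 2 by (simp add: sector_iff[OF \<theta>])
    moreover have "isCont (B_fun n \<alpha> t) l"
      using holomorphic_on_imp_continuous_on[OF B_fun_holomorphic[of n \<alpha> t UNIV]]
      by (simp add: continuous_on_eq_continuous_at)
    then have "(\<lambda>j. B_fun n \<alpha> t ((z \<circ> s) j)) \<longlonglongrightarrow> B_fun n \<alpha> t l"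
      using l by (rule isCont_tendsto_compose)
    then have "B_fun n \<alpha> t l = 0" using z(2) by (simp add: LIMSEQ_const_iff)
    ultimately show False using nz by blast
  qed
  then obtain j where j: "\<And>z. z \<in> sector (\<rho>' j) (\<theta>' j) \<Longrightarrow> B_fun n \<alpha> t z \<noteq> 0" by blast
  have "B_fun n \<alpha> t analytic_on sector (\<rho>' j) (\<theta>' j)"
    using B_fun_holomorphic[of n \<alpha> t UNIV] by (metis analytic_on_holomorphic open_UNIV subset_UNIV)
  then have "(\<lambda>z. 1 / B_fun n \<alpha> t z) analytic_on sector (\<rho>' j) (\<theta>' j)"
    using j by (intro analytic_intros) auto
  then have "admissible_sector \<rho> \<theta> n \<alpha> t (\<rho>' j) (\<theta>' j)"
    using \<theta>'[of j] by (simp add: admissible_sector_def \<rho>'_def)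
  then show ?thesis by blast
qed

section \<open>Improper integrals along rays\<close>

text \<open>Scalar contour integrals thereby become a special case of the vector-valued
  ones.\<close>

instantiation complex :: complex_banach
begin
definition scaleC_complex :: "complex \<Rightarrow> complex \<Rightarrow> complex" where "scaleC_complex = (*)"
instance by standard (auto simp: scaleC_complex_def algebra_simps norm_mult scaleR_conv_of_real)
end

lemma bounded_bilinear_scaleC: "bounded_bilinear ((*\<^sub>C) :: complex \<Rightarrow> 'a::complex_banach \<Rightarrow> 'a)"
proof
  show "(r *\<^sub>R c) *\<^sub>C x = r *\<^sub>R c *\<^sub>C x" for r c and x :: 'a
    by (simp add: scaleC_scaleC scaleR_conv_of_real flip: scaleC_of_real)
  show "c *\<^sub>C r *\<^sub>R x = r *\<^sub>R c *\<^sub>C x" for r c and x :: 'a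
    by (simp add: scaleC_scaleC mult.commute flip: scaleC_of_real)
  show "\<exists>K. \<forall>c (x::'a). norm (c *\<^sub>C x) \<le> norm c * norm x * K"
    by (rule exI[of _ 1]) (simp add: norm_scaleC)
qed (rule scaleC_add_left scaleC_add_right)+

interpretation scaleC: bounded_bilinear "(*\<^sub>C) :: complex \<Rightarrow> 'a::complex_banach \<Rightarrow> 'a"
  by (rule bounded_bilinear_scaleC)

lemmas scaleC_simps = scaleC.zero_left scaleC.zero_right scaleC.minus_left scaleC.minus_right
  scaleC.diff_left scaleC.diff_right scaleC_add_left scaleC_add_right scaleC_scaleC

lemma scaleC_one [simp]: "1 *\<^sub>C x = x"
  using scaleC_of_real[of 1 x] by simp

lemma scaleR_scaleC: "r *\<^sub>R c *\<^sub>C x = (of_real r * c) *\<^sub>C x"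
  by (simp add: scaleC_scaleC flip: scaleC_of_real)

lemmas continuous_on_scaleC [continuous_intros] = scaleC.continuous_on

text \<open>On every interval [y, v] the integral of k is dominated by that of b, so the Cauchy
  criterion for b carries over to k; completeness of the space does the rest.\<close>

lemma integrable_on_ray:
  fixes k :: "real \<Rightarrow> 'a::banach"
  assumes cont: "continuous_on {0..} k" and le: "\<And>r. 0 \<le> r \<Longrightarrow> norm (k r) \<le> b r"
    and b: "b integrable_on {0..}"
  shows "k integrable_on {0..}" and "((\<lambda>R. integral {0..R} k) \<longlongrightarrow> integral {0..} k) at_top"
proof -
  have int: "k integrable_on {x..y}" if "0 \<le> x" for x y
    by (intro integrable_continuous_real continuous_on_subset[OF cont]) (use that in auto)
  have bint: "b integrable_on {x..y}" if "0 \<le> x" for x y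
    by (rule integrable_on_subinterval[OF b]) (use that in auto)
  have Int: "{0..} \<inter> cbox x y = {0..y}" if "x \<le> 0" for x y :: real using that by auto
  have diff: "norm (integral {0..v} k - integral {0..y} k) \<le> \<bar>integral {0..v} b - integral {0..y} b\<bar>"
    if "0 \<le> v" "0 \<le> y" for v y
  proof -
    have *: "norm (integral {0..v} k - integral {0..y} k) \<le> \<bar>integral {0..v} b - integral {0..y} b\<bar>"
      if "0 \<le> y" "y \<le> v" for v y
    proof -
      have "integral {0..v} k = integral {0..y} k + integral {y..v} k"
        using that int by (intro Henstock_Kurzweil_Integration.integral_combine[symmetric]) auto
      moreover have "integral {0..v} b = integral {0..y} b + integral {y..v} b"
        using that bint by (intro Henstock_Kurzweil_Integration.integral_combine[symmetric]) auto
      moreover have "norm (integral {y..v} k) \<le> integral {y..v} b"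
        using that int bint le by (intro integral_norm_bound_integral) auto
      ultimately show ?thesis by simp
    qed
    show ?thesis using *[of y v] *[of v y] that by (cases "y \<le> v") (auto simp: norm_minus_commute abs_minus_commute)
  qed
  show kint: "k integrable_on {0..}"
    unfolding integrable_alt[of k]
  proof (intro conjI allI impI)
    fix x y :: real
    show "(\<lambda>x. if x \<in> {0..} then k x else 0) integrable_on cbox x y"
    proof -
      have "{0..} \<inter> cbox x y = {max 0 x..y}" by auto
      then show ?thesis unfolding integrable_restrict_Int using int by simp
    qed
  next
    fix e :: real assume "0 < e"
    then obtain B where B: "0 < B" "\<And>x y u v. ball 0 B \<subseteq> cbox x y \<Longrightarrow> ball 0 B \<subseteq> cbox u v \<Longrightarrow>
        norm (integral (cbox x y) (\<lambda>x. if x \<in> {0..} then b x else 0) -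
          integral (cbox u v) (\<lambda>x. if x \<in> {0..} then b x else 0)) < e"
      using b unfolding integrable_alt[of b] by meson
    have "norm (integral (cbox x y) (\<lambda>x. if x \<in> {0..} then k x else 0) -
          integral (cbox u v) (\<lambda>x. if x \<in> {0..} then k x else 0)) < e"
      if *: "ball 0 B \<subseteq> cbox x y" "ball 0 B \<subseteq> cbox u v" for x y u v
    proof -
      have "0 \<in> ball (0::real) B" using B(1) by simp
      then have "0 \<in> cbox x y" "0 \<in> cbox u v" using * by blast+
      then have 0: "x \<le> 0" "0 \<le> y" "u \<le> 0" "0 \<le> v" by auto
      show ?thesis
        using B(2)[OF *] diff[of y v] 0 unfolding integral_restrict_Int Int[OF 0(1)] Int[OF 0(3)]
        by (simp add: norm_minus_commute abs_minus_commute)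
    qed
    then show "\<exists>B>0. \<forall>x y u v. ball 0 B \<subseteq> cbox x y \<and> ball 0 B \<subseteq> cbox u v \<longrightarrow>
        norm (integral (cbox x y) (\<lambda>x. if x \<in> {0..} then k x else 0) -
          integral (cbox u v) (\<lambda>x. if x \<in> {0..} then k x else 0)) < e"
      using B(1) by blast
  qed
  show "((\<lambda>R. integral {0..R} k) \<longlongrightarrow> integral {0..} k) at_top"
  proof (rule tendstoI)
    fix e :: real assume "0 < e"
    have "(k has_integral integral {0..} k) {0..}" using kint by (rule integrable_integral)
    then obtain B where B: "0 < B" "\<And>x y. ball 0 B \<subseteq> cbox x y \<Longrightarrow>
        norm (integral (cbox x y) (\<lambda>x. if x \<in> {0..} then k x else 0) - integral {0..} k) < e"
      using \<open>0 < e\<close> unfolding has_integral_alt'[of k] by meson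
    have "dist (integral {0..R} k) (integral {0..} k) < e" if "B \<le> R" for R
    proof -
      have "ball 0 B \<subseteq> cbox (- R) R" using that by (auto simp: dist_norm)
      from B(2)[OF this] show ?thesis using B(1) that unfolding integral_restrict_Int
        by (simp add: Int dist_norm)
    qed
    then show "\<forall>\<^sub>F R in at_top. dist (integral {0..R} k) (integral {0..} k) < e"
      using eventually_at_top_linorder by blast
  qed
qed

lemma Cauchy_kernel_has_integral:
  assumes "0 < d"
  shows "((\<lambda>r. d / (d\<^sup>2 + r\<^sup>2)) has_integral pi / 2) {0..}"
proof (rule has_integral_to_inf)
  have pos: "0 < d\<^sup>2 + r\<^sup>2" for r using assms by (simp add: add_pos_nonneg)
  have fin: "((\<lambda>r. d / (d\<^sup>2 + r\<^sup>2)) has_integral arctan (y / d) - arctan (0 / d)) {0..y}" if "0 \<le> y" for y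
  proof (rule fundamental_theorem_of_calculus[OF that])
    fix x
    have "((\<lambda>x. arctan (x / d)) has_real_derivative inverse (1 + (x / d)\<^sup>2) * (1 / d)) (at x)"
      using assms by (auto intro!: derivative_eq_intros)
    also have "inverse (1 + (x / d)\<^sup>2) * (1 / d) = d / (d\<^sup>2 + x\<^sup>2)"
      using assms pos[of x] by (simp add: field_simps power2_eq_square)
    finally show "((\<lambda>x. arctan (x / d)) has_vector_derivative d / (d\<^sup>2 + x\<^sup>2)) (at x within {0..y})"
      unfolding has_real_derivative_iff_has_vector_derivative by (rule has_vector_derivative_at_within)
  qed
  show "(\<lambda>r. d / (d\<^sup>2 + r\<^sup>2)) integrable_on {0..y}" for y
    using pos by (intro integrable_continuous_real continuous_intros) (metis less_irrefl)
  have "((\<lambda>y. arctan (y / d)) \<longlongrightarrow> pi / 2) at_top"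
  proof (rule filterlim_compose[OF tendsto_arctan_at_top])
    show "filterlim (\<lambda>y. y / d) at_top at_top" using assms by real_asymp
  qed
  moreover have "\<forall>\<^sub>F y in at_top. arctan (y / d) = integral {0..y} (\<lambda>r. d / (d\<^sup>2 + r\<^sup>2))"
    using eventually_ge_at_top[of 0] by eventually_elim (simp add: integral_unique[OF fin])
  ultimately show "((\<lambda>y. integral {0..y} (\<lambda>r. d / (d\<^sup>2 + r\<^sup>2))) \<longlongrightarrow> pi / 2) at_top"
    by (rule Lim_transform_eventually)
qed (use assms in auto)

text \<open>The integral of d / (d^2 + r^2) over the ray is pi / 2 for every d. Later estimates let
  d depend on the time t without losing anything; d = 1 is plain quadratic decay.\<close>

lemma ray_bound:
  fixes k :: "real \<Rightarrow> 'a::banach"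
  assumes cont: "continuous_on {0..} k" and d: "0 < d"
    and le: "\<And>r. 0 \<le> r \<Longrightarrow> norm (k r) \<le> C * (d / (d\<^sup>2 + r\<^sup>2))"
  shows "k integrable_on {0..}" and "(\<lambda>r. norm (k r)) integrable_on {0..}"
    and "((\<lambda>R. integral {0..R} k) \<longlongrightarrow> integral {0..} k) at_top"
    and "norm (integral {0..} k) \<le> C * (pi / 2)"
proof -
  have b: "((\<lambda>r. C * (d / (d\<^sup>2 + r\<^sup>2))) has_integral C * (pi / 2)) {0..}"
    by (intro has_integral_mult_right Cauchy_kernel_has_integral d)
  show 1: "k integrable_on {0..}" and "((\<lambda>R. integral {0..R} k) \<longlongrightarrow> integral {0..} k) at_top"
    using integrable_on_ray[OF cont le has_integral_integrable[OF b]] by auto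
  show "(\<lambda>r. norm (k r)) integrable_on {0..}"
    by (rule integrable_on_ray(1)[OF _ _ has_integral_integrable[OF b]])
      (use cont le in \<open>auto intro: continuous_intros\<close>)
  have "norm (integral {0..} k) \<le> integral {0..} (\<lambda>r. C * (d / (d\<^sup>2 + r\<^sup>2)))"
    using le by (intro integral_norm_bound_integral 1 has_integral_integrable[OF b]) auto
  then show "norm (integral {0..} k) \<le> C * (pi / 2)" using integral_unique[OF b] by simp
qed

section \<open>Complex differentiability and rotation of rays\<close>

text \<open>The derivative is taken in a full neighbourhood of each point, although W may be closed,
  such as a sector. Continuity of the derivative is included for differentiation under the
  integral.\<close>

definition C_differentiable_on :: "(complex \<Rightarrow> 'a::complex_banach) \<Rightarrow> (complex \<Rightarrow> 'a) \<Rightarrow> complex set \<Rightarrow> bool" where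
  "C_differentiable_on g g' W \<longleftrightarrow>
     (\<forall>z\<in>W. (g has_derivative (\<lambda>h. h *\<^sub>C g' z)) (at z)) \<and> continuous_on W g'"

lemma C_differentiable_on_continuous:
  "C_differentiable_on g g' W \<Longrightarrow> continuous_on W g"
  unfolding C_differentiable_on_def
  by (meson continuous_at_imp_continuous_on has_derivative_continuous)

lemma C_differentiable_on_scaleC:
  assumes f: "f analytic_on W" and g: "C_differentiable_on g g' W"
  shows "C_differentiable_on (\<lambda>z. f z *\<^sub>C g z) (\<lambda>z. deriv f z *\<^sub>C g z + f z *\<^sub>C g' z) W"
  unfolding C_differentiable_on_def
proof (intro conjI ballI)
  fix z assume z: "z \<in> W"
  have "(f has_field_derivative deriv f z) (at z)"
    using f z by (simp add: analytic_on_imp_differentiable_at field_differentiable_derivI)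
  then have "(f has_derivative (\<lambda>h. deriv f z * h)) (at z)"
    by (simp add: has_field_derivative_def)
  then have "((\<lambda>z. f z *\<^sub>C g z) has_derivative (\<lambda>h. f z *\<^sub>C (h *\<^sub>C g' z) + (deriv f z * h) *\<^sub>C g z)) (at z)"
    using g z unfolding C_differentiable_on_def by (intro scaleC.FDERIV) auto
  then show "((\<lambda>z. f z *\<^sub>C g z) has_derivative (\<lambda>h. h *\<^sub>C (deriv f z *\<^sub>C g z + f z *\<^sub>C g' z))) (at z)"
    by (simp add: scaleC_simps add.commute mult.commute)
next
  show "continuous_on W (\<lambda>z. deriv f z *\<^sub>C g z + f z *\<^sub>C g' z)"
    using C_differentiable_on_continuous[OF g] g analytic_deriv[OF f] f
    unfolding C_differentiable_on_def
    by (intro continuous_intros) (auto intro: analytic_imp_holomorphic holomorphic_on_imp_continuous_on)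
qed

lemma C_differentiable_on_const: "C_differentiable_on (\<lambda>z. x) (\<lambda>z. 0) W"
  by (simp add: C_differentiable_on_def scaleC_simps)

lemma C_differentiable_on_analytic:
  fixes f :: "complex \<Rightarrow> complex"
  assumes "f analytic_on W"
  shows "C_differentiable_on f (deriv f) W"
  using C_differentiable_on_scaleC[OF assms C_differentiable_on_const[of "1::complex"]]
  by (simp add: scaleC_complex_def)

lemma vector_derivative_bound:
  fixes f :: "real \<Rightarrow> 'a::real_normed_vector"
  assumes "a \<le> b" and "\<And>x. x \<in> {a..b} \<Longrightarrow> (f has_vector_derivative f' x) (at x within {a..b})"
    and "\<And>x. x \<in> {a..b} \<Longrightarrow> norm (f' x) \<le> B"
  shows "norm (f b - f a) \<le> B * (b - a)"
proof -
  have "norm (f b - f a) \<le> B * norm (b - a)"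
  proof (rule differentiable_bound[of "{a..b}" f "\<lambda>x h. h *\<^sub>R f' x"])
    fix x assume x: "x \<in> {a..b}"
    show "(f has_derivative (\<lambda>h. h *\<^sub>R f' x)) (at x within {a..b})"
      using assms(2)[OF x] by (simp add: has_vector_derivative_def)
    show "onorm (\<lambda>h. h *\<^sub>R f' x) \<le> B"
    proof (rule onorm_bound)
      show "0 \<le> B" using assms(3)[OF x] norm_ge_zero order_trans by blast
      show "norm (h *\<^sub>R f' x) \<le> B * norm h" for h
        using mult_left_mono[OF assms(3)[OF x], of "\<bar>h\<bar>"] by (simp add: mult.commute)
    qed
  qed (use assms(1) in auto)
  then show ?thesis using assms(1) by simp
qed

text \<open>The integral over the ray piece [0, R] is differentiated with respect to the angle. The
  angular derivative of the integrand is also the radial derivative of i r cis \<psi> g(\<rho> + r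
  cis \<psi>), so only the boundary term at R remains. It is bounded by R C / (1 + R^2) and vanishes
  as R -> \<infinity>.\<close>

lemma ray_rotation:
  fixes g :: "complex \<Rightarrow> 'a::complex_banach"
  assumes ab: "a \<le> b"
    and W: "\<And>r \<psi>. 0 \<le> r \<Longrightarrow> \<psi> \<in> {a..b} \<Longrightarrow> of_real \<rho> + of_real r * cis \<psi> \<in> W"
    and g: "C_differentiable_on g g' W"
    and le: "\<And>r \<psi>. 0 \<le> r \<Longrightarrow> \<psi> \<in> {a..b} \<Longrightarrow>
      norm (g (of_real \<rho> + of_real r * cis \<psi>)) \<le> C / (1 + r\<^sup>2)"
  shows "integral {0..} (ray_integrand \<rho> a g) = integral {0..} (ray_integrand \<rho> b g)"
proof -
  define z where "z \<psi> r = of_real \<rho> + of_real r * cis \<psi>" for \<psi> r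
  define k where "k \<psi> r = cis \<psi> *\<^sub>C g (z \<psi> r)" for \<psi> r
  \<comment> \<open>The common value of the derivative of \<open>k\<close> in \<psi> and the
    derivative of \<open>m\<close> in r.\<close>
  define kd where "kd \<psi> r = (\<i> * cis \<psi>) *\<^sub>C g (z \<psi> r) + (\<i> * of_real r * cis \<psi> * cis \<psi>) *\<^sub>C g' (z \<psi> r)" for \<psi> r
  define m where "m \<psi> r = (\<i> * of_real r * cis \<psi>) *\<^sub>C g (z \<psi> r)" for \<psi> r
  define J where "J R \<psi> = integral {0..R} (k \<psi>)" for R \<psi>
  have gd: "(g has_derivative (\<lambda>h. h *\<^sub>C g' (z \<psi> r))) (at (z \<psi> r))" if "0 \<le> r" "\<psi> \<in> {a..b}" for \<psi> r
    using g W that unfolding C_differentiable_on_def z_def by blast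
  have cont_g: "continuous_on W g" and cont_g': "continuous_on W g'"
    using g C_differentiable_on_continuous unfolding C_differentiable_on_def by auto
  have cis_d: "(cis has_derivative (\<lambda>h. (h *\<^sub>R (\<i> * cis \<psi>)))) (at \<psi> within S)" for \<psi> S
    by (auto simp: cis_conv_exp intro!: derivative_eq_intros simp: scaleR_conv_of_real)
  have z_\<psi>: "((\<lambda>\<psi>. z \<psi> r) has_derivative (\<lambda>h. h *\<^sub>R (\<i> * of_real r * cis \<psi>))) (at \<psi> within S)" for \<psi> r S
    unfolding z_def by (auto intro!: derivative_eq_intros cis_d simp: scaleR_conv_of_real)
  have z_r: "((\<lambda>r. z \<psi> r) has_derivative (\<lambda>h. h *\<^sub>R cis \<psi>)) (at r within S)" for \<psi> r S
    unfolding z_def by (auto intro!: derivative_eq_intros simp: scaleR_conv_of_real)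
  have k_d: "((\<lambda>\<psi>. k \<psi> r) has_vector_derivative kd \<psi> r) (at \<psi> within {a..b})"
    if r: "0 \<le> r" "\<psi> \<in> {a..b}" for \<psi> r
  proof -
    have "((\<lambda>\<psi>. g (z \<psi> r)) has_derivative (\<lambda>h. (h *\<^sub>R (\<i> * of_real r * cis \<psi>)) *\<^sub>C g' (z \<psi> r))) (at \<psi> within {a..b})"
      by (rule has_derivative_compose[OF z_\<psi> gd[OF r]])
    from scaleC.FDERIV[OF cis_d this] show ?thesis
      unfolding k_def has_vector_derivative_def
      by (rule has_derivative_eq_rhs)
        (simp add: fun_eq_iff kd_def scaleR_scaleC scaleR_conv_of_real scaleC_simps mult_ac scaleR_add_right add.commute)
  qed
  have m_d: "((\<lambda>r. m \<psi> r) has_vector_derivative kd \<psi> r) (at r within S)"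
    if r: "0 \<le> r" "\<psi> \<in> {a..b}" for \<psi> r S
  proof -
    have "((\<lambda>r. g (z \<psi> r)) has_derivative (\<lambda>h. (h *\<^sub>R cis \<psi>) *\<^sub>C g' (z \<psi> r))) (at r within S)"
      by (rule has_derivative_compose[OF z_r gd[OF r]])
    moreover have "((\<lambda>r. \<i> * of_real r * cis \<psi>) has_derivative (\<lambda>h. h *\<^sub>R (\<i> * cis \<psi>))) (at r within S)"
      by (auto intro!: derivative_eq_intros simp: scaleR_conv_of_real)
    ultimately have "((\<lambda>r. (\<i> * of_real r * cis \<psi>) *\<^sub>C g (z \<psi> r)) has_derivative
        (\<lambda>h. (\<i> * of_real r * cis \<psi>) *\<^sub>C ((h *\<^sub>R cis \<psi>) *\<^sub>C g' (z \<psi> r)) + (h *\<^sub>R (\<i> * cis \<psi>)) *\<^sub>C g (z \<psi> r))) (at r within S)"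
      by (intro scaleC.FDERIV)
    then show ?thesis
      unfolding m_def has_vector_derivative_def
      by (rule has_derivative_eq_rhs)
        (simp add: fun_eq_iff kd_def scaleR_scaleC scaleR_conv_of_real scaleC_simps mult_ac scaleR_add_right add.commute)
  qed
  have cis_cont: "continuous_on S (\<lambda>x. cis (f x))" if "continuous_on S f" for S and f :: "real \<times> real \<Rightarrow> real"
    using that by (auto simp: cis_conv_exp intro!: continuous_intros)
  have cont_kd: "continuous_on ({a..b} \<times> {0..}) (\<lambda>(\<psi>, r). kd \<psi> r)"
  proof -
    have zc: "continuous_on ({a..b} \<times> {0..}) (\<lambda>p. z (fst p) (snd p))"
      unfolding z_def by (intro continuous_intros cis_cont)
    have "continuous_on ({a..b} \<times> {0..}) (\<lambda>p. g (z (fst p) (snd p)))"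
      by (rule continuous_on_compose2[OF cont_g zc]) (auto simp: z_def intro: W)
    moreover have "continuous_on ({a..b} \<times> {0..}) (\<lambda>p. g' (z (fst p) (snd p)))"
      by (rule continuous_on_compose2[OF cont_g' zc]) (auto simp: z_def intro: W)
    ultimately show ?thesis
      unfolding kd_def split_beta by (intro continuous_intros cis_cont)
  qed
  have cont_k: "continuous_on {0..} (k \<psi>)" if "\<psi> \<in> {a..b}" for \<psi>
  proof -
    have "continuous_on {0..} (\<lambda>r. z \<psi> r)" unfolding z_def by (intro continuous_intros)
    then have "continuous_on {0..} (\<lambda>r. g (z \<psi> r))"
      by (rule continuous_on_compose2[OF cont_g]) (use that in \<open>auto simp: z_def intro: W\<close>)
    then show ?thesis unfolding k_def by (intro continuous_intros)
  qed
  have lim: "((\<lambda>R. J R \<psi>) \<longlongrightarrow> integral {0..} (k \<psi>)) at_top" if "\<psi> \<in> {a..b}" for \<psi>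
    unfolding J_def
    by (rule ray_bound(3)[of _ 1 C]) (use that le cont_k in \<open>auto simp: k_def z_def norm_scaleC\<close>)
  have J_diff: "norm (J R b - J R a) \<le> R * (C / (1 + R\<^sup>2)) * (b - a)" if R: "0 \<le> R" for R
  proof -
    have "(J R has_vector_derivative m \<psi> R) (at \<psi> within {a..b})" if \<psi>: "\<psi> \<in> {a..b}" for \<psi>
    proof -
      have "((\<lambda>\<psi>. integral (cbox 0 R) (k \<psi>)) has_vector_derivative integral (cbox 0 R) (kd \<psi>)) (at \<psi> within {a..b})"
      proof (rule leibniz_rule_vector_derivative)
        show "continuous_on ({a..b} \<times> cbox 0 R) (\<lambda>(\<psi>, r). kd \<psi> r)"
          by (rule continuous_on_subset[OF cont_kd]) auto
        show "k \<psi> integrable_on cbox 0 R" if "\<psi> \<in> {a..b}" for \<psi>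
          by (rule integrable_continuous, rule continuous_on_subset[OF cont_k[OF that]]) auto
      qed (use \<psi> k_d in auto)
      moreover have "(kd \<psi> has_integral m \<psi> R - m \<psi> 0) {0..R}"
        by (rule fundamental_theorem_of_calculus[OF R]) (use m_d \<psi> in auto)
      then have "integral (cbox 0 R) (kd \<psi>) = m \<psi> R"
        by (auto dest!: integral_unique simp: m_def scaleC_simps)
      ultimately show ?thesis unfolding J_def by simp
    qed
    moreover have "norm (m \<psi> R) \<le> R * (C / (1 + R\<^sup>2))" if "\<psi> \<in> {a..b}" for \<psi>
      unfolding m_def norm_scaleC using le[OF R that] R
      by (simp add: norm_mult z_def mult_left_mono del: times_divide_eq_right)
    ultimately show ?thesis
      using ab by (intro vector_derivative_bound[where f' = "\<lambda>\<psi>. m \<psi> R"]) auto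
  qed
  have "((\<lambda>R. norm (J R b - J R a)) \<longlongrightarrow> norm (integral {0..} (k b) - integral {0..} (k a))) at_top"
    using ab by (intro tendsto_intros lim) auto
  moreover have "((\<lambda>R. norm (J R b - J R a)) \<longlongrightarrow> 0) at_top"
  proof (rule tendsto_sandwich[OF _ _ tendsto_const])
    show "\<forall>\<^sub>F R in at_top. norm (J R b - J R a) \<le> R * (C / (1 + R\<^sup>2)) * (b - a)"
      using eventually_ge_at_top[of 0] by eventually_elim (rule J_diff)
    show "((\<lambda>R. R * (C / (1 + R\<^sup>2)) * (b - a)) \<longlongrightarrow> 0) at_top"
      by real_asymp
  qed auto
  ultimately have "norm (integral {0..} (k b) - integral {0..} (k a)) = 0"
    using tendsto_unique trivial_limit_at_top_linorder by blast
  then show ?thesis by (simp add: ray_integrand_def k_def[abs_def] z_def)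
qed

section \<open>Integrals along the boundary of a sector\<close>

definition sector_boundary :: "real \<Rightarrow> real \<Rightarrow> complex set" where
  "sector_boundary \<rho> \<theta> = {of_real \<rho> + of_real r * cis \<psi> | r \<psi>. 0 \<le> r \<and> \<psi> \<in> {- \<theta>, \<theta>}}"

text \<open>The integrability class of the whole calculus. A scalar function in it stays in it after
  multiplication with the resolvent, which is bounded on the contour.\<close>

definition ray_decay :: "real \<Rightarrow> real \<Rightarrow> (complex \<Rightarrow> 'a::complex_banach) \<Rightarrow> bool" where
  "ray_decay \<rho> \<theta> g \<longleftrightarrow> continuous_on (sector_boundary \<rho> \<theta>) g \<and>
     (\<exists>C. \<forall>r\<ge>0. \<forall>\<psi>\<in>{- \<theta>, \<theta>}. norm (g (of_real \<rho> + of_real r * cis \<psi>)) \<le> C / (1 + r\<^sup>2))"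

lemma sector_boundary_I: "0 \<le> r \<Longrightarrow> \<psi> \<in> {- \<theta>, \<theta>} \<Longrightarrow> of_real \<rho> + of_real r * cis \<psi> \<in> sector_boundary \<rho> \<theta>"
  by (auto simp: sector_boundary_def)

lemma sector_boundary_subset: "0 \<le> \<theta> \<Longrightarrow> sector_boundary \<rho> \<theta> \<subseteq> sector \<rho> \<theta>"
  by (force simp: sector_boundary_def sector_def)

lemma continuous_on_ray_integrand:
  assumes "continuous_on (sector_boundary \<rho> \<theta>) g" "\<psi> \<in> {- \<theta>, \<theta>}"
  shows "continuous_on {0..} (ray_integrand \<rho> \<psi> g)"
proof -
  have "continuous_on {0..} (\<lambda>r. of_real \<rho> + of_real r * cis \<psi>)" by (intro continuous_intros)
  then have "continuous_on {0..} (\<lambda>r. g (of_real \<rho> + of_real r * cis \<psi>))"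
    by (rule continuous_on_compose2[OF assms(1)]) (use assms(2) in \<open>auto intro!: sector_boundary_I\<close>)
  then show ?thesis unfolding ray_integrand_def by (intro continuous_intros)
qed

lemma ray_decay_integrable:
  assumes "ray_decay \<rho> \<theta> g" "\<psi> \<in> {- \<theta>, \<theta>}"
  shows "ray_integrand \<rho> \<psi> g integrable_on {0..}"
    and "(\<lambda>r. norm (ray_integrand \<rho> \<psi> g r)) integrable_on {0..}"
proof -
  obtain C where "\<And>r. 0 \<le> r \<Longrightarrow> norm (g (of_real \<rho> + of_real r * cis \<psi>)) \<le> C / (1 + r\<^sup>2)"
    using assms unfolding ray_decay_def by blast
  then have "norm (ray_integrand \<rho> \<psi> g r) \<le> C * (1 / (1\<^sup>2 + r\<^sup>2))" if "0 \<le> r" for r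
    using that by (simp add: ray_integrand_def norm_scaleC)
  moreover have "continuous_on {0..} (ray_integrand \<rho> \<psi> g)"
    using assms by (intro continuous_on_ray_integrand) (auto simp: ray_decay_def)
  ultimately show "ray_integrand \<rho> \<psi> g integrable_on {0..}"
    "(\<lambda>r. norm (ray_integrand \<rho> \<psi> g r)) integrable_on {0..}"
    using ray_bound(1,2)[of _ 1 C] by auto
qed

lemma ray_decay_sector_integrable: "ray_decay \<rho> \<theta> g \<Longrightarrow> sector_integrable \<rho> \<theta> g"
  unfolding sector_integrable_def using ray_decay_integrable by blast

lemma sector_integral_norm_le:
  assumes cont: "continuous_on (sector_boundary \<rho> \<theta>) g" and d: "0 < d"
    and le: "\<And>r \<psi>. 0 \<le> r \<Longrightarrow> \<psi> \<in> {- \<theta>, \<theta>} \<Longrightarrow>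
      norm (g (of_real \<rho> + of_real r * cis \<psi>)) \<le> C * (d / (d\<^sup>2 + r\<^sup>2))"
  shows "norm (sector_integral \<rho> \<theta> g) \<le> C * pi"
proof -
  have "norm (integral {0..} (ray_integrand \<rho> \<psi> g)) \<le> C * (pi / 2)" if "\<psi> \<in> {- \<theta>, \<theta>}" for \<psi>
    by (rule ray_bound(4)[OF continuous_on_ray_integrand[OF cont that] d])
      (use le that in \<open>auto simp: ray_integrand_def norm_scaleC\<close>)
  from this[of "- \<theta>"] this[of \<theta>] show ?thesis
    unfolding sector_integral_def
    using norm_triangle_ineq4[of "integral {0..} (ray_integrand \<rho> (- \<theta>) g)"
        "integral {0..} (ray_integrand \<rho> \<theta> g)"]
    by simp
qed

lemma ray_decay_bounded_linear:
  assumes F: "bounded_linear F" and g: "ray_decay \<rho> \<theta> g"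
  shows "ray_decay \<rho> \<theta> (\<lambda>z. F (g z))"
proof -
  obtain C where C: "\<And>r \<psi>. 0 \<le> r \<Longrightarrow> \<psi> \<in> {- \<theta>, \<theta>} \<Longrightarrow>
      norm (g (of_real \<rho> + of_real r * cis \<psi>)) \<le> C / (1 + r\<^sup>2)"
    using g unfolding ray_decay_def by blast
  obtain K where K: "0 \<le> K" "\<And>x. norm (F x) \<le> norm x * K"
    using bounded_linear.nonneg_bounded[OF F] by blast
  have "norm (F (g (of_real \<rho> + of_real r * cis \<psi>))) \<le> (C * K) / (1 + r\<^sup>2)"
    if "0 \<le> r" "\<psi> \<in> {- \<theta>, \<theta>}" for r \<psi>
    using K(2)[of "g (of_real \<rho> + of_real r * cis \<psi>)"] mult_right_mono[OF C[OF that] K(1)]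
    by (simp add: field_simps)
  moreover have "continuous_on (sector_boundary \<rho> \<theta>) (\<lambda>z. F (g z))"
    using g by (intro bounded_linear.continuous_on[OF F]) (auto simp: ray_decay_def)
  ultimately show ?thesis unfolding ray_decay_def by blast
qed

lemma ray_decay_add:
  assumes f: "ray_decay \<rho> \<theta> f" and g: "ray_decay \<rho> \<theta> g"
  shows "ray_decay \<rho> \<theta> (\<lambda>z. f z + g z)"
proof -
  obtain C1 where C1: "\<And>r \<psi>. 0 \<le> r \<Longrightarrow> \<psi> \<in> {- \<theta>, \<theta>} \<Longrightarrow>
      norm (f (of_real \<rho> + of_real r * cis \<psi>)) \<le> C1 / (1 + r\<^sup>2)"
    using f unfolding ray_decay_def by blast
  obtain C2 where C2: "\<And>r \<psi>. 0 \<le> r \<Longrightarrow> \<psi> \<in> {- \<theta>, \<theta>} \<Longrightarrow>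
      norm (g (of_real \<rho> + of_real r * cis \<psi>)) \<le> C2 / (1 + r\<^sup>2)"
    using g unfolding ray_decay_def by blast
  have "norm (f (of_real \<rho> + of_real r * cis \<psi>) + g (of_real \<rho> + of_real r * cis \<psi>)) \<le> (C1 + C2) / (1 + r\<^sup>2)"
    if "0 \<le> r" "\<psi> \<in> {- \<theta>, \<theta>}" for r \<psi>
    unfolding add_divide_distrib
    by (rule order_trans[OF norm_triangle_ineq add_mono[OF C1[OF that] C2[OF that]]])
  moreover have "continuous_on (sector_boundary \<rho> \<theta>) (\<lambda>z. f z + g z)"
    using f g by (intro continuous_intros) (auto simp: ray_decay_def)
  ultimately show ?thesis unfolding ray_decay_def by blast
qed

lemma bounded_linear_scaleC_right: "bounded_linear (\<lambda>x::'a::complex_banach. c *\<^sub>C x)"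
  by (rule scaleC.bounded_linear_right)

lemma ray_decay_scaleC: "ray_decay \<rho> \<theta> g \<Longrightarrow> ray_decay \<rho> \<theta> (\<lambda>z. c *\<^sub>C g z)"
  by (rule ray_decay_bounded_linear[OF bounded_linear_scaleC_right])

lemma sector_integral_bounded_linear:
  assumes F: "bounded_linear F" "\<And>c x. F (c *\<^sub>C x) = c *\<^sub>C F x" and g: "ray_decay \<rho> \<theta> g"
  shows "sector_integral \<rho> \<theta> (\<lambda>z. F (g z)) = F (sector_integral \<rho> \<theta> g)"
proof -
  have "integral {0..} (ray_integrand \<rho> \<psi> (\<lambda>z. F (g z))) = F (integral {0..} (ray_integrand \<rho> \<psi> g))"
    if "\<psi> \<in> {- \<theta>, \<theta>}" for \<psi>
    using integral_linear[OF ray_decay_integrable(1)[OF g that] F(1)]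
    by (simp add: ray_integrand_def o_def F(2))
  then show ?thesis unfolding sector_integral_def by (simp add: linear_diff[OF bounded_linear.linear[OF F(1)]])
qed

lemma sector_integral_scaleC:
  assumes "ray_decay \<rho> \<theta> g"
  shows "sector_integral \<rho> \<theta> (\<lambda>z. c *\<^sub>C g z) = c *\<^sub>C sector_integral \<rho> \<theta> g"
  using assms by (intro sector_integral_bounded_linear bounded_linear_scaleC_right)
    (simp_all add: scaleC_scaleC mult.commute)

lemma sector_integral_scaleC_const:
  assumes "ray_decay \<rho> \<theta> h"
  shows "sector_integral \<rho> \<theta> (\<lambda>z. h z *\<^sub>C x) = sector_integral \<rho> \<theta> h *\<^sub>C x"
  using assms by (intro sector_integral_bounded_linear[of "\<lambda>c. c *\<^sub>C x"] scaleC.bounded_linear_left)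
    (simp_all add: scaleC_scaleC scaleC_complex_def)

lemma sector_integral_add:
  assumes f: "ray_decay \<rho> \<theta> f" and g: "ray_decay \<rho> \<theta> g"
  shows "sector_integral \<rho> \<theta> (\<lambda>z. f z + g z) = sector_integral \<rho> \<theta> f + sector_integral \<rho> \<theta> g"
proof -
  have "integral {0..} (ray_integrand \<rho> \<psi> (\<lambda>z. f z + g z)) =
      integral {0..} (ray_integrand \<rho> \<psi> f) + integral {0..} (ray_integrand \<rho> \<psi> g)"
    if "\<psi> \<in> {- \<theta>, \<theta>}" for \<psi>
    using Henstock_Kurzweil_Integration.integral_add[OF ray_decay_integrable(1)[OF f that] ray_decay_integrable(1)[OF g that]]
    by (simp add: ray_integrand_def scaleC_add_right)
  then show ?thesis unfolding sector_integral_def by simp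
qed

lemma sector_integral_cong:
  assumes "\<And>z. z \<in> sector_boundary \<rho> \<theta> \<Longrightarrow> f z = g z"
  shows "sector_integral \<rho> \<theta> f = sector_integral \<rho> \<theta> g"
proof -
  have "integral {0..} (ray_integrand \<rho> \<psi> f) = integral {0..} (ray_integrand \<rho> \<psi> g)" if "\<psi> \<in> {- \<theta>, \<theta>}" for \<psi>
    using that assms[OF sector_boundary_I] by (intro integral_cong) (simp add: ray_integrand_def)
  then show ?thesis by (simp add: sector_integral_def)
qed

lemma ray_decay_cong:
  assumes "\<And>z. z \<in> sector_boundary \<rho> \<theta> \<Longrightarrow> f z = g z"
  shows "ray_decay \<rho> \<theta> f \<longleftrightarrow> ray_decay \<rho> \<theta> g"
proof -
  have "continuous_on (sector_boundary \<rho> \<theta>) f \<longleftrightarrow> continuous_on (sector_boundary \<rho> \<theta>) g"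
    using assms by (rule continuous_on_cong[OF refl])
  moreover have "f (of_real \<rho> + of_real r * cis \<psi>) = g (of_real \<rho> + of_real r * cis \<psi>)"
    if "0 \<le> r" "\<psi> \<in> {- \<theta>, \<theta>}" for r \<psi>
    using that assms sector_boundary_I by blast
  ultimately show ?thesis unfolding ray_decay_def by simp
qed

section \<open>Closing the contour on either side\<close>

lemma sector_integral_right_eq_0:
  assumes "0 \<le> \<theta>" "C_differentiable_on g g' (sector \<rho> \<theta>)"
    and "\<And>r \<psi>. 0 \<le> r \<Longrightarrow> \<bar>\<psi>\<bar> \<le> \<theta> \<Longrightarrow> norm (g (of_real \<rho> + of_real r * cis \<psi>)) \<le> C / (1 + r\<^sup>2)"
  shows "sector_integral \<rho> \<theta> g = 0"
  unfolding sector_integral_def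
proof -
  have "of_real \<rho> + of_real r * cis \<psi> \<in> sector \<rho> \<theta>" if "0 \<le> r" "\<psi> \<in> {- \<theta>..\<theta>}" for r \<psi>
    using that unfolding sector_def by (intro CollectI exI[of _ r] exI[of _ \<psi>]) (auto simp: abs_le_iff)
  then have "integral {0..} (ray_integrand \<rho> (- \<theta>) g) = integral {0..} (ray_integrand \<rho> \<theta> g)"
    by (intro ray_rotation[OF _ _ assms(2), where C = C]) (use assms in \<open>auto simp: abs_le_iff\<close>)
  then show "integral {0..} (ray_integrand \<rho> (- \<theta>) g) - integral {0..} (ray_integrand \<rho> \<theta> g) = 0"
    by simp
qed

text \<open>The upper ray is turned through the outside of the sector, past angle pi, until it
  reaches the angle 2 pi - \<theta>, which has the same direction as the lower ray.\<close>

lemma sector_integral_left_eq_0: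
  assumes "\<theta> \<le> pi" "C_differentiable_on g g' W"
    and "\<And>r \<psi>. 0 \<le> r \<Longrightarrow> \<psi> \<in> {\<theta>..2 * pi - \<theta>} \<Longrightarrow> of_real \<rho> + of_real r * cis \<psi> \<in> W"
    and "\<And>r \<psi>. 0 \<le> r \<Longrightarrow> \<psi> \<in> {\<theta>..2 * pi - \<theta>} \<Longrightarrow> norm (g (of_real \<rho> + of_real r * cis \<psi>)) \<le> C / (1 + r\<^sup>2)"
  shows "sector_integral \<rho> \<theta> g = 0"
proof -
  have "integral {0..} (ray_integrand \<rho> \<theta> g) = integral {0..} (ray_integrand \<rho> (2 * pi - \<theta>) g)"
    by (rule ray_rotation[where W = W and C = C and g' = g']) (use assms in auto)
  moreover have "cis (2 * pi - \<theta>) = cis (- \<theta>)" by (simp add: cis.ctr)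
  ultimately show ?thesis by (simp add: sector_integral_def ray_integrand_def)
qed

lemma cos_le_if_left:
  assumes "0 \<le> \<theta>" "\<psi> \<in> {\<theta>..2 * pi - \<theta>}"
  shows "cos \<psi> \<le> cos \<theta>"
proof (cases "\<psi> \<le> pi")
  case True
  then show ?thesis using assms by (intro cos_monotone_0_pi_le) auto
next
  case False
  have "cos \<psi> = cos (2 * pi - \<psi>)" by simp
  also have "\<dots> \<le> cos \<theta>" using assms False by (intro cos_monotone_0_pi_le) auto
  finally show ?thesis .
qed

lemma norm_ray_diff_sq: "(cmod (of_real r * cis \<psi> - of_real d))\<^sup>2 = r\<^sup>2 - 2 * r * d * cos \<psi> + d\<^sup>2"
proof -
  have "(cmod (of_real r * cis \<psi> - of_real d))\<^sup>2 = (r * cos \<psi> - d)\<^sup>2 + (r * sin \<psi>)\<^sup>2"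
    unfolding cmod_power2 by simp
  also have "\<dots> = r\<^sup>2 * ((cos \<psi>)\<^sup>2 + (sin \<psi>)\<^sup>2) - 2 * r * d * cos \<psi> + d\<^sup>2"
    by algebra
  finally show ?thesis by (simp only: sin_cos_squared_add2 mult_1_right)
qed

text \<open>Law of cosines together with 2 r d \<le> r^2 + d^2: a ray that keeps an angle away from
  the positive axis stays at a distance comparable with sqrt (d^2 + r^2) from the point d on
  it.\<close>

lemma norm_ray_diff_ge_sq:
  assumes "0 \<le> r" "0 \<le> d" "cos \<psi> \<le> c" "0 \<le> c"
  shows "(1 - c) * (d\<^sup>2 + r\<^sup>2) \<le> (cmod (of_real r * cis \<psi> - of_real d))\<^sup>2"
proof -
  have "2 * r * d * cos \<psi> \<le> (2 * r * d) * c" using assms by (intro mult_left_mono) auto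
  also have "\<dots> \<le> (d\<^sup>2 + r\<^sup>2) * c"
    using sum_squares_bound[of r d] assms by (intro mult_right_mono) (auto simp: add.commute)
  finally show ?thesis unfolding norm_ray_diff_sq by (simp add: algebra_simps)
qed

lemma norm_ray_diff_ge:
  assumes "0 < d" "0 \<le> c" "c < 1"
  obtains \<kappa> where "0 < \<kappa>" "\<And>r \<psi>. 0 \<le> r \<Longrightarrow> cos \<psi> \<le> c \<Longrightarrow> \<kappa> * (1 + r) \<le> cmod (of_real r * cis \<psi> - of_real d)"
proof
  \<comment> \<open>Obtained from (1 + r)^2 \<le> 2 (1 + r^2) and min 1 d^2 (1 + r^2) \<le> d^2 +
    r^2.\<close>
  define \<kappa> where "\<kappa> = sqrt ((1 - c) * min 1 (d\<^sup>2) / 2)"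
  have \<kappa>2: "\<kappa>\<^sup>2 = (1 - c) * min 1 (d\<^sup>2) / 2" using assms by (simp add: \<kappa>_def)
  show "0 < \<kappa>" using assms by (simp add: \<kappa>_def)
  fix r \<psi> :: real assume *: "0 \<le> r" "cos \<psi> \<le> c"
  have "(\<kappa> * (1 + r))\<^sup>2 = (1 - c) * (min 1 (d\<^sup>2) * ((1 + r)\<^sup>2 / 2))"
    by (simp add: power_mult_distrib \<kappa>2)
  also have "\<dots> \<le> (1 - c) * (d\<^sup>2 + r\<^sup>2)"
  proof (intro mult_left_mono)
    have "(1 + r)\<^sup>2 / 2 \<le> 1 + r\<^sup>2" using sum_squares_bound[of 1 r] by (simp add: power2_sum)
    then have "min 1 (d\<^sup>2) * ((1 + r)\<^sup>2 / 2) \<le> min 1 (d\<^sup>2) * (1 + r\<^sup>2)" by (intro mult_left_mono) auto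
    also have "\<dots> = min 1 (d\<^sup>2) + min 1 (d\<^sup>2) * r\<^sup>2" by (simp add: algebra_simps)
    also have "\<dots> \<le> d\<^sup>2 + 1 * r\<^sup>2" by (intro add_mono mult_right_mono) auto
    finally show "min 1 (d\<^sup>2) * ((1 + r)\<^sup>2 / 2) \<le> d\<^sup>2 + r\<^sup>2" by simp
  qed (use assms in auto)
  also have "\<dots> \<le> (cmod (of_real r * cis \<psi> - of_real d))\<^sup>2"
    using * assms by (intro norm_ray_diff_ge_sq) auto
  finally show "\<kappa> * (1 + r) \<le> cmod (of_real r * cis \<psi> - of_real d)"
    by (rule power2_le_imp_le) simp
qed

text \<open>
  The two poles lie on both sides of the contour. Rotating the rays into the imaginary direction
  turns the integrand into the Cauchy kernel.
\<close>

lemma sector_integral_pole_pair: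
  fixes \<rho> \<theta> d :: real
  assumes \<theta>: "0 < \<theta>" "\<theta> < pi / 2" and d: "0 < d"
  defines "g \<equiv> \<lambda>z::complex. 1 / (z - of_real (\<rho> + d)) - 1 / (z - of_real (\<rho> - d))"
  shows "ray_decay \<rho> \<theta> g" and "sector_integral \<rho> \<theta> g = 2 * of_real pi * \<i>"
proof -
  define c where "c = cos \<theta>"
  have c: "0 \<le> c" "c < 1"
    using \<theta> cos_gt_zero[of \<theta>] cos_monotone_0_pi[of 0 \<theta>] by (auto simp: c_def)
  define W where "W = - {of_real (\<rho> + d), of_real (\<rho> - d) :: complex}"
  \<comment> \<open>The factor 1 + 1 / d^2 replaces d^2 + r^2 by 1 + r^2 in the denominator, and 1 -
    c comes from the distance to the pole inside the sector.\<close>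
  define C where "C = 2 * d * (1 + 1 / d\<^sup>2) / (1 - c)"
  have zW: "of_real \<rho> + of_real r * cis \<psi> \<in> W"
    and g_eq: "g (of_real \<rho> + of_real r * cis \<psi>) = of_real (2 * d) / ((of_real r * cis \<psi>)\<^sup>2 - (of_real d)\<^sup>2)"
    and g_le: "cmod (g (of_real \<rho> + of_real r * cis \<psi>)) \<le> C / (1 + r\<^sup>2)"
    if r: "0 \<le> r" and \<psi>: "0 \<le> cos \<psi>" "cos \<psi> \<le> c" for r \<psi>
  proof -
    define \<zeta> where "\<zeta> = of_real r * cis \<psi>"
    have pos: "0 < d\<^sup>2 + r\<^sup>2" using d by (simp add: add_pos_nonneg)
    have 1: "(1 - c) * (d\<^sup>2 + r\<^sup>2) \<le> (cmod (\<zeta> - of_real d))\<^sup>2"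
      unfolding \<zeta>_def using r d \<psi> c by (intro norm_ray_diff_ge_sq) auto
    have "d\<^sup>2 + r\<^sup>2 \<le> (cmod (\<zeta> - of_real (- d)))\<^sup>2"
      unfolding \<zeta>_def norm_ray_diff_sq using r d \<psi> by simp
    moreover have "(1 - c) * (d\<^sup>2 + r\<^sup>2) \<le> 1 * (d\<^sup>2 + r\<^sup>2)" using c by (intro mult_right_mono) auto
    ultimately have 2: "(1 - c) * (d\<^sup>2 + r\<^sup>2) \<le> (cmod (\<zeta> + of_real d))\<^sup>2" by simp
    have pos': "0 < (1 - c) * (d\<^sup>2 + r\<^sup>2)" using c pos by simp
    have nz: "\<zeta> - of_real d \<noteq> 0" "\<zeta> + of_real d \<noteq> 0" using 1 2 pos' by auto
    then show "of_real \<rho> + of_real r * cis \<psi> \<in> W"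
      unfolding W_def \<zeta>_def[symmetric] by (auto simp: algebra_simps add_eq_0_iff2)
    have "g (of_real \<rho> + \<zeta>) = 1 / (\<zeta> - of_real d) - 1 / (\<zeta> + of_real d)" by (simp add: g_def)
    also have "\<dots> = of_real (2 * d) / (\<zeta>\<^sup>2 - (of_real d)\<^sup>2)"
      using nz by (simp add: divide_simps power2_eq_square square_diff_square_factored)
    finally show eq: "g (of_real \<rho> + of_real r * cis \<psi>) = of_real (2 * d) / ((of_real r * cis \<psi>)\<^sup>2 - (of_real d)\<^sup>2)"
      by (simp add: \<zeta>_def)
    have "((1 - c) * (d\<^sup>2 + r\<^sup>2))\<^sup>2 \<le> (cmod (\<zeta> - of_real d))\<^sup>2 * (cmod (\<zeta> + of_real d))\<^sup>2"
      unfolding power2_eq_square[of "(1 - c) * _"] using 1 2 pos' by (intro mult_mono) auto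
    also have "\<dots> = (cmod (\<zeta>\<^sup>2 - (of_real d)\<^sup>2))\<^sup>2"
      by (simp add: power2_eq_square square_diff_square_factored norm_mult mult_ac)
    finally have 3: "(1 - c) * (d\<^sup>2 + r\<^sup>2) \<le> cmod (\<zeta>\<^sup>2 - (of_real d)\<^sup>2)"
      by (rule power2_le_imp_le) simp
    have "cmod (g (of_real \<rho> + of_real r * cis \<psi>)) = 2 * d / cmod (\<zeta>\<^sup>2 - (of_real d)\<^sup>2)"
      unfolding eq \<zeta>_def norm_divide norm_of_real using d by simp
    also have "\<dots> \<le> 2 * d / ((1 - c) * (d\<^sup>2 + r\<^sup>2))"
      by (rule divide_left_mono[OF 3]) (use d pos' order.strict_trans2[OF pos' 3] in \<open>auto simp del: zero_less_norm_iff intro: mult_pos_pos\<close>)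
    also have "\<dots> \<le> C / (1 + r\<^sup>2)"
    proof -
      have "1 + r\<^sup>2 \<le> (1 + 1 / d\<^sup>2) * (d\<^sup>2 + r\<^sup>2)" using d by (simp add: field_simps)
      then have "2 * d / (1 - c) * (1 + r\<^sup>2) \<le> 2 * d / (1 - c) * ((1 + 1 / d\<^sup>2) * (d\<^sup>2 + r\<^sup>2))"
        using c d by (intro mult_left_mono) auto
      also have "\<dots> = C * (d\<^sup>2 + r\<^sup>2)" by (simp add: C_def)
      finally have "2 * d / (1 - c) * (1 + r\<^sup>2) \<le> C * (d\<^sup>2 + r\<^sup>2)" .
      then show ?thesis using pos c by (simp add: divide_simps add_pos_nonneg mult_ac)
    qed
    finally show "cmod (g (of_real \<rho> + of_real r * cis \<psi>)) \<le> C / (1 + r\<^sup>2)" .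
  qed
  have an: "g analytic_on W" unfolding g_def W_def
    by (auto intro!: analytic_intros)
  then have diff: "C_differentiable_on g (deriv g) W" by (rule C_differentiable_on_analytic)
  have cos: "0 \<le> cos \<psi> \<and> cos \<psi> \<le> c" if "\<theta> \<le> \<bar>\<psi>\<bar>" "\<bar>\<psi>\<bar> \<le> pi / 2" for \<psi>
  proof -
    have "cos \<bar>\<psi>\<bar> \<le> cos \<theta>" using that \<theta> by (intro cos_monotone_0_pi_le) auto
    moreover have "0 \<le> cos \<bar>\<psi>\<bar>" using that by (intro cos_ge_zero) auto
    ultimately show ?thesis by (simp add: c_def)
  qed
  show "ray_decay \<rho> \<theta> g"
    unfolding ray_decay_def
  proof (intro conjI exI allI impI ballI)
    show "continuous_on (sector_boundary \<rho> \<theta>) g"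
      by (rule continuous_on_subset[OF C_differentiable_on_continuous[OF diff]])
        (use cos \<theta> in \<open>auto simp: sector_boundary_def intro!: zW\<close>)
    show "cmod (g (of_real \<rho> + of_real r * cis \<psi>)) \<le> C / (1 + r\<^sup>2)" if "0 \<le> r" "\<psi> \<in> {- \<theta>, \<theta>}" for r \<psi>
      using g_le[of r \<psi>] cos[of \<psi>] that \<theta> by auto
  qed
  have up: "integral {0..} (ray_integrand \<rho> \<theta> g) = integral {0..} (ray_integrand \<rho> (pi / 2) g)"
    by (rule ray_rotation[OF _ _ diff]) (use cos \<theta> in \<open>auto intro!: zW g_le\<close>)
  have down: "integral {0..} (ray_integrand \<rho> (- pi / 2) g) = integral {0..} (ray_integrand \<rho> (- \<theta>) g)"
    by (rule ray_rotation[OF _ _ diff]) (use cos \<theta> in \<open>auto intro!: zW g_le\<close>)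
  have kernel: "integral {0..} (ray_integrand \<rho> \<psi> g) = - 2 * cis \<psi> * of_real (pi / 2)"
    if \<psi>: "\<psi> = pi / 2 \<or> \<psi> = - pi / 2" for \<psi>
  proof -
    have "\<psi> = pi / 2 \<or> \<psi> = - (pi / 2)" using \<psi> by simp
    then have co: "cos \<psi> = 0" by (elim disjE) (simp_all only: cos_minus cos_pi_half)
    then have "sin \<psi> * sin \<psi> = 1" using sin_cos_squared_add[of \<psi>] by (simp add: power2_eq_square)
    then have sq: "(cis \<psi>)\<^sup>2 = -1" using co by (simp add: complex_eq_iff power2_eq_square)
    have "ray_integrand \<rho> \<psi> g r = - 2 * cis \<psi> * of_real (d / (d\<^sup>2 + r\<^sup>2))" if "0 \<le> r" for r
    proof -
      have "ray_integrand \<rho> \<psi> g r = cis \<psi> * (of_real (2 * d) / (- of_real (d\<^sup>2 + r\<^sup>2)))"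
        unfolding ray_integrand_def scaleC_complex_def
        using g_eq[OF that, of \<psi>] co c by (simp add: power_mult_distrib sq)
      then show ?thesis by (simp del: of_real_add)
    qed
    then have "integral {0..} (ray_integrand \<rho> \<psi> g) =
        integral {0..} (\<lambda>r. - 2 * cis \<psi> * of_real (d / (d\<^sup>2 + r\<^sup>2)))"
      by (intro integral_cong) auto
    also have "\<dots> = - 2 * cis \<psi> * integral {0..} (\<lambda>r. of_real (d / (d\<^sup>2 + r\<^sup>2)))"
      by (rule integral_mult_right)
    also have "integral {0..} (\<lambda>r. of_real (d / (d\<^sup>2 + r\<^sup>2)) :: complex) = of_real (pi / 2)"
      using has_integral_linear[OF Cauchy_kernel_has_integral[OF d] bounded_linear_of_real[where 'a = complex]]
      by (intro integral_unique) (simp only: o_def)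
    finally show ?thesis .
  qed
  have "cis (- pi / 2) = - \<i>" by (simp add: complex_eq_iff)
  then show "sector_integral \<rho> \<theta> g = 2 * of_real pi * \<i>"
    unfolding sector_integral_def using up down kernel[of "pi / 2"] kernel[of "- pi / 2"] by simp
qed

lemma exp_times_power_le:
  assumes "0 < e"
  obtains C :: real where "0 \<le> C" "\<And>r. 0 \<le> r \<Longrightarrow> exp (- e * r) * (1 + r) ^ m \<le> C / (1 + r\<^sup>2)"
proof -
  define h where "h r = exp (- e * r) * (1 + r) ^ m * (1 + r\<^sup>2)" for r :: real
  have "(h \<longlongrightarrow> 0) at_top" unfolding h_def using assms by real_asymp
  then have "\<forall>\<^sub>F r in at_top. h r < 1" by (rule order_tendstoD) auto
  then obtain R where R: "\<And>r. R \<le> r \<Longrightarrow> h r < 1" by (auto simp: eventually_at_top_linorder)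
  have "compact (h ` {0..R})" unfolding h_def
    by (intro compact_continuous_image continuous_intros) auto
  then obtain B where B: "\<And>r. r \<in> {0..R} \<Longrightarrow> norm (h r) \<le> B"
    using compact_imp_bounded bounded_iff by (metis imageI)
  show ?thesis
  proof
    show "0 \<le> max 1 B" by simp
    fix r :: real assume "0 \<le> r"
    then have "h r \<le> max 1 B" using R[of r] B[of r] by (cases "R \<le> r") auto
    moreover have "0 < 1 + r\<^sup>2" by (simp add: add_pos_nonneg)
    ultimately show "exp (- e * r) * (1 + r) ^ m \<le> max 1 B / (1 + r\<^sup>2)"
      by (simp add: h_def pos_le_divide_eq)
  qed
qed

section \<open>Resolvents and contour integrals\<close>

lemma resolvent_facts:
  assumes lin: "linear_operator_on D A" and z: "z \<in> resolvent_set D A"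
  shows "resolvent D A z x \<in> D" and "z *\<^sub>C resolvent D A z x - A (resolvent D A z x) = x"
    and "bounded_linear (resolvent D A z)"
    and "y \<in> D \<Longrightarrow> resolvent D A z (z *\<^sub>C y - A y) = y"
    and "resolvent D A z (c *\<^sub>C x) = c *\<^sub>C resolvent D A z x"
proof -
  have bij: "bij_betw (\<lambda>x. z *\<^sub>C x - A x) D UNIV" and bl: "bounded_linear (resolvent D A z)"
    using z by (auto simp: resolvent_set_def)
  show "bounded_linear (resolvent D A z)" by (rule bl)
  show mem: "resolvent D A z x \<in> D" for x
    using bij unfolding resolvent_def bij_betw_def by (metis UNIV_I inv_into_into)
  show right: "z *\<^sub>C resolvent D A z x - A (resolvent D A z x) = x" for x
    using bij_betw_inv_into_right[OF bij] unfolding resolvent_def by simp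
  show left: "y \<in> D \<Longrightarrow> resolvent D A z (z *\<^sub>C y - A y) = y" for y
    using bij_betw_inv_into_left[OF bij] unfolding resolvent_def by simp
  have "c *\<^sub>C resolvent D A z x \<in> D" "A (c *\<^sub>C resolvent D A z x) = c *\<^sub>C A (resolvent D A z x)"
    using lin mem unfolding linear_operator_on_def by auto
  with left[of "c *\<^sub>C resolvent D A z x"] show "resolvent D A z (c *\<^sub>C x) = c *\<^sub>C resolvent D A z x"
    using right[of x] by (metis mult.commute scaleC.diff_right scaleC_scaleC)
qed

lemma resolvent_identity:
  assumes lin: "linear_operator_on D A" and w: "w \<in> resolvent_set D A" and z: "z \<in> resolvent_set D A"
  shows "(w - z) *\<^sub>C resolvent D A w (resolvent D A z x) = resolvent D A z x - resolvent D A w x"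
proof -
  define y where "y = resolvent D A z x"
  have y: "y \<in> D" "z *\<^sub>C y - A y = x" using resolvent_facts(1,2)[OF lin z] by (auto simp: y_def)
  have "w *\<^sub>C y - A y = (w - z) *\<^sub>C y + x" using y(2) by (simp add: scaleC_simps algebra_simps)
  with resolvent_facts(4)[OF lin w y(1)] have "resolvent D A w ((w - z) *\<^sub>C y + x) = y" by simp
  then show ?thesis
    unfolding y_def[symmetric] resolvent_facts(5)[OF lin w, symmetric]
    by (simp add: linear_add[OF bounded_linear.linear[OF resolvent_facts(3)[OF lin w]]] algebra_simps)
qed

lemma resolvent_commute:
  assumes lin: "linear_operator_on D A" and w: "w \<in> resolvent_set D A" and z: "z \<in> resolvent_set D A"
  shows "resolvent D A w (resolvent D A z x) = resolvent D A z (resolvent D A w x)"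
proof (cases "w = z")
  case False
  have "(w - z) *\<^sub>C resolvent D A w (resolvent D A z x) = - ((z - w) *\<^sub>C resolvent D A z (resolvent D A w x))"
    unfolding resolvent_identity[OF assms] resolvent_identity[OF lin z w] by simp
  also have "\<dots> = (w - z) *\<^sub>C resolvent D A z (resolvent D A w x)"
    by (simp add: scaleC_simps)
  finally have "(1 / (w - z)) *\<^sub>C (w - z) *\<^sub>C resolvent D A w (resolvent D A z x) =
      (1 / (w - z)) *\<^sub>C (w - z) *\<^sub>C resolvent D A z (resolvent D A w x)" by simp
  then show ?thesis using False by (simp add: scaleC_scaleC)
qed simp

section \<open>Estimates for the exponential\<close>

text \<open>The mean value inequality along the segment from b to a, which stays in the half-plane
  Re \<le> m. For the second estimate the linear term is subtracted and the first one bounds the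
  derivative.\<close>

lemma norm_exp_diff_le:
  fixes a b :: complex
  assumes "Re a \<le> m" "Re b \<le> m"
  shows "cmod (exp a - exp b) \<le> exp m * cmod (a - b)"
    and "cmod (exp a - exp b - (a - b) * exp b) \<le> exp m * (cmod (a - b))\<^sup>2"
proof -
  have seg: "Re (b + of_real s * (a - b)) \<le> m" if s: "s \<in> {0..1}" for s
  proof -
    have "Re (b + of_real s * (a - b)) = (1 - s) * Re b + s * Re a" by (simp add: algebra_simps)
    also have "\<dots> \<le> (1 - s) * m + s * m" using s assms by (intro add_mono mult_left_mono) auto
    finally show ?thesis by (simp add: algebra_simps)
  qed
  have 1: "cmod (exp (b + of_real s * (a - b)) - exp b) \<le> exp m * cmod (a - b)" if s: "s \<in> {0..1}" for s
  proof -
    define f where "f u = exp (b + of_real u * (a - b))" for u :: real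
    have "cmod (f s - f 0) \<le> (exp m * cmod (a - b)) * (s - 0)"
    proof (rule vector_derivative_bound)
      fix u assume u: "u \<in> {0..s}"
      show "(f has_vector_derivative (a - b) * f u) (at u within {0..s})"
        unfolding f_def
        by (rule has_vector_derivative_real_field) (auto intro!: derivative_eq_intros)
      show "cmod ((a - b) * f u) \<le> exp m * cmod (a - b)"
        unfolding f_def norm_mult norm_exp_eq_Re
        by (subst mult.commute, rule mult_right_mono) (use seg[of u] u s in auto)
    qed (use s in auto)
    also have "\<dots> \<le> (exp m * cmod (a - b)) * 1" using s by (intro mult_left_mono) auto
    finally show ?thesis by (simp add: f_def)
  qed
  from 1[of 1] show "cmod (exp a - exp b) \<le> exp m * cmod (a - b)" by simp
  define f where "f u = exp (b + of_real u * (a - b)) - of_real u * ((a - b) * exp b)" for u :: real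
  have "cmod (f 1 - f 0) \<le> (exp m * (cmod (a - b))\<^sup>2) * (1 - 0)"
  proof (rule vector_derivative_bound)
    fix u :: real assume u: "u \<in> {0..1}"
    show "(f has_vector_derivative (a - b) * (exp (b + of_real u * (a - b)) - exp b)) (at u within {0..1})"
      unfolding f_def
      by (rule has_vector_derivative_real_field) (auto intro!: derivative_eq_intros simp: algebra_simps)
    show "cmod ((a - b) * (exp (b + of_real u * (a - b)) - exp b)) \<le> exp m * (cmod (a - b))\<^sup>2"
      using mult_left_mono[OF 1[OF u], of "cmod (a - b)"]
      by (simp add: norm_mult power2_eq_square mult_ac)
  qed auto
  then show "cmod (exp a - exp b - (a - b) * exp b) \<le> exp m * (cmod (a - b))\<^sup>2"
    by (simp add: f_def algebra_simps)
qed

text \<open>Both functions equal 1 at \<xi> = 0, so the difference is O(s) for s \<le> 1; for s > 1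
  each of them is O(1 / s). The kernel 2 s / (1 + s^2) dominates both regimes.\<close>

lemma norm_exp_diff_rational_le:
  assumes \<xi>: "cmod \<xi> = s" "Re \<xi> = s * c" and c: "0 < c"
  shows "cmod (exp (- \<xi>) - 1 / (1 + \<xi>)) \<le> (2 + 1 / c) * (2 * s / (1 + s\<^sup>2))"
proof -
  have s: "0 \<le> s" using \<xi>(1) norm_ge_zero by blast
  have Re: "0 \<le> Re \<xi>" using \<xi> s c by simp
  have pos: "0 < 1 + s\<^sup>2" by (simp add: add_pos_nonneg)
  have one: "1 \<le> cmod (1 + \<xi>)" using complex_Re_le_cmod[of "1 + \<xi>"] Re by simp
  then have nz: "1 + \<xi> \<noteq> 0" by auto
  show ?thesis
  proof (cases "s \<le> 1")
    case True
    have "cmod (exp (- \<xi>) - 1) \<le> s"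
      using norm_exp_diff_le(1)[of "- \<xi>" 0 0] Re \<xi> by simp
    moreover have "cmod (1 - 1 / (1 + \<xi>)) \<le> s"
    proof -
      have "1 - 1 / (1 + \<xi>) = \<xi> / (1 + \<xi>)" using nz by (simp add: field_simps)
      then have "cmod (1 - 1 / (1 + \<xi>)) = s / cmod (1 + \<xi>)" by (simp add: norm_divide \<xi>)
      also have "\<dots> \<le> s / 1" using s one by (intro divide_left_mono) auto
      finally show ?thesis by simp
    qed
    ultimately have "cmod (exp (- \<xi>) - 1 / (1 + \<xi>)) \<le> 2 * s"
      using norm_triangle_ineq[of "exp (- \<xi>) - 1" "1 - 1 / (1 + \<xi>)"] by simp
    also have "\<dots> \<le> 2 * (2 * s / (1 + s\<^sup>2))"
    proof -
      have "s * (1 + s\<^sup>2) \<le> s * 2" using True s by (intro mult_left_mono) (auto simp: power_le_one)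
      then show ?thesis using pos by (simp add: pos_le_divide_eq)
    qed
    also have "\<dots> \<le> (2 + 1 / c) * (2 * s / (1 + s\<^sup>2))" using c s by (intro mult_right_mono) auto
    finally show ?thesis .
  next
    case False
    have "s \<le> cmod (1 + \<xi>)"
    proof (rule power2_le_imp_le)
      have "(cmod (1 + \<xi>))\<^sup>2 = 1 + 2 * Re \<xi> + (cmod \<xi>)\<^sup>2"
        unfolding cmod_power2 by (simp add: power2_eq_square algebra_simps)
      then show "s\<^sup>2 \<le> (cmod (1 + \<xi>))\<^sup>2" using Re \<xi> by simp
    qed simp
    then have "cmod (1 / (1 + \<xi>)) \<le> 1 / s"
      unfolding norm_divide using False by (intro frac_le) auto
    moreover have "cmod (exp (- \<xi>)) \<le> 1 / (s * c)"
    proof -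
      have "s * c < exp (s * c)" using exp_ge_add_one_self[of "s * c"] by linarith
      moreover have "cmod (exp (- \<xi>)) = 1 / exp (s * c)"
        unfolding norm_exp_eq_Re by (simp add: \<xi> exp_minus inverse_eq_divide)
      ultimately show ?thesis using False c by (simp add: frac_le)
    qed
    ultimately have "cmod (exp (- \<xi>) - 1 / (1 + \<xi>)) \<le> 1 / (s * c) + 1 / s"
      using norm_triangle_ineq4[of "exp (- \<xi>)" "1 / (1 + \<xi>)"] by linarith
    also have "\<dots> = (1 + 1 / c) * (1 / s)" using c False by (simp add: field_simps)
    also have "\<dots> \<le> (2 + 1 / c) * (2 * s / (1 + s\<^sup>2))"
    proof (intro mult_mono)
      have "1 \<le> s\<^sup>2" using False by (intro one_le_power) auto
      then show "1 / s \<le> 2 * s / (1 + s\<^sup>2)" using False pos by (simp add: divide_simps power2_eq_square)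
    qed (use c False in auto)
    finally show ?thesis .
  qed
qed

lemma has_vector_derivative_quadratic:
  fixes f :: "real \<Rightarrow> 'a::real_normed_vector"
  assumes "0 < \<delta>" and le: "\<And>k. \<bar>k\<bar> \<le> \<delta> \<Longrightarrow> norm (f (t + k) - f t - k *\<^sub>R d) \<le> C * k\<^sup>2"
  shows "(f has_vector_derivative d) (at t)"
  unfolding has_vector_derivative_def has_derivative_iff_norm
proof (intro conjI bounded_linear_scaleR_left)
  show "((\<lambda>y. norm (f y - f t - (y - t) *\<^sub>R d) / norm (y - t)) \<longlongrightarrow> 0) (at t)"
  proof (rule tendsto_sandwich[OF _ _ tendsto_const])
    have "\<forall>\<^sub>F y in at t. dist y t < \<delta>" using assms(1) by (auto simp: eventually_at)
    then show "\<forall>\<^sub>F y in at t. norm (f y - f t - (y - t) *\<^sub>R d) / norm (y - t) \<le> C * \<bar>y - t\<bar>"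
    proof eventually_elim
      case (elim y)
      then show ?case using le[of "y - t"]
        by (cases "y = t") (auto simp: dist_real_def divide_simps power2_eq_square)
    qed
    have "((\<lambda>y. C * \<bar>y - t\<bar>) \<longlongrightarrow> C * \<bar>t - t\<bar>) (at t)" by (intro tendsto_intros)
    then show "((\<lambda>y. C * \<bar>y - t\<bar>) \<longlongrightarrow> 0) (at t)" by simp
  qed simp
qed

section \<open>The Dunford integral over the boundary of a sector\<close>

text \<open>Here \<rho> and \<theta> belong to the contour, that is to the enlarged sector, and W
  will be the complement of the original sector. The angles from \<theta> to 2 pi - \<theta> sweep
  the contour and everything to the left of it; on this region the resolvent is available with its
  bound.\<close>

locale sector_contour =
  fixes D :: "'a::complex_banach set" and A :: "'a \<Rightarrow> 'a" and \<rho> \<theta> M :: real and W :: "complex set"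
  assumes lin: "linear_operator_on D A" and dense: "closure D = UNIV"
    and \<theta>: "0 < \<theta>" "\<theta> < pi / 2"
    and W: "open W" "W \<subseteq> resolvent_set D A"
    and left: "\<And>r \<psi>. 0 \<le> r \<Longrightarrow> \<psi> \<in> {\<theta>..2 * pi - \<theta>} \<Longrightarrow> of_real \<rho> + of_real r * cis \<psi> \<in> W"
    and M: "0 < M" "\<And>z x. z \<in> W \<Longrightarrow> norm (resolvent D A z x) \<le> M / (1 + cmod z) * norm x"
begin

abbreviation R where "R \<equiv> resolvent D A"
abbreviation \<Gamma> where "\<Gamma> \<equiv> sector_boundary \<rho> \<theta>"
abbreviation ray where "ray r \<psi> \<equiv> complex_of_real \<rho> + complex_of_real r * cis \<psi>"

lemma W_resolvent: "z \<in> W \<Longrightarrow> z \<in> resolvent_set D A"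
  using W(2) by blast

lemma R_linear: "z \<in> W \<Longrightarrow> linear (R z)"
  using resolvent_facts(3)[OF lin] W_resolvent bounded_linear.linear by blast

lemma cos_\<theta>: "0 < cos \<theta>" "cos \<theta> < 1"
  using \<theta> cos_gt_zero[of \<theta>] cos_monotone_0_pi[of 0 \<theta>] by auto

lemma boundary_left:
  assumes "\<psi> \<in> {- \<theta>, \<theta>}"
  obtains \<psi>' where "\<psi>' \<in> {\<theta>..2 * pi - \<theta>}" "cis \<psi>' = cis \<psi>"
proof (cases "\<psi> = \<theta>")
  case True
  with that[of \<theta>] show ?thesis using \<theta> by auto
next
  case False
  with assms have [simp]: "\<psi> = - \<theta>" by simp
  have "cis (2 * pi - \<theta>) = cis \<psi>" by (simp add: cis.ctr)
  with that[of "2 * pi - \<theta>"] show ?thesis using \<theta> by auto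
qed

lemma \<Gamma>_W: "\<Gamma> \<subseteq> W"
proof
  fix z assume "z \<in> \<Gamma>"
  then obtain r \<psi> where z: "z = ray r \<psi>" "0 \<le> r" "\<psi> \<in> {- \<theta>, \<theta>}"
    unfolding sector_boundary_def by blast
  obtain \<psi>' where "\<psi>' \<in> {\<theta>..2 * pi - \<theta>}" "cis \<psi>' = cis \<psi>" using boundary_left[OF z(3)] .
  then show "z \<in> W" using left[OF z(2), of \<psi>'] z(1) by simp
qed

lemma norm_ray_le: "0 \<le> r \<Longrightarrow> cmod (ray r \<psi>) \<le> (1 + \<bar>\<rho>\<bar>) * (1 + r)"
proof -
  assume r: "0 \<le> r"
  have "cmod (ray r \<psi>) \<le> \<bar>\<rho>\<bar> + r"
    using norm_triangle_ineq[of "of_real \<rho>" "of_real r * cis \<psi>"] r by (simp add: norm_mult)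
  moreover have "0 \<le> \<bar>\<rho>\<bar> * r" using r by simp
  ultimately show ?thesis unfolding distrib_left distrib_right by linarith
qed

text \<open>Converts the bound in |z| into one in the distance r from the vertex, by 1 + r \<le> (1
  + |\<rho>|) (1 + |z|).\<close>

definition M' where "M' = M * (1 + \<bar>\<rho>\<bar>)"

lemma M'_pos: "0 < M'"
  using M(1) by (simp add: M'_def add_pos_nonneg)

lemma R_bound:
  assumes "ray r \<psi> \<in> W" "0 \<le> r"
  shows "norm (R (ray r \<psi>) x) \<le> M' * norm x / (1 + r)"
proof -
  have "r \<le> cmod (ray r \<psi>) + \<bar>\<rho>\<bar>"
    using norm_triangle_ineq4[of "ray r \<psi>" "of_real \<rho>"] assms(2) by (simp add: norm_mult)
  moreover have "0 \<le> \<bar>\<rho>\<bar> * cmod (ray r \<psi>)" by simp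
  ultimately have "1 + r \<le> (1 + \<bar>\<rho>\<bar>) * (1 + cmod (ray r \<psi>))"
    unfolding distrib_left distrib_right by linarith
  then have "M / (1 + cmod (ray r \<psi>)) \<le> M' / (1 + r)"
    using M(1) assms(2) mult_left_mono[of "1 + r" "(1 + \<bar>\<rho>\<bar>) * (1 + cmod (ray r \<psi>))" M]
    by (simp add: M'_def frac_le_eq divide_simps mult_ac add_pos_nonneg)
  then have "M / (1 + cmod (ray r \<psi>)) * norm x \<le> M' / (1 + r) * norm x" by (rule mult_right_mono) simp
  then show ?thesis using M(2)[OF assms(1), of x] by simp
qed

lemma R_bound_simple: "z \<in> W \<Longrightarrow> norm (R z x) \<le> M * norm x"
proof -
  assume "z \<in> W"
  then have "norm (R z x) \<le> M / (1 + cmod z) * norm x" by (rule M(2))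
  also have "M / (1 + cmod z) \<le> M / 1" using M(1) by (intro divide_left_mono) (auto simp: add_pos_nonneg)
  finally show ?thesis by (simp add: mult_right_mono)
qed

text \<open>Applying the resolvent identity twice, the remainder of the difference is exactly (y -
  z)^2 R_y R_z R_z x, and all three factors are bounded by M.\<close>

lemma R_has_derivative:
  assumes z: "z \<in> W"
  shows "((\<lambda>z. R z x) has_derivative (\<lambda>h. h *\<^sub>C (- R z (R z x)))) (at z)"
  unfolding has_derivative_iff_norm
proof (intro conjI scaleC.bounded_linear_left)
  obtain e where e: "0 < e" "ball z e \<subseteq> W" using W(1) z open_contains_ball by blast
  define C where "C = M * (M * (M * norm x))"
  show "((\<lambda>y. norm (R y x - R z x - (y - z) *\<^sub>C (- R z (R z x))) / norm (y - z)) \<longlongrightarrow> 0) (at z)"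
  proof (rule tendsto_sandwich[OF _ _ tendsto_const])
    have "\<forall>\<^sub>F y in at z. dist y z < e" using e(1) by (auto simp: eventually_at)
    then show "\<forall>\<^sub>F y in at z. norm (R y x - R z x - (y - z) *\<^sub>C (- R z (R z x))) / norm (y - z) \<le> C * norm (y - z)"
    proof eventually_elim
      case (elim y)
      then have y: "y \<in> W" using e(2) by (auto simp: dist_commute)
      note id = resolvent_identity[OF lin W_resolvent[OF y] W_resolvent[OF z]]
      have "R y x - R z x = - ((y - z) *\<^sub>C R y (R z x))" unfolding id by simp
      then have "R y x - R z x - (y - z) *\<^sub>C (- R z (R z x)) = (y - z) *\<^sub>C (R z (R z x) - R y (R z x))"
        by (simp add: scaleC_simps)
      also have "\<dots> = (y - z) *\<^sub>C ((y - z) *\<^sub>C R y (R z (R z x)))"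
        unfolding id ..
      finally have "norm (R y x - R z x - (y - z) *\<^sub>C (- R z (R z x))) =
          norm (y - z) * norm (y - z) * norm (R y (R z (R z x)))"
        by (simp add: norm_scaleC norm_mult scaleC_scaleC)
      also have "norm (R y (R z (R z x))) \<le> C"
      proof -
        have "norm (R y (R z (R z x))) \<le> M * norm (R z (R z x))" using R_bound_simple[OF y] .
        also have "\<dots> \<le> M * (M * norm (R z x))" using R_bound_simple[OF z] M(1) by (intro mult_left_mono) auto
        also have "\<dots> \<le> C" unfolding C_def using R_bound_simple[OF z] M(1) by (intro mult_left_mono) auto
        finally show ?thesis .
      qed
      finally show ?case by (cases "y = z") (auto simp: divide_simps mult_ac mult_left_mono)
    qed
    have "((\<lambda>y. C * norm (y - z)) \<longlongrightarrow> C * norm (z - z)) (at z)" by (intro tendsto_intros)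
    then show "((\<lambda>y. C * norm (y - z)) \<longlongrightarrow> 0) (at z)" by simp
  qed simp
qed

lemma R_continuous: "continuous_on W (\<lambda>z. R z x)"
  using has_derivative_continuous[OF R_has_derivative] by (intro continuous_at_imp_continuous_on) blast

lemma R_C_differentiable: "C_differentiable_on (\<lambda>z. R z x) (\<lambda>z. - R z (R z x)) W"
  unfolding C_differentiable_on_def
proof (intro conjI ballI R_has_derivative)
  show "continuous_on W (\<lambda>z. - R z (R z x))"
    unfolding continuous_on_def
  proof
    fix z assume z: "z \<in> W"
    have lim: "((\<lambda>y. R y v) \<longlongrightarrow> R z v) (at z within W)" for v
      using R_continuous z by (auto simp: continuous_on_def)
    \<comment> \<open>R_y R_y x is split into R_y (R_y x - R_z x) and R_y R_z x: the uniform bound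
      handles the first part, continuity at a fixed vector the second.\<close>
    have "((\<lambda>y. R y (R y x - R z x)) \<longlongrightarrow> 0) (at z within W)"
    proof (rule Lim_null_comparison)
      show "\<forall>\<^sub>F y in at z within W. norm (R y (R y x - R z x)) \<le> M * norm (R y x - R z x)"
        using R_bound_simple by (auto simp: eventually_at_filter)
      have "((\<lambda>y. M * norm (R y x - R z x)) \<longlongrightarrow> M * norm (R z x - R z x)) (at z within W)"
        by (intro tendsto_intros lim)
      then show "((\<lambda>y. M * norm (R y x - R z x)) \<longlongrightarrow> 0) (at z within W)" by simp
    qed
    then have "((\<lambda>y. - (R y (R y x - R z x) + R y (R z x))) \<longlongrightarrow> - (0 + R z (R z x))) (at z within W)"
      by (intro tendsto_intros lim)
    moreover have "\<forall>\<^sub>F y in at z within W. - (R y (R y x - R z x) + R y (R z x)) = - R y (R y x)"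
      using linear_diff[OF R_linear] by (auto simp: eventually_at_filter)
    ultimately show "((\<lambda>y. - R y (R y x)) \<longlongrightarrow> - R z (R z x)) (at z within W)"
      by (simp add: tendsto_cong)
  qed
qed

lemma decay_R:
  assumes "ray_decay \<rho> \<theta> h"
  shows "ray_decay \<rho> \<theta> (\<lambda>z. h z *\<^sub>C R z x)"
proof -
  obtain C where C: "\<And>r \<psi>. 0 \<le> r \<Longrightarrow> \<psi> \<in> {- \<theta>, \<theta>} \<Longrightarrow> cmod (h (ray r \<psi>)) \<le> C / (1 + r\<^sup>2)"
    using assms unfolding ray_decay_def by blast
  have "norm (h (ray r \<psi>) *\<^sub>C R (ray r \<psi>) x) \<le> (C * (M * norm x)) / (1 + r\<^sup>2)"
    if r: "0 \<le> r" "\<psi> \<in> {- \<theta>, \<theta>}" for r \<psi>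
  proof -
    have "norm (R (ray r \<psi>) x) \<le> M * norm x"
      using sector_boundary_I[OF r] \<Gamma>_W by (intro R_bound_simple) auto
    then have "cmod (h (ray r \<psi>)) * norm (R (ray r \<psi>) x) \<le> (C / (1 + r\<^sup>2)) * (M * norm x)"
      using C[OF r] by (intro mult_mono) (auto intro: order_trans[OF norm_ge_zero])
    then show ?thesis by (simp add: norm_scaleC)
  qed
  moreover have "continuous_on \<Gamma> (\<lambda>z. h z *\<^sub>C R z x)"
    using assms continuous_on_subset[OF R_continuous \<Gamma>_W]
    by (intro continuous_intros) (auto simp: ray_decay_def)
  ultimately show ?thesis unfolding ray_decay_def by blast
qed

text \<open>The Dunford integral without a term at infinity; where the identity occurs, it is added
  by hand.\<close>

definition Phi :: "(complex \<Rightarrow> complex) \<Rightarrow> 'a \<Rightarrow> 'a" where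
  "Phi h x = (1 / (2 * of_real pi * \<i>)) *\<^sub>C sector_integral \<rho> \<theta> (\<lambda>z. h z *\<^sub>C R z x)"

lemma Phi_add: "ray_decay \<rho> \<theta> g \<Longrightarrow> ray_decay \<rho> \<theta> h \<Longrightarrow> Phi (\<lambda>z. g z + h z) x = Phi g x + Phi h x"
  unfolding Phi_def by (simp add: scaleC_add_left scaleC_add_right[symmetric] sector_integral_add decay_R)

lemma Phi_cmult: "ray_decay \<rho> \<theta> h \<Longrightarrow> Phi (\<lambda>z. c * h z) x = c *\<^sub>C Phi h x"
  using sector_integral_scaleC[OF decay_R, of h c x]
  by (simp add: Phi_def scaleC_scaleC mult.commute)

lemma Phi_norm_le:
  assumes "ray_decay \<rho> \<theta> h" and "\<And>r \<psi>. 0 \<le> r \<Longrightarrow> \<psi> \<in> {- \<theta>, \<theta>} \<Longrightarrow> cmod (h (ray r \<psi>)) \<le> C / (1 + r\<^sup>2)"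
  shows "norm (Phi h x) \<le> C * M * norm x"
proof -
  have "norm (sector_integral \<rho> \<theta> (\<lambda>z. h z *\<^sub>C R z x)) \<le> (C * M * norm x) * pi"
  proof (rule sector_integral_norm_le[where d = 1])
    show "continuous_on \<Gamma> (\<lambda>z. h z *\<^sub>C R z x)" using decay_R[OF assms(1)] by (simp add: ray_decay_def)
    fix r \<psi> :: real assume r: "0 \<le> r" "\<psi> \<in> {- \<theta>, \<theta>}"
    have "norm (R (ray r \<psi>) x) \<le> M * norm x"
      using sector_boundary_I[OF r] \<Gamma>_W by (intro R_bound_simple) auto
    then have "cmod (h (ray r \<psi>)) * norm (R (ray r \<psi>) x) \<le> (C / (1 + r\<^sup>2)) * (M * norm x)"
      using assms(2)[OF r] by (intro mult_mono) (auto intro: order_trans[OF norm_ge_zero])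
    then show "norm (h (ray r \<psi>) *\<^sub>C R (ray r \<psi>) x) \<le> C * M * norm x * (1 / (1\<^sup>2 + r\<^sup>2))"
      by (simp add: norm_scaleC)
  qed simp
  then have "norm (Phi h x) \<le> (1 / (2 * pi)) * ((C * M * norm x) * pi)"
    unfolding Phi_def norm_scaleC by (simp add: norm_mult norm_divide pos_divide_le_eq)
  also have "\<dots> = C * M * norm x / 2" by simp
  also have "\<dots> \<le> C * M * norm x"
  proof -
    have "0 \<le> C" using assms(2)[of 0 \<theta>] by (auto intro: order_trans[OF norm_ge_zero])
    then show ?thesis using M(1) by simp
  qed
  finally show ?thesis .
qed

lemma Phi_bounded_linear:
  assumes h: "ray_decay \<rho> \<theta> h"
  shows "bounded_linear (Phi h)" and "Phi h (c *\<^sub>C x) = c *\<^sub>C Phi h x"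
proof -
  obtain C where C: "\<And>r \<psi>. 0 \<le> r \<Longrightarrow> \<psi> \<in> {- \<theta>, \<theta>} \<Longrightarrow> cmod (h (ray r \<psi>)) \<le> C / (1 + r\<^sup>2)"
    using h unfolding ray_decay_def by blast
  show sc: "Phi h (c *\<^sub>C x) = c *\<^sub>C Phi h x" for c x
  proof -
    have "sector_integral \<rho> \<theta> (\<lambda>z. h z *\<^sub>C R z (c *\<^sub>C x)) = sector_integral \<rho> \<theta> (\<lambda>z. c *\<^sub>C (h z *\<^sub>C R z x))"
      using \<Gamma>_W W_resolvent
      by (intro sector_integral_cong) (auto simp: resolvent_facts(5)[OF lin] scaleC_scaleC mult.commute)
    then show ?thesis unfolding Phi_def sector_integral_scaleC[OF decay_R[OF h]]
      by (simp add: scaleC_scaleC mult.commute)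
  qed
  have add: "Phi h (x + y) = Phi h x + Phi h y" for x y
  proof -
    have "sector_integral \<rho> \<theta> (\<lambda>z. h z *\<^sub>C R z (x + y)) = sector_integral \<rho> \<theta> (\<lambda>z. h z *\<^sub>C R z x + h z *\<^sub>C R z y)"
      using \<Gamma>_W linear_add[OF R_linear]
      by (intro sector_integral_cong) (auto simp: scaleC_add_right)
    then show ?thesis unfolding Phi_def sector_integral_add[OF decay_R[OF h] decay_R[OF h]]
      by (simp add: scaleC_add_right)
  qed
  show "bounded_linear (Phi h)"
    by (rule bounded_linear_intro[where K = "C * M"])
      (use add sc[of "of_real _"] Phi_norm_le[OF h C] in \<open>auto simp: scaleC_of_real mult_ac\<close>)
qed

text \<open>The first form puts a second resolvent under the integral, where the resolvent identity
  can be applied.\<close>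

lemma R_Phi:
  assumes h: "ray_decay \<rho> \<theta> h" and w: "w \<in> resolvent_set D A"
  shows "R w (Phi h x) = (1 / (2 * of_real pi * \<i>)) *\<^sub>C sector_integral \<rho> \<theta> (\<lambda>z. h z *\<^sub>C R w (R z x))"
    and "R w (Phi h x) = Phi h (R w x)"
proof -
  show 1: "R w (Phi h x) = (1 / (2 * of_real pi * \<i>)) *\<^sub>C sector_integral \<rho> \<theta> (\<lambda>z. h z *\<^sub>C R w (R z x))"
    unfolding Phi_def resolvent_facts(5)[OF lin w]
    by (subst sector_integral_bounded_linear[symmetric, OF resolvent_facts(3)[OF lin w] _ decay_R[OF h]])
      (auto simp: resolvent_facts(5)[OF lin w])
  show "R w (Phi h x) = Phi h (R w x)"
    unfolding 1 unfolding Phi_def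
    using \<Gamma>_W W_resolvent resolvent_commute[OF lin w]
    by (intro arg_cong[where f = "\<lambda>y. _ *\<^sub>C y"] sector_integral_cong) auto
qed

text \<open>Multiplied by exp (- t z) with t > 0 and any power of z, such a function decays
  quadratically on the whole closed sector. The instances needed are 1, a simple pole to the left of
  the sector, and exp (t_1 z) (1 / B - 1).\<close>

definition bounded_analytic :: "(complex \<Rightarrow> complex) \<Rightarrow> bool" where
  "bounded_analytic h \<longleftrightarrow> h analytic_on sector \<rho> \<theta> \<and> (\<exists>C. \<forall>z\<in>sector \<rho> \<theta>. cmod (h z) \<le> C)"

lemma bounded_analytic_one: "bounded_analytic (\<lambda>z. 1)"
  unfolding bounded_analytic_def by (auto intro: analytic_intros exI[of _ 1])

lemma norm_exp_ray_le:
  assumes "0 \<le> t" "0 \<le> r" "\<bar>\<psi>\<bar> \<le> \<theta>"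
  shows "cmod (exp (- of_real t * ray r \<psi>)) \<le> exp (- t * \<rho>) * exp (- (t * cos \<theta>) * r)"
proof -
  have "cos \<theta> \<le> cos \<bar>\<psi>\<bar>" using assms \<theta> by (intro cos_monotone_0_pi_le) auto
  then have "t * r * cos \<theta> \<le> t * r * cos \<psi>" using assms by (intro mult_left_mono) auto
  then show ?thesis by (simp add: exp_add[symmetric] algebra_simps)
qed

lemma exp_decay:
  assumes h: "bounded_analytic h" and t: "0 < t"
  obtains C where "\<And>r \<psi>. 0 \<le> r \<Longrightarrow> \<bar>\<psi>\<bar> \<le> \<theta> \<Longrightarrow>
      cmod (ray r \<psi> ^ m * (exp (- of_real t * ray r \<psi>) * h (ray r \<psi>))) \<le> C / (1 + r\<^sup>2)"
proof -
  obtain C1 where C1: "\<And>z. z \<in> sector \<rho> \<theta> \<Longrightarrow> cmod (h z) \<le> C1"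
    using h by (auto simp: bounded_analytic_def)
  have "0 < t * cos \<theta>" using t cos_\<theta> by simp
  then obtain C2 where C2: "0 \<le> C2"
    "\<And>r. 0 \<le> r \<Longrightarrow> exp (- (t * cos \<theta>) * r) * (1 + r) ^ m \<le> C2 / (1 + r\<^sup>2)"
    using exp_times_power_le by blast
  define C where "C = (1 + \<bar>\<rho>\<bar>) ^ m * exp (- t * \<rho>) * C1 * C2"
  show ?thesis
  proof
    fix r \<psi> :: real assume r: "0 \<le> r" "\<bar>\<psi>\<bar> \<le> \<theta>"
    have "ray r \<psi> \<in> sector \<rho> \<theta>" using r by (auto simp: sector_def)
    then have hC: "cmod (h (ray r \<psi>)) \<le> C1" by (rule C1)
    then have C10: "0 \<le> C1" by (rule order_trans[OF norm_ge_zero])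
    have "cmod (ray r \<psi> ^ m * (exp (- of_real t * ray r \<psi>) * h (ray r \<psi>))) \<le>
        ((1 + \<bar>\<rho>\<bar>) * (1 + r)) ^ m * ((exp (- t * \<rho>) * exp (- (t * cos \<theta>) * r)) * C1)"
      unfolding norm_mult[of "_ ^ m"] norm_mult[of "exp _"] norm_power
      using r t hC C10 norm_exp_ray_le[of t r \<psi>]
      by (intro mult_mono power_mono norm_ray_le) (auto intro: mult_nonneg_nonneg)
    also have "\<dots> = (1 + \<bar>\<rho>\<bar>) ^ m * exp (- t * \<rho>) * C1 * (exp (- (t * cos \<theta>) * r) * (1 + r) ^ m)"
      by (simp add: power_mult_distrib mult_ac)
    also have "\<dots> \<le> (1 + \<bar>\<rho>\<bar>) ^ m * exp (- t * \<rho>) * C1 * (C2 / (1 + r\<^sup>2))"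
      using C2(2)[OF r(1)] C10 by (intro mult_left_mono) (auto intro: mult_nonneg_nonneg)
    finally show "cmod (ray r \<psi> ^ m * (exp (- of_real t * ray r \<psi>) * h (ray r \<psi>))) \<le> C / (1 + r\<^sup>2)"
      by (simp add: C_def)
  qed
qed

text \<open>The contour is closed through the sector, where the integrand is analytic. This removes
  the scalar terms that the resolvent identities leave behind.\<close>

lemma exp_decay_integral:
  assumes h: "bounded_analytic h" and t: "0 < t"
  shows "ray_decay \<rho> \<theta> (\<lambda>z. z ^ m * (exp (- of_real t * z) * h z))"
    and "sector_integral \<rho> \<theta> (\<lambda>z. z ^ m * (exp (- of_real t * z) * h z)) = 0"
proof -
  define g where "g z = z ^ m * (exp (- of_real t * z) * h z)" for z
  obtain C where C: "\<And>r \<psi>. 0 \<le> r \<Longrightarrow> \<bar>\<psi>\<bar> \<le> \<theta> \<Longrightarrow> cmod (g (ray r \<psi>)) \<le> C / (1 + r\<^sup>2)"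
    using exp_decay[OF assms, of m] unfolding g_def by blast
  have "g analytic_on sector \<rho> \<theta>"
    using h unfolding g_def bounded_analytic_def by (intro analytic_intros) auto
  then have d: "C_differentiable_on g (deriv g) (sector \<rho> \<theta>)" by (rule C_differentiable_on_analytic)
  have "continuous_on \<Gamma> g"
    using C_differentiable_on_continuous[OF d] sector_boundary_subset[of \<theta> \<rho>] \<theta>
    by (auto intro: continuous_on_subset)
  moreover have "\<bar>\<psi>\<bar> \<le> \<theta>" if "\<psi> \<in> {- \<theta>, \<theta>}" for \<psi> using that \<theta> by auto
  ultimately have "ray_decay \<rho> \<theta> g" unfolding ray_decay_def using C by blast
  moreover have "sector_integral \<rho> \<theta> g = 0"
    by (rule sector_integral_right_eq_0[OF _ d C]) (use \<theta> in auto)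
  ultimately show "ray_decay \<rho> \<theta> (\<lambda>z. z ^ m * (exp (- of_real t * z) * h z))"
    "sector_integral \<rho> \<theta> (\<lambda>z. z ^ m * (exp (- of_real t * z) * h z)) = 0"
    by (simp_all only: g_def[abs_def])
qed

end

section \<open>The semigroup as a contour integral\<close>

lemma C_differentiable_on_subset: "C_differentiable_on g g' W \<Longrightarrow> V \<subseteq> W \<Longrightarrow> C_differentiable_on g g' V"
  unfolding C_differentiable_on_def by (meson continuous_on_subset subset_iff)

lemma ray_decay_cmult: "ray_decay \<rho> \<theta> h \<Longrightarrow> ray_decay \<rho> \<theta> (\<lambda>z. c * h z :: complex)"
  using ray_decay_scaleC[of \<rho> \<theta> h c] by (simp add: scaleC_complex_def)

context sector_contour
begin

text \<open>On the domain, R(z, A) y agrees with y / (z - p) up to a resolvent divided by z - p.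
  This second factor of order 1 / |z| is the source of quadratic decay without an
  exponential.\<close>

lemma R_pole:
  assumes y: "y \<in> D" and z: "z \<in> W" "z \<noteq> p"
  shows "(1 / (z - p)) *\<^sub>C R z (A y - p *\<^sub>C y) = R z y - (1 / (z - p)) *\<^sub>C y"
proof -
  note zr = W_resolvent[OF z(1)]
  have eq: "A y - p *\<^sub>C y = (z - p) *\<^sub>C y - (z *\<^sub>C y - A y)" by (simp add: scaleC_simps)
  have "R z (A y - p *\<^sub>C y) = (z - p) *\<^sub>C R z y - y"
    unfolding eq linear_diff[OF R_linear[OF z(1)], of "(z - p) *\<^sub>C y"]
      resolvent_facts(4)[OF lin zr y] resolvent_facts(5)[OF lin zr] ..
  then show ?thesis using z(2) by (simp add: scaleC.diff_right scaleC_scaleC)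
qed

text \<open>The subtracted pole c lies inside the sector, so the difference is analytic to the left
  of the contour and the integral is closed there.\<close>

lemma left_pole_integral:
  assumes y: "y \<in> D" and d: "0 < d"
  defines "c \<equiv> complex_of_real (\<rho> + d)"
  shows "ray_decay \<rho> \<theta> (\<lambda>z. R z y - (1 / (z - c)) *\<^sub>C y)"
    and "sector_integral \<rho> \<theta> (\<lambda>z. R z y - (1 / (z - c)) *\<^sub>C y) = 0"
proof -
  define v where "v = A y - c *\<^sub>C y"
  define g where "g z = (1 / (z - c)) *\<^sub>C R z v" for z
  obtain \<kappa> where \<kappa>: "0 < \<kappa>"
    "\<And>r \<psi>. 0 \<le> r \<Longrightarrow> cos \<psi> \<le> cos \<theta> \<Longrightarrow> \<kappa> * (1 + r) \<le> cmod (of_real r * cis \<psi> - of_real d)"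
    using norm_ray_diff_ge[OF d, of "cos \<theta>"] cos_\<theta> by auto
  have ray_c: "ray r \<psi> - c = of_real r * cis \<psi> - of_real d" for r \<psi> by (simp add: c_def)
  have far: "\<kappa> * (1 + r) \<le> cmod (ray r \<psi> - c)" if "0 \<le> r" "\<psi> \<in> {\<theta>..2 * pi - \<theta>}" for r \<psi>
    unfolding ray_c using \<kappa>(2)[OF that(1) cos_le_if_left[OF less_imp_le[OF \<theta>(1)] that(2)]] .
  have W': "ray r \<psi> \<in> W - {c}" if "0 \<le> r" "\<psi> \<in> {\<theta>..2 * pi - \<theta>}" for r \<psi>
  proof -
    have "0 < \<kappa> * (1 + r)" using \<kappa>(1) that by simp
    then show ?thesis using far[OF that] left[OF that] by auto
  qed
  have an: "(\<lambda>z. 1 / (z - c)) analytic_on W - {c}" by (auto intro!: analytic_intros)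
  have diff: "C_differentiable_on g (\<lambda>z. deriv (\<lambda>z. 1 / (z - c)) z *\<^sub>C R z v + (1 / (z - c)) *\<^sub>C (- R z (R z v))) (W - {c})"
    unfolding g_def by (rule C_differentiable_on_scaleC[OF an C_differentiable_on_subset[OF R_C_differentiable]]) auto
  have le: "norm (g (ray r \<psi>)) \<le> (M' * norm v / \<kappa>) / (1 + r\<^sup>2)"
    if r: "0 \<le> r" "\<psi> \<in> {\<theta>..2 * pi - \<theta>}" for r \<psi>
  proof -
    have "norm (g (ray r \<psi>)) = 1 / cmod (ray r \<psi> - c) * norm (R (ray r \<psi>) v)"
      by (simp add: g_def norm_scaleC norm_divide)
    also have "\<dots> \<le> 1 / (\<kappa> * (1 + r)) * (M' * norm v / (1 + r))"
      using far[OF r] \<kappa>(1) r left[OF r] M'_pos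
      by (intro mult_mono R_bound frac_le) auto
    also have "\<dots> = (M' * norm v / \<kappa>) / ((1 + r) * (1 + r))" by simp
    also have "\<dots> \<le> (M' * norm v / \<kappa>) / (1 + r\<^sup>2)"
      using r M'_pos \<kappa>(1) by (intro divide_left_mono) (auto simp: power2_eq_square algebra_simps add_pos_nonneg)
    finally show ?thesis .
  qed
  have "continuous_on \<Gamma> g"
  proof (rule continuous_on_subset[OF C_differentiable_on_continuous[OF diff]])
    show "\<Gamma> \<subseteq> W - {c}"
    proof
      fix z assume "z \<in> \<Gamma>"
      then obtain r \<psi> where z: "z = ray r \<psi>" "0 \<le> r" "\<psi> \<in> {- \<theta>, \<theta>}"
        unfolding sector_boundary_def by blast
      obtain \<psi>' where "\<psi>' \<in> {\<theta>..2 * pi - \<theta>}" "cis \<psi>' = cis \<psi>" using boundary_left[OF z(3)] .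
      then show "z \<in> W - {c}" using W'[OF z(2), of \<psi>'] z(1) by simp
    qed
  qed
  moreover have "norm (g (ray r \<psi>)) \<le> (M' * norm v / \<kappa>) / (1 + r\<^sup>2)" if r: "0 \<le> r" "\<psi> \<in> {- \<theta>, \<theta>}" for r \<psi>
  proof -
    obtain \<psi>' where "\<psi>' \<in> {\<theta>..2 * pi - \<theta>}" "cis \<psi>' = cis \<psi>" using boundary_left[OF r(2)] .
    then show ?thesis using le[OF r(1), of \<psi>'] by simp
  qed
  ultimately have decay: "ray_decay \<rho> \<theta> g" unfolding ray_decay_def by blast
  have zero: "sector_integral \<rho> \<theta> g = 0"
    by (rule sector_integral_left_eq_0[OF _ diff W' le]) (use \<theta> in auto)
  have eq: "g z = R z y - (1 / (z - c)) *\<^sub>C y" if z\<Gamma>: "z \<in> \<Gamma>" for z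
  proof -
    obtain r \<psi> where z: "z = ray r \<psi>" "0 \<le> r" "\<psi> \<in> {- \<theta>, \<theta>}"
      using z\<Gamma> unfolding sector_boundary_def by blast
    obtain \<psi>' where "\<psi>' \<in> {\<theta>..2 * pi - \<theta>}" "cis \<psi>' = cis \<psi>" using boundary_left[OF z(3)] .
    then have "z \<in> W - {c}" using W'[OF z(2), of \<psi>'] z(1) by simp
    then show ?thesis unfolding g_def v_def using R_pole[OF y] by auto
  qed
  show "ray_decay \<rho> \<theta> (\<lambda>z. R z y - (1 / (z - c)) *\<^sub>C y)"
    using decay ray_decay_cong[where f = g, OF eq] by blast
  show "sector_integral \<rho> \<theta> (\<lambda>z. R z y - (1 / (z - c)) *\<^sub>C y) = 0"
    using zero sector_integral_cong[where f = g, OF eq] by simp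
qed

text \<open>Moving the subtracted pole from \<rho> + d to \<rho> - d crosses the contour and adds
  the integral of the pole pair, 2 pi i.\<close>

lemma R_minus_pole_integral:
  assumes y: "y \<in> D" and d: "0 < d"
  defines "w \<equiv> complex_of_real (\<rho> - d)"
  shows "ray_decay \<rho> \<theta> (\<lambda>z. R z y - (1 / (z - w)) *\<^sub>C y)"
    and "sector_integral \<rho> \<theta> (\<lambda>z. R z y - (1 / (z - w)) *\<^sub>C y) = (2 * of_real pi * \<i>) *\<^sub>C y"
proof -
  define c where "c = complex_of_real (\<rho> + d)"
  define g where "g z = 1 / (z - c) - 1 / (z - w)" for z
  have g: "ray_decay \<rho> \<theta> g" "sector_integral \<rho> \<theta> g = 2 * of_real pi * \<i>"
    using sector_integral_pole_pair[OF \<theta> d, of \<rho>] by (auto simp: g_def[abs_def] c_def w_def)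
  have gy: "ray_decay \<rho> \<theta> (\<lambda>z. g z *\<^sub>C y)"
    by (rule ray_decay_bounded_linear[OF scaleC.bounded_linear_left g(1)])
  have eq: "R z y - (1 / (z - w)) *\<^sub>C y = (R z y - (1 / (z - c)) *\<^sub>C y) + g z *\<^sub>C y" for z
    by (simp add: g_def scaleC_simps)
  note left_pole = left_pole_integral[OF y d, folded c_def]
  show "ray_decay \<rho> \<theta> (\<lambda>z. R z y - (1 / (z - w)) *\<^sub>C y)"
    unfolding eq by (rule ray_decay_add[OF left_pole(1) gy])
  show "sector_integral \<rho> \<theta> (\<lambda>z. R z y - (1 / (z - w)) *\<^sub>C y) = (2 * of_real pi * \<i>) *\<^sub>C y"
    unfolding eq sector_integral_add[OF left_pole(1) gy] left_pole(2) sector_integral_scaleC_const[OF g(1)] g(2)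
    by simp
qed

lemma left_real: "0 \<le> d \<Longrightarrow> complex_of_real (\<rho> - d) \<in> W"
  using left[of d pi] \<theta> by (simp add: complex_eq_iff)

text \<open>With y = - R(w, A) x one has A y - w y = x, which rewrites the integrand as R(z, A) y -
  y / (z - w).\<close>

lemma R_over_pole_integral:
  assumes d: "0 < d"
  defines "w \<equiv> complex_of_real (\<rho> - d)"
  shows "ray_decay \<rho> \<theta> (\<lambda>z. (1 / (z - w)) *\<^sub>C R z x)"
    and "sector_integral \<rho> \<theta> (\<lambda>z. (1 / (z - w)) *\<^sub>C R z x) = - ((2 * of_real pi * \<i>) *\<^sub>C R w x)"
proof -
  have w: "w \<in> resolvent_set D A" unfolding w_def using left_real[of d] d W_resolvent by simp
  define y where "y = (-1) *\<^sub>C R w x"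
  have "R w x \<in> D" "w *\<^sub>C R w x - A (R w x) = x" using resolvent_facts(1,2)[OF lin w] by auto
  moreover from this(1) have "y \<in> D" "A y = (-1) *\<^sub>C A (R w x)"
    using lin unfolding y_def linear_operator_on_def by blast+
  ultimately have y: "y \<in> D" "A y - w *\<^sub>C y = x"
    by (simp_all add: y_def scaleC_simps)
  have ne: "z \<noteq> w" if "z \<in> \<Gamma>" for z
  proof -
    have "z \<in> sector \<rho> \<theta>" using that sector_boundary_subset[of \<theta> \<rho>] \<theta> by auto
    then have "\<rho> \<le> Re z" using \<theta> by (simp add: sector_iff)
    then show ?thesis using d by (auto simp: w_def)
  qed
  have eq: "(1 / (z - w)) *\<^sub>C R z x = R z y - (1 / (z - w)) *\<^sub>C y" if "z \<in> \<Gamma>" for z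
    using R_pole[OF y(1), of z w] \<Gamma>_W that ne[OF that] unfolding y(2) by blast
  note m = R_minus_pole_integral[OF y(1) d, folded w_def]
  show "ray_decay \<rho> \<theta> (\<lambda>z. (1 / (z - w)) *\<^sub>C R z x)"
    by (subst ray_decay_cong[where g = "\<lambda>z. R z y - (1 / (z - w)) *\<^sub>C y"]) (use eq m(1) in auto)
  show "sector_integral \<rho> \<theta> (\<lambda>z. (1 / (z - w)) *\<^sub>C R z x) = - ((2 * of_real pi * \<i>) *\<^sub>C R w x)"
    by (subst sector_integral_cong[where g = "\<lambda>z. R z y - (1 / (z - w)) *\<^sub>C y"])
      (use eq m(2) in \<open>auto simp: y_def scaleC_simps\<close>)
qed

text \<open>\<open>Phi (E 0 h t)\<close> plays the role of exp (- t A) h(A), and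
  \<open>Phi (E 1 h t)\<close> that of its product with A.\<close>

definition E :: "nat \<Rightarrow> (complex \<Rightarrow> complex) \<Rightarrow> real \<Rightarrow> complex \<Rightarrow> complex" where
  "E m h t z = z ^ m * (exp (- of_real t * z) * h z)"

lemma E_decay: "bounded_analytic h \<Longrightarrow> 0 < t \<Longrightarrow> ray_decay \<rho> \<theta> (E m h t)"
  and E_integral: "bounded_analytic h \<Longrightarrow> 0 < t \<Longrightarrow> sector_integral \<rho> \<theta> (E m h t) = 0"
  using exp_decay_integral unfolding E_def[abs_def] by blast+

text \<open>The integral is available only for t > 0. The value x for t \<le> 0 covers t = 0 and
  keeps every \<open>U t\<close> bounded and linear without a side condition.\<close>

definition U :: "real \<Rightarrow> 'a \<Rightarrow> 'a" where
  "U t x = (if t \<le> 0 then x else Phi (E 0 (\<lambda>z. 1) t) x)"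

text \<open>
  For small \<open>t\<close> the integrand of \<open>U t\<close> is not dominated uniformly. Subtracting \<open>1 / (1 + t (z - \<rho>))\<close>,
  whose integral is a multiple of the resolvent at \<open>\<rho> - 1 / t\<close>, leaves a remainder of order
  \<open>min (t r, 1 / (t r))\<close>.
\<close>

lemma U_bound:
  obtains K where "1 \<le> K" "\<And>t x. 0 \<le> t \<Longrightarrow> norm (U t x) \<le> K * exp (- t * \<rho>) * norm x"
proof
  define C where "C = 2 + 1 / cos \<theta>"
  define K where "K = 1 + (C + 1) * M'"
  have C: "0 < C" using cos_\<theta> by (simp add: C_def add_pos_pos)
  show K1: "1 \<le> K" using C M'_pos by (simp add: K_def)
  fix t :: real and x :: 'a
  assume "0 \<le> t"
  show "norm (U t x) \<le> K * exp (- t * \<rho>) * norm x"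
  proof (cases "t = 0")
    case True
    then show ?thesis using K1 mult_right_mono[of 1 K "norm x"] by (simp add: U_def)
  next
    case False
    then have t: "0 < t" using \<open>0 \<le> t\<close> by simp
    define d where "d = 1 / t"
    have d: "0 < d" using t by (simp add: d_def)
    define w where "w = complex_of_real (\<rho> - d)"
    define e where "e = exp (- t * \<rho>)"
    have e: "0 < e" by (simp add: e_def)
    define G where "G z = E 0 (\<lambda>z. 1) t z *\<^sub>C R z x" for z
    define H where "H z = (1 / (z - w)) *\<^sub>C R z x" for z
    define S where "S z = G z + (- of_real (e * d)) *\<^sub>C H z" for z
    have G: "ray_decay \<rho> \<theta> G" unfolding G_def by (intro decay_R E_decay bounded_analytic_one t)
    have H: "ray_decay \<rho> \<theta> H" "sector_integral \<rho> \<theta> H = - ((2 * of_real pi * \<i>) *\<^sub>C R w x)"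
      using R_over_pole_integral[OF d, of x] by (auto simp: H_def[abs_def] w_def)
    have S: "ray_decay \<rho> \<theta> S" unfolding S_def by (intro ray_decay_add G ray_decay_scaleC H)
    have "sector_integral \<rho> \<theta> S = sector_integral \<rho> \<theta> G + (- of_real (e * d)) *\<^sub>C sector_integral \<rho> \<theta> H"
      unfolding S_def[abs_def] sector_integral_add[OF G ray_decay_scaleC[OF H(1)]] sector_integral_scaleC[OF H(1)] ..
    then have GS: "sector_integral \<rho> \<theta> G = sector_integral \<rho> \<theta> S - (of_real (e * d) * (2 * of_real pi * \<i>)) *\<^sub>C R w x"
      unfolding H(2) by (simp add: scaleC_simps)
    have S_le: "norm (S (ray r \<psi>)) \<le> (2 * C * M' * e * norm x) * (d / (d\<^sup>2 + r\<^sup>2))"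
      if r: "0 \<le> r" "\<psi> \<in> {- \<theta>, \<theta>}" for r \<psi>
    proof -
      define \<zeta> where "\<zeta> = of_real r * cis \<psi>"
      define \<xi> where "\<xi> = of_real t * \<zeta>"
      have z: "ray r \<psi> = of_real \<rho> + \<zeta>" by (simp add: \<zeta>_def)
      have in_W: "ray r \<psi> \<in> W" using sector_boundary_I[OF r] \<Gamma>_W by blast
      have \<xi>: "cmod \<xi> = t * r" "Re \<xi> = (t * r) * cos \<theta>"
        using r t by (auto simp: \<xi>_def \<zeta>_def norm_mult)
      have "E 0 (\<lambda>z. 1) t (ray r \<psi>) = of_real e * exp (- \<xi>)"
        by (simp add: E_def e_def \<xi>_def \<zeta>_def exp_of_real[symmetric] exp_add[symmetric] algebra_simps)
      moreover have "of_real (e * d) * (1 / (ray r \<psi> - w)) = of_real e * (1 / (1 + \<xi>))"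
        using t by (simp add: \<zeta>_def w_def d_def \<xi>_def field_simps)
      ultimately have "S (ray r \<psi>) = (of_real e * (exp (- \<xi>) - 1 / (1 + \<xi>))) *\<^sub>C R (ray r \<psi>) x"
        unfolding S_def G_def H_def by (simp add: scaleC_simps right_diff_distrib)
      then have "norm (S (ray r \<psi>)) = e * cmod (exp (- \<xi>) - 1 / (1 + \<xi>)) * norm (R (ray r \<psi>) x)"
        using e by (simp add: norm_scaleC norm_mult)
      also have "\<dots> \<le> e * (C * (2 * (t * r) / (1 + (t * r)\<^sup>2))) * (M' * norm x / (1 + r))"
        using norm_exp_diff_rational_le[OF \<xi> cos_\<theta>(1)] R_bound[OF in_W r(1), of x] e r t C
        by (intro mult_mono mult_left_mono) (auto simp: C_def intro!: mult_nonneg_nonneg divide_nonneg_nonneg)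
      \<comment> \<open>The factor r cancels against the resolvent decay 1 / (1 + r). What remains
        is the Cauchy kernel of width d = 1 / t, whose integral does not depend on t.\<close>
      also have "\<dots> = (2 * C * M' * e * norm x) * (t / (1 + (t * r)\<^sup>2)) * (r / (1 + r))"
        by (simp add: mult_ac)
      also have "\<dots> \<le> (2 * C * M' * e * norm x) * (t / (1 + (t * r)\<^sup>2)) * 1"
        using C M'_pos e r t by (intro mult_left_mono) (auto intro!: mult_nonneg_nonneg divide_nonneg_nonneg)
      also have "t / (1 + (t * r)\<^sup>2) = d / (d\<^sup>2 + r\<^sup>2)"
      proof -
        have "0 < 1 + (t * r)\<^sup>2" by (simp add: add_pos_nonneg)
        moreover have "d\<^sup>2 + r\<^sup>2 = (1 + (t * r)\<^sup>2) / t\<^sup>2"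
          using t by (simp add: d_def field_simps power2_eq_square)
        ultimately show ?thesis using t by (simp add: d_def power2_eq_square)
      qed
      finally show ?thesis by simp
    qed
    have "norm (sector_integral \<rho> \<theta> S) \<le> (2 * C * M' * e * norm x) * pi"
      by (rule sector_integral_norm_le[OF _ d S_le]) (use S in \<open>auto simp: ray_decay_def\<close>)
    moreover have "norm ((of_real (e * d) * (2 * of_real pi * \<i>)) *\<^sub>C R w x) \<le> (2 * M' * e * norm x) * pi"
    proof -
      have "ray d pi = w" by (simp add: w_def complex_eq_iff)
      then have "norm (R w x) \<le> M' * norm x / (1 + d)"
        using R_bound[of d pi x] left_real[of d] d by (simp add: w_def)
      then have "d * norm (R w x) \<le> d * (M' * norm x / (1 + d))" using d by (intro mult_left_mono) auto
      also have "\<dots> = (M' * norm x) * (d / (1 + d))" by simp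
      also have "\<dots> \<le> (M' * norm x) * 1" using d M'_pos by (intro mult_left_mono) auto
      finally have "(2 * e * pi) * (d * norm (R w x)) \<le> (2 * e * pi) * (M' * norm x)"
        using e by (intro mult_left_mono) auto
      then show ?thesis using e d by (simp add: norm_scaleC norm_mult mult_ac)
    qed
    ultimately have "norm (sector_integral \<rho> \<theta> G) \<le> (2 * C * M' * e * norm x) * pi + (2 * M' * e * norm x) * pi"
      unfolding GS by (intro order_trans[OF norm_triangle_ineq4] add_mono)
    also have "\<dots> = (2 * pi) * (((C + 1) * M') * e * norm x)" by (simp add: algebra_simps)
    finally have "norm (sector_integral \<rho> \<theta> G) / (2 * pi) \<le> ((C + 1) * M') * e * norm x"
      by (simp add: pos_divide_le_eq mult_ac)
    also have "\<dots> \<le> K * e * norm x" using e by (intro mult_right_mono) (auto simp: K_def)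
    finally show ?thesis
      using t by (simp add: U_def Phi_def G_def[abs_def] norm_scaleC norm_divide norm_mult e_def)
  qed
qed

lemma U_bounded_linear: "bounded_linear (U t)" and U_scaleC: "U t (c *\<^sub>C x) = c *\<^sub>C U t x"
proof -
  show "U t (c *\<^sub>C x) = c *\<^sub>C U t x"
    unfolding U_def using Phi_bounded_linear(2)[OF E_decay[OF bounded_analytic_one]] by auto
  show "bounded_linear (U t)"
  proof (cases "t \<le> 0")
    case True
    then have "U t = (\<lambda>x. x)" by (auto simp: U_def)
    then show ?thesis by simp
  next
    case False
    then have "U t = Phi (E 0 (\<lambda>z. 1) t)" by (auto simp: U_def)
    then show ?thesis using Phi_bounded_linear(1)[OF E_decay[OF bounded_analytic_one]] False by auto
  qed
qed

lemma U_linear: "linear (U t)"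
  using U_bounded_linear bounded_linear.linear by blast

text \<open>The width 1 / sqrt t is where the roles of d and r change: for r \<ge> d the 1 in the
  minimum is used, below it the factor t r. The integral over the kernel on the right is of order 1
  / d = sqrt t.\<close>

lemma min_kernel_le:
  assumes t: "0 < t" and r: "0 \<le> r" and d: "d = 1 / sqrt t"
  shows "min 1 (t * r) / (1 + r\<^sup>2) \<le> 2 / (d\<^sup>2 + r\<^sup>2)"
proof -
  have d2: "d\<^sup>2 = 1 / t" using t by (simp add: d power_divide)
  have pos: "0 < 1 + r\<^sup>2" "0 < d\<^sup>2 + r\<^sup>2" using t by (auto simp: d2 add_pos_nonneg)
  show ?thesis
  proof (cases "d\<^sup>2 \<le> r\<^sup>2")
    case True
    have "min 1 (t * r) / (1 + r\<^sup>2) \<le> 1 / (1 + r\<^sup>2)" using pos by (intro divide_right_mono) auto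
    also have "\<dots> \<le> 2 / (d\<^sup>2 + r\<^sup>2)" using pos True by (simp add: frac_le_eq divide_simps)
    finally show ?thesis .
  next
    case False
    have "min 1 (t * r) / (1 + r\<^sup>2) \<le> t * r / (1 + r\<^sup>2)" using pos by (intro divide_right_mono) auto
    also have "\<dots> \<le> t"
    proof -
      have "r \<le> 1 + r\<^sup>2" using sum_squares_bound[of r 1] r by simp
      then show ?thesis using t pos by (simp add: pos_divide_le_eq)
    qed
    also have "t \<le> 2 / (d\<^sup>2 + r\<^sup>2)"
    proof -
      have "t * (d\<^sup>2 + r\<^sup>2) \<le> t * (2 * d\<^sup>2)" using False t by (intro mult_left_mono) auto
      also have "\<dots> = 2" using t by (simp add: d2)
      finally show ?thesis using pos by (simp add: pos_le_divide_eq)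
    qed
    finally show ?thesis .
  qed
qed

text \<open>For x in the domain, G(z) = R(z, A) x - x / (z - w) decays quadratically and has
  integral 2 pi i x, while exp (- t z) / (z - w) integrates to 0. Hence U(t) x - exp (- t \<rho>) x
  is the normalised integral of (exp (- t z) - exp (- t \<rho>)) G(z), which is O(sqrt t).\<close>

lemma U_tendsto_domain:
  assumes x: "x \<in> D"
  shows "((\<lambda>t. U t x) \<longlongrightarrow> x) (at_right 0)"
proof -
  define w where "w = complex_of_real (\<rho> - 1)"
  define G where "G z = R z x - (1 / (z - w)) *\<^sub>C x" for z
  have G: "ray_decay \<rho> \<theta> G" "sector_integral \<rho> \<theta> G = (2 * of_real pi * \<i>) *\<^sub>C x"
    using R_minus_pole_integral[OF x, of 1] by (auto simp: G_def[abs_def] w_def)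
  obtain C where C: "\<And>r \<psi>. 0 \<le> r \<Longrightarrow> \<psi> \<in> {- \<theta>, \<theta>} \<Longrightarrow> norm (G (ray r \<psi>)) \<le> C / (1 + r\<^sup>2)"
    using G(1) unfolding ray_decay_def by blast
  have C0: "0 \<le> C" using C[of 0 \<theta>] by (auto intro: order_trans[OF norm_ge_zero])
  define h where "h z = 1 / (z - w)" for z
  have h: "bounded_analytic h"
  proof -
    have far: "1 \<le> cmod (z - w)" if "z \<in> sector \<rho> \<theta>" for z
    proof -
      have "\<rho> \<le> Re z" using that \<theta> by (simp add: sector_iff)
      then show ?thesis using complex_Re_le_cmod[of "z - w"] by (simp add: w_def)
    qed
    have "z \<noteq> w" if "z \<in> sector \<rho> \<theta>" for z using far[OF that] by auto
    then have "h analytic_on sector \<rho> \<theta>" unfolding h_def by (auto intro!: analytic_intros)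
    moreover have "cmod (h z) \<le> 1" if "z \<in> sector \<rho> \<theta>" for z
      using far[OF that] by (simp add: h_def norm_divide divide_le_eq_1)
    ultimately show ?thesis unfolding bounded_analytic_def by blast
  qed
  have le: "norm (U t x - exp (- t * \<rho>) *\<^sub>R x) \<le> (2 * C * exp (- t * \<rho>)) * sqrt t" if t: "0 < t" for t
  proof -
    define e where "e = exp (- t * \<rho>)"
    have e: "0 < e" by (simp add: e_def)
    define d where "d = 1 / sqrt t"
    have d: "0 < d" using t by (simp add: d_def)
    define F where "F z = E 0 (\<lambda>z. 1) t z *\<^sub>C R z x" for z
    define S where "S z = (E 0 (\<lambda>z. 1) t z - of_real e) *\<^sub>C G z" for z
    have F: "ray_decay \<rho> \<theta> F" unfolding F_def by (intro decay_R E_decay bounded_analytic_one t)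
    have hx: "ray_decay \<rho> \<theta> (\<lambda>z. (-1) *\<^sub>C (E 0 h t z *\<^sub>C x))"
      by (intro ray_decay_scaleC ray_decay_bounded_linear[OF scaleC.bounded_linear_left] E_decay h t)
    have eq: "S z = (F z + (-1) *\<^sub>C (E 0 h t z *\<^sub>C x)) + (- of_real e) *\<^sub>C G z" for z
    proof -
      have "E 0 h t z = E 0 (\<lambda>z. 1) t z * (1 / (z - w))" by (simp add: E_def h_def)
      then show ?thesis unfolding S_def F_def G_def by (simp add: scaleC_simps algebra_simps)
    qed
    have S: "ray_decay \<rho> \<theta> S"
      unfolding eq[abs_def] by (intro ray_decay_add F hx ray_decay_scaleC G)
    have "sector_integral \<rho> \<theta> (\<lambda>z. (-1) *\<^sub>C (E 0 h t z *\<^sub>C x)) = 0"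
      using sector_integral_scaleC[OF ray_decay_bounded_linear[OF scaleC.bounded_linear_left E_decay[OF h t]], of "-1" 0 x]
        sector_integral_scaleC_const[OF E_decay[OF h t], of 0 x] E_integral[OF h t]
      by (simp add: scaleC_simps)
    then have "sector_integral \<rho> \<theta> S = sector_integral \<rho> \<theta> F + (- of_real e) *\<^sub>C ((2 * of_real pi * \<i>) *\<^sub>C x)"
      unfolding eq[abs_def] sector_integral_add[OF ray_decay_add[OF F hx] ray_decay_scaleC[OF G(1)]]
        sector_integral_add[OF F hx] sector_integral_scaleC[OF G(1)] G(2) by simp
    then have "(1 / (2 * of_real pi * \<i>)) *\<^sub>C sector_integral \<rho> \<theta> S = U t x - e *\<^sub>R x"
      using t by (simp add: U_def Phi_def F_def[abs_def] scaleC_simps flip: scaleC_of_real)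
    moreover have "norm ((1 / (2 * of_real pi * \<i>)) *\<^sub>C sector_integral \<rho> \<theta> S) =
        norm (sector_integral \<rho> \<theta> S) / (2 * pi)"
      by (simp add: norm_scaleC norm_divide norm_mult)
    ultimately have "norm (U t x - e *\<^sub>R x) = norm (sector_integral \<rho> \<theta> S) / (2 * pi)"
      by simp
    moreover have "norm (sector_integral \<rho> \<theta> S) \<le> (4 * C * e / d) * pi"
    proof (rule sector_integral_norm_le[OF _ d])
      show "continuous_on \<Gamma> S" using S by (simp add: ray_decay_def)
      fix r \<psi> :: real assume r: "0 \<le> r" "\<psi> \<in> {- \<theta>, \<theta>}"
      define \<xi> where "\<xi> = of_real (t * r) * cis \<psi>"
      have \<xi>: "cmod \<xi> = t * r" "0 \<le> Re \<xi>" using r t cos_\<theta> by (auto simp: \<xi>_def norm_mult)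
      have "E 0 (\<lambda>z. 1) t (ray r \<psi>) = of_real e * exp (- \<xi>)"
        by (simp add: E_def e_def \<xi>_def exp_of_real[symmetric] exp_add[symmetric] algebra_simps)
      then have "cmod (E 0 (\<lambda>z. 1) t (ray r \<psi>) - of_real e) = e * cmod (exp (- \<xi>) - 1)"
        using e by (simp add: norm_mult flip: right_diff_distrib[of "of_real e" _ 1, simplified])
      also have "cmod (exp (- \<xi>) - 1) \<le> 2 * min 1 (t * r)"
      proof -
        have "cmod (exp (- \<xi>) - 1) \<le> t * r" using norm_exp_diff_le(1)[of "- \<xi>" 0 0] \<xi> by simp
        moreover have "cmod (exp (- \<xi>) - 1) \<le> 1 + 1"
          by (rule order_trans[OF norm_triangle_ineq4]) (use \<xi> in simp)
        ultimately show ?thesis using r t by (auto simp: min_def intro: order_trans)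
      qed
      finally have "cmod (E 0 (\<lambda>z. 1) t (ray r \<psi>) - of_real e) \<le> e * (2 * min 1 (t * r))"
        using e by simp
      then have "norm (S (ray r \<psi>)) \<le> (e * (2 * min 1 (t * r))) * (C / (1 + r\<^sup>2))"
        unfolding S_def norm_scaleC using C[OF r] e r t by (intro mult_mono) auto
      also have "\<dots> = (2 * C * e) * (min 1 (t * r) / (1 + r\<^sup>2))" by simp
      also have "\<dots> \<le> (2 * C * e) * (2 / (d\<^sup>2 + r\<^sup>2))"
        using C0 e by (intro mult_left_mono min_kernel_le[OF t r(1) d_def]) auto
      also have "\<dots> = 4 * C * e / d * (d / (d\<^sup>2 + r\<^sup>2))" using d by simp
      finally show "norm (S (ray r \<psi>)) \<le> 4 * C * e / d * (d / (d\<^sup>2 + r\<^sup>2))" .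
    qed
    ultimately have "norm (U t x - e *\<^sub>R x) \<le> (4 * C * e / d) * pi / (2 * pi)"
      by (elim ssubst) (rule divide_right_mono, simp_all)
    then show ?thesis unfolding e_def d_def by (simp add: mult_ac)
  qed
  have "((\<lambda>t. U t x - exp (- t * \<rho>) *\<^sub>R x) \<longlongrightarrow> 0) (at_right 0)"
  proof (rule Lim_null_comparison)
    show "\<forall>\<^sub>F t in at_right 0. norm (U t x - exp (- t * \<rho>) *\<^sub>R x) \<le> (2 * C * exp (- t * \<rho>)) * sqrt t"
      using le by (auto simp: eventually_at_filter)
    have "((\<lambda>t. (2 * C * exp (- t * \<rho>)) * sqrt t) \<longlongrightarrow> (2 * C * exp (- 0 * \<rho>)) * sqrt 0) (at_right 0)"
      by (intro tendsto_intros)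
    then show "((\<lambda>t. (2 * C * exp (- t * \<rho>)) * sqrt t) \<longlongrightarrow> 0) (at_right 0)" by simp
  qed
  moreover have "((\<lambda>t. exp (- t * \<rho>) *\<^sub>R x) \<longlongrightarrow> exp (- 0 * \<rho>) *\<^sub>R x) (at_right 0)"
    by (intro tendsto_intros)
  ultimately have "((\<lambda>t. (U t x - exp (- t * \<rho>) *\<^sub>R x) + exp (- t * \<rho>) *\<^sub>R x) \<longlongrightarrow> 0 + exp (- 0 * \<rho>) *\<^sub>R x) (at_right 0)"
    by (rule tendsto_add)
  then show ?thesis by simp
qed

end

section \<open>The Cauchy problem and uniqueness of the semigroup\<close>

lemma has_vector_derivative_iff_quotient:
  "(f has_vector_derivative d) (at x within S) \<longleftrightarrow>
    ((\<lambda>y. (f y - f x) /\<^sub>R (y - x)) \<longlongrightarrow> d) (at x within S)"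
proof -
  have "((\<lambda>y. (f y - f x) /\<^sub>R (y - x)) \<longlongrightarrow> d) (at x within S) \<longleftrightarrow>
      ((\<lambda>y. norm ((f y - f x) /\<^sub>R (y - x) - d)) \<longlongrightarrow> 0) (at x within S)"
    by (subst tendsto_norm_zero_iff) (rule Lim_null)
  also have "\<dots> \<longleftrightarrow> ((\<lambda>y. norm (f y - f x - (y - x) *\<^sub>R d) / norm (y - x)) \<longlongrightarrow> 0) (at x within S)"
  proof (rule tendsto_cong)
    have "norm ((f y - f x) /\<^sub>R (y - x) - d) = norm (f y - f x - (y - x) *\<^sub>R d) / norm (y - x)"
      if "y \<noteq> x" for y
    proof -
      have "(f y - f x) /\<^sub>R (y - x) - d = (f y - f x - (y - x) *\<^sub>R d) /\<^sub>R (y - x)"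
        using that by (simp add: scaleR_diff_right)
      then show ?thesis by (simp add: divide_inverse mult.commute)
    qed
    then show "\<forall>\<^sub>F y in at x within S. norm ((f y - f x) /\<^sub>R (y - x) - d) =
        norm (f y - f x - (y - x) *\<^sub>R d) / norm (y - x)"
      by (auto simp: eventually_at_filter)
  qed
  finally show ?thesis
    unfolding has_vector_derivative_def has_derivative_iff_norm by (simp add: bounded_linear_scaleR_left)
qed

lemma strong_tendsto:
  fixes F :: "'b \<Rightarrow> 'a::real_normed_vector \<Rightarrow> 'c::real_normed_vector"
  assumes lin: "\<And>s. linear (F s)" and le: "\<forall>\<^sub>F s in Fl. \<forall>y. norm (F s y) \<le> K * norm y"
    and lim: "((\<lambda>s. F s v0) \<longlongrightarrow> g) Fl" and v: "(v \<longlongrightarrow> v0) Fl"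
  shows "((\<lambda>s. F s (v s)) \<longlongrightarrow> g) Fl"
proof -
  have "((\<lambda>s. F s (v s - v0)) \<longlongrightarrow> 0) Fl"
  proof (rule Lim_null_comparison)
    show "\<forall>\<^sub>F s in Fl. norm (F s (v s - v0)) \<le> K * norm (v s - v0)"
      using le by eventually_elim blast
    have "((\<lambda>s. K * norm (v s - v0)) \<longlongrightarrow> K * norm (v0 - v0)) Fl" by (intro tendsto_intros v)
    then show "((\<lambda>s. K * norm (v s - v0)) \<longlongrightarrow> 0) Fl" by simp
  qed
  from tendsto_add[OF this lim] show ?thesis by (simp add: linear_diff[OF lin])
qed

context sector_contour
begin

lemma U_bound_local:
  obtains K where "1 \<le> K" "\<And>t x. 0 \<le> t \<Longrightarrow> t \<le> T \<Longrightarrow> norm (U t x) \<le> K * norm x"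
proof -
  obtain K where K: "1 \<le> K" "\<And>t x. 0 \<le> t \<Longrightarrow> norm (U t x) \<le> K * exp (- t * \<rho>) * norm x"
    using U_bound by blast
  show ?thesis
  proof
    have "1 \<le> exp (\<bar>T\<bar> * \<bar>\<rho>\<bar>)" by simp
    then show "1 \<le> K * exp (\<bar>T\<bar> * \<bar>\<rho>\<bar>)" using K(1) mult_mono[of 1 K 1 "exp (\<bar>T\<bar> * \<bar>\<rho>\<bar>)"] by simp
    fix t :: real and x :: 'a assume t: "0 \<le> t" "t \<le> T"
    have "- t * \<rho> \<le> t * \<bar>\<rho>\<bar>" using mult_left_mono[of "- \<rho>" "\<bar>\<rho>\<bar>" t] t by simp
    also have "\<dots> \<le> \<bar>T\<bar> * \<bar>\<rho>\<bar>" using t by (intro mult_right_mono) auto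
    finally have "K * exp (- t * \<rho>) * norm x \<le> K * exp (\<bar>T\<bar> * \<bar>\<rho>\<bar>) * norm x"
      using K(1) by (intro mult_right_mono mult_left_mono) auto
    then show "norm (U t x) \<le> K * exp (\<bar>T\<bar> * \<bar>\<rho>\<bar>) * norm x" using K(2)[OF t(1), of x] by simp
  qed
qed

lemma U_tendsto: "((\<lambda>t. U t x) \<longlongrightarrow> x) (at_right 0)"
proof (rule tendstoI)
  fix e :: real assume e: "0 < e"
  obtain K where K: "1 \<le> K" "\<And>t x. 0 \<le> t \<Longrightarrow> t \<le> 1 \<Longrightarrow> norm (U t x) \<le> K * norm x"
    using U_bound_local[of 1] by blast
  have "x \<in> closure D" using dense by simp
  moreover have "0 < e / (3 * K)" using e K(1) by simp
  ultimately obtain y where y: "y \<in> D" "dist y x < e / (3 * K)"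
    unfolding closure_approachable by blast
  have "\<forall>\<^sub>F t in at_right 0. dist (U t y) y < e / 3"
    using tendstoD[OF U_tendsto_domain[OF y(1)], of "e / 3"] e by simp
  moreover have "\<forall>\<^sub>F t in at_right 0. 0 < t \<and> t < (1::real)"
    by (rule eventually_at_rightI[of 0 1]) auto
  ultimately show "\<forall>\<^sub>F t in at_right 0. dist (U t x) x < e"
  proof eventually_elim
    case (elim t)
    have Kxy: "K * norm (x - y) < e / 3"
      using y(2) K(1) by (simp add: dist_norm norm_minus_commute field_simps)
    moreover have "1 * norm (x - y) \<le> K * norm (x - y)" using K(1) by (intro mult_right_mono) auto
    moreover have "norm (U t (x - y)) \<le> K * norm (x - y)" using elim by (intro K(2)) auto
    moreover have "U t x - x = U t (x - y) + (U t y - y) - (x - y)" by (simp add: linear_diff[OF U_linear])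
    then have "norm (U t x - x) \<le> norm (U t (x - y)) + norm (U t y - y) + norm (x - y)"
      using norm_triangle_ineq4[of "U t (x - y) + (U t y - y)" "x - y"]
        norm_triangle_ineq[of "U t (x - y)" "U t y - y"] by simp
    ultimately show ?case using elim(1) by (simp add: dist_norm)
  qed
qed

text \<open>The second-order Taylor remainder of the exponential is integrated. The restriction |k|
  \<le> t / 2 keeps all times at least t / 2, and the resulting decay absorbs the factor |z|^2
  uniformly in k.\<close>

lemma Phi_E_derivative:
  assumes h: "bounded_analytic h" and t: "0 < t"
  shows "((\<lambda>t. Phi (E 0 h t) x) has_vector_derivative - Phi (E 1 h t) x) (at t)"
proof -
  obtain Ch where Ch: "\<And>z. z \<in> sector \<rho> \<theta> \<Longrightarrow> cmod (h z) \<le> Ch"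
    using h by (auto simp: bounded_analytic_def)
  have "0 < t / 2 * cos \<theta>" using t cos_\<theta> by simp
  then obtain C2 where C2: "0 \<le> C2"
    "\<And>r. 0 \<le> r \<Longrightarrow> exp (- (t / 2 * cos \<theta>) * r) * (1 + r) ^ 2 \<le> C2 / (1 + r\<^sup>2)"
    using exp_times_power_le by blast
  define C where "C = exp (2 * t * \<bar>\<rho>\<bar>) * (1 + \<bar>\<rho>\<bar>)\<^sup>2 * Ch * C2"
  show ?thesis
  proof (rule has_vector_derivative_quadratic)
    show "0 < t / 2" using t by simp
    fix k :: real assume k: "\<bar>k\<bar> \<le> t / 2"
    then have tk: "0 < t + k" "t / 2 \<le> t + k" "t + k \<le> 2 * t" using t by auto
    define F where "F z = (E 0 h (t + k) z + (-1) * E 0 h t z) + of_real k * E 1 h t z" for z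
    have d: "ray_decay \<rho> \<theta> (E 0 h (t + k))" "ray_decay \<rho> \<theta> (\<lambda>z. (-1) * E 0 h t z)"
      "ray_decay \<rho> \<theta> (\<lambda>z. of_real k * E 1 h t z)"
      by (intro ray_decay_cmult E_decay h t tk)+
    have F: "ray_decay \<rho> \<theta> F" unfolding F_def by (intro ray_decay_add d)
    have "Phi F x = Phi (E 0 h (t + k)) x - Phi (E 0 h t) x - k *\<^sub>R (- Phi (E 1 h t) x)"
      unfolding F_def[abs_def] Phi_add[OF ray_decay_add[OF d(1,2)] d(3)] Phi_add[OF d(1,2)]
        Phi_cmult[OF E_decay[OF h t]]
      by (simp add: scaleC_simps scaleC_of_real)
    moreover have "norm (Phi F x) \<le> (k\<^sup>2 * C) * M * norm x"
    proof (rule Phi_norm_le[OF F])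
      fix r \<psi> :: real assume r: "0 \<le> r" "\<psi> \<in> {- \<theta>, \<theta>}"
      define z where "z = ray r \<psi>"
      have zs: "z \<in> sector \<rho> \<theta>"
        using sector_boundary_I[OF r] sector_boundary_subset[of \<theta> \<rho>] \<theta> unfolding z_def by auto
      have hC: "cmod (h z) \<le> Ch" by (rule Ch[OF zs])
      then have Ch0: "0 \<le> Ch" by (rule order_trans[OF norm_ge_zero])
      \<comment> \<open>A common upper bound for Re (- s z) over all s in [t / 2, 2 t], whatever the
        sign of \<rho>.\<close>
      define m where "m = 2 * t * \<bar>\<rho>\<bar> - (t / 2 * cos \<theta>) * r"
      have Re: "Re (- of_real s * z) \<le> m" if s: "t / 2 \<le> s" "s \<le> 2 * t" for s
      proof -
        have "Re z = \<rho> + r * cos \<theta>" using r by (auto simp: z_def)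
        moreover have "- (s * \<rho>) \<le> 2 * t * \<bar>\<rho>\<bar>"
        proof -
          have "- (s * \<rho>) \<le> s * \<bar>\<rho>\<bar>" using mult_left_mono[of "- \<rho>" "\<bar>\<rho>\<bar>" s] s t by simp
          also have "\<dots> \<le> 2 * t * \<bar>\<rho>\<bar>" using s by (intro mult_right_mono) auto
          finally show ?thesis .
        qed
        moreover have "t / 2 * (cos \<theta> * r) \<le> s * (cos \<theta> * r)" using s r cos_\<theta> by (intro mult_right_mono) auto
        ultimately show ?thesis by (simp add: m_def algebra_simps)
      qed
      have "F z = (exp (- of_real (t + k) * z) - exp (- of_real t * z) -
          (- of_real (t + k) * z - - of_real t * z) * exp (- of_real t * z)) * h z"
        by (simp add: F_def E_def algebra_simps)
      also have "cmod \<dots> \<le> (exp m * (cmod (- of_real (t + k) * z - - of_real t * z))\<^sup>2) * Ch"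
        unfolding norm_mult[of _ "h z"]
        by (rule mult_mono[OF norm_exp_diff_le(2)[OF Re Re] hC]) (use tk t in auto)
      also have "- of_real (t + k) * z - - of_real t * z = - of_real k * z" by (simp add: algebra_simps)
      also have "(exp m * (cmod (- of_real k * z))\<^sup>2) * Ch = k\<^sup>2 * (exp m * (cmod z)\<^sup>2 * Ch)"
        by (simp add: norm_mult power_mult_distrib)
      also have "\<dots> \<le> k\<^sup>2 * (exp m * ((1 + \<bar>\<rho>\<bar>) * (1 + r))\<^sup>2 * Ch)"
        unfolding z_def using r Ch0 by (intro mult_left_mono mult_right_mono power_mono norm_ray_le) auto
      also have "\<dots> = k\<^sup>2 * (exp (2 * t * \<bar>\<rho>\<bar>) * (1 + \<bar>\<rho>\<bar>)\<^sup>2 * Ch) * (exp (- (t / 2 * cos \<theta>) * r) * (1 + r) ^ 2)"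
      proof -
        have "exp m = exp (2 * t * \<bar>\<rho>\<bar>) * exp (- (t / 2 * cos \<theta>) * r)"
          by (simp only: m_def diff_conv_add_uminus exp_add mult_minus_left)
        then show ?thesis by (simp only: power_mult_distrib mult_ac)
      qed
      also have "\<dots> \<le> k\<^sup>2 * (exp (2 * t * \<bar>\<rho>\<bar>) * (1 + \<bar>\<rho>\<bar>)\<^sup>2 * Ch) * (C2 / (1 + r\<^sup>2))"
        using Ch0 by (intro mult_left_mono C2(2) r) auto
      finally show "cmod (F (ray r \<psi>)) \<le> k\<^sup>2 * C / (1 + r\<^sup>2)"
        by (simp add: C_def z_def mult_ac)
    qed
    ultimately show "norm (Phi (E 0 h (t + k)) x - Phi (E 0 h t) x - k *\<^sub>R (- Phi (E 1 h t) x)) \<le> (C * M * norm x) * k\<^sup>2"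
      by (simp add: mult_ac)
  qed
qed

text \<open>With v and y the values for exponents 0 and 1, the resolvent identity turns R(w, A) (w v
  - y) into v plus a scalar integral times R(w, A) x, and that integral is 0. So v lies in the range
  of the resolvent, which is D, and A v = y follows.\<close>

lemma Phi_E_domain:
  assumes h: "bounded_analytic h" and t: "0 < t"
  shows "Phi (E 0 h t) x \<in> D" and "A (Phi (E 0 h t) x) = Phi (E 1 h t) x"
proof -
  define w where "w = complex_of_real (\<rho> - 1)"
  have w: "w \<in> resolvent_set D A" unfolding w_def using left_real[of 1] W_resolvent by simp
  define v where "v = Phi (E 0 h t) x"
  define y where "y = Phi (E 1 h t) x"
  have d: "ray_decay \<rho> \<theta> (\<lambda>z. w * E 0 h t z)" "ray_decay \<rho> \<theta> (\<lambda>z. (-1) * E 1 h t z)"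
    by (intro ray_decay_cmult E_decay h t)+
  have "w *\<^sub>C v - y = Phi (\<lambda>z. w * E 0 h t z + (-1) * E 1 h t z) x"
    unfolding Phi_add[OF d] Phi_cmult[OF E_decay[OF h t]] v_def y_def by (simp add: scaleC_simps)
  then have "R w (w *\<^sub>C v - y) = (1 / (2 * of_real pi * \<i>)) *\<^sub>C
      sector_integral \<rho> \<theta> (\<lambda>z. (w * E 0 h t z + (-1) * E 1 h t z) *\<^sub>C R w (R z x))"
    using R_Phi(1)[OF ray_decay_add[OF d] w, of x] by simp
  also have "sector_integral \<rho> \<theta> (\<lambda>z. (w * E 0 h t z + (-1) * E 1 h t z) *\<^sub>C R w (R z x)) =
      sector_integral \<rho> \<theta> (\<lambda>z. E 0 h t z *\<^sub>C R z x + (-1) *\<^sub>C (E 0 h t z *\<^sub>C R w x))"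
  proof (rule sector_integral_cong)
    fix z assume "z \<in> \<Gamma>"
    then have z: "z \<in> resolvent_set D A" using \<Gamma>_W W_resolvent by blast
    have "w * E 0 h t z + (-1) * E 1 h t z = E 0 h t z * (w - z)" by (simp add: E_def algebra_simps)
    then have "(w * E 0 h t z + (-1) * E 1 h t z) *\<^sub>C R w (R z x) = E 0 h t z *\<^sub>C ((w - z) *\<^sub>C R w (R z x))"
      by (simp only: scaleC_scaleC)
    also have "\<dots> = E 0 h t z *\<^sub>C (R z x - R w x)" unfolding resolvent_identity[OF lin w z] ..
    finally show "(w * E 0 h t z + (-1) * E 1 h t z) *\<^sub>C R w (R z x) =
        E 0 h t z *\<^sub>C R z x + (-1) *\<^sub>C (E 0 h t z *\<^sub>C R w x)"
      by (simp add: scaleC_simps)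
  qed
  also have "\<dots> = sector_integral \<rho> \<theta> (\<lambda>z. E 0 h t z *\<^sub>C R z x)"
  proof -
    have c: "ray_decay \<rho> \<theta> (\<lambda>z. E 0 h t z *\<^sub>C R w x)"
      by (rule ray_decay_bounded_linear[OF scaleC.bounded_linear_left E_decay[OF h t]])
    show ?thesis
      unfolding sector_integral_add[OF decay_R[OF E_decay[OF h t]] ray_decay_scaleC[OF c]]
        sector_integral_scaleC[OF c] sector_integral_scaleC_const[OF E_decay[OF h t]] E_integral[OF h t]
      by (simp add: scaleC_simps)
  qed
  finally have v: "R w (w *\<^sub>C v - y) = v" by (simp add: v_def Phi_def)
  then show mem: "Phi (E 0 h t) x \<in> D" using resolvent_facts(1)[OF lin w] v_def by metis
  have "w *\<^sub>C v - A v = w *\<^sub>C v - y" using resolvent_facts(2)[OF lin w, of "w *\<^sub>C v - y"] unfolding v .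
  then show "A (Phi (E 0 h t) x) = Phi (E 1 h t) x" by (simp add: v_def y_def)
qed

text \<open>z R(z, A) y = R(z, A) A y + y on the domain; the term y carries a scalar integral equal
  to 0.\<close>

lemma Phi_E_on_domain:
  assumes h: "bounded_analytic h" and t: "0 < t" and y: "y \<in> D"
  shows "Phi (E 1 h t) y = Phi (E 0 h t) (A y)"
proof -
  have "sector_integral \<rho> \<theta> (\<lambda>z. E 1 h t z *\<^sub>C R z y) =
      sector_integral \<rho> \<theta> (\<lambda>z. E 0 h t z *\<^sub>C R z (A y) + E 0 h t z *\<^sub>C y)"
  proof (rule sector_integral_cong)
    fix z assume "z \<in> \<Gamma>"
    then have zW: "z \<in> W" and z: "z \<in> resolvent_set D A" using \<Gamma>_W W_resolvent by blast+
    have "z *\<^sub>C R z y - R z (A y) = y"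
      using resolvent_facts(4)[OF lin z y] unfolding linear_diff[OF R_linear[OF zW]] resolvent_facts(5)[OF lin z] .
    then have "z *\<^sub>C R z y = R z (A y) + y" by (simp add: algebra_simps)
    moreover have "E 1 h t z *\<^sub>C R z y = E 0 h t z *\<^sub>C (z *\<^sub>C R z y)"
      by (simp add: E_def scaleC_scaleC mult_ac)
    ultimately show "E 1 h t z *\<^sub>C R z y = E 0 h t z *\<^sub>C R z (A y) + E 0 h t z *\<^sub>C y"
      by (simp add: scaleC_add_right)
  qed
  also have "\<dots> = sector_integral \<rho> \<theta> (\<lambda>z. E 0 h t z *\<^sub>C R z (A y))"
    unfolding sector_integral_add[OF decay_R[OF E_decay[OF h t]]
        ray_decay_bounded_linear[OF scaleC.bounded_linear_left E_decay[OF h t]]]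
      sector_integral_scaleC_const[OF E_decay[OF h t]] E_integral[OF h t]
    by (simp add: scaleC_simps)
  finally show ?thesis by (simp add: Phi_def)
qed

lemma U_derivative:
  assumes t: "0 < t"
  shows "((\<lambda>t. U t x) has_vector_derivative - Phi (E 1 (\<lambda>z. 1) t) x) (at t)"
  by (rule has_vector_derivative_transform_within_open[OF Phi_E_derivative[OF bounded_analytic_one t], of "{0<..}"])
    (use t in \<open>auto simp: U_def\<close>)

lemma U_domain: "0 < t \<Longrightarrow> U t x \<in> D"
  and A_U: "0 < t \<Longrightarrow> A (U t x) = Phi (E 1 (\<lambda>z. 1) t) x"
  and U_A: "0 < t \<Longrightarrow> y \<in> D \<Longrightarrow> U t (A y) = Phi (E 1 (\<lambda>z. 1) t) y"
  using Phi_E_domain[OF bounded_analytic_one] Phi_E_on_domain[OF bounded_analytic_one]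
  by (auto simp: U_def)

lemma U_continuous: "continuous_on {0..} (\<lambda>t. U t x)"
  unfolding continuous_on_def
proof
  fix t :: real assume "t \<in> {0..}"
  then consider "t = 0" | "0 < t" by fastforce
  then show "((\<lambda>t. U t x) \<longlongrightarrow> U t x) (at t within {0..})"
  proof cases
    case 1
    then show ?thesis using U_tendsto[of x] by (simp add: at_within_Ici_at_right U_def)
  next
    case 2
    then have "isCont (\<lambda>t. U t x) t" using has_vector_derivative_continuous[OF U_derivative] by blast
    then show ?thesis unfolding isCont_def by (rule tendsto_within_subset) simp
  qed
qed

text \<open>The function \<open>\<tau> \<mapsto> U (t - \<tau>) (w \<tau>)\<close> has derivative \<open>0\<close>.\<close>

lemma Cauchy_problem_unique:
  assumes t: "0 < t" and cont: "continuous_on {0..t} w"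
    and w: "\<And>\<tau>. 0 < \<tau> \<Longrightarrow> \<tau> < t \<Longrightarrow> w \<tau> \<in> D \<and> (w has_vector_derivative - A (w \<tau>)) (at \<tau>)"
  shows "w t = U t (w 0)"
proof -
  define g where "g \<tau> = U (t - \<tau>) (w \<tau>)" for \<tau>
  obtain K where K: "1 \<le> K" "\<And>s x. 0 \<le> s \<Longrightarrow> s \<le> t \<Longrightarrow> norm (U s x) \<le> K * norm x"
    using U_bound_local[of t] by blast
  have "continuous_on {0..t} g"
    unfolding continuous_on_def
  proof
    fix \<tau> assume \<tau>: "\<tau> \<in> {0..t}"
    show "(g \<longlongrightarrow> g \<tau>) (at \<tau> within {0..t})"
      unfolding g_def
    proof (rule strong_tendsto[OF U_linear, where ?v0.0 = "w \<tau>"])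
      show "\<forall>\<^sub>F s in at \<tau> within {0..t}. \<forall>y. norm (U (t - s) y) \<le> K * norm y"
        using K(2) by (auto simp: eventually_at_filter)
      have "continuous_on {0..t} (\<lambda>s. U (t - s) (w \<tau>))"
        by (rule continuous_on_compose2[OF U_continuous]) (auto intro!: continuous_intros)
      then show "((\<lambda>s. U (t - s) (w \<tau>)) \<longlongrightarrow> U (t - \<tau>) (w \<tau>)) (at \<tau> within {0..t})"
        using \<tau> by (auto simp: continuous_on_def)
      show "(w \<longlongrightarrow> w \<tau>) (at \<tau> within {0..t})" using cont \<tau> by (auto simp: continuous_on_def)
    qed
  qed
  moreover have "(g has_vector_derivative 0) (at \<tau>)" if \<tau>: "\<tau> \<in> {0<..<t}" for \<tau>
    unfolding has_vector_derivative_iff_quotient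
  proof -
    have w\<tau>: "w \<tau> \<in> D" "(w has_vector_derivative - A (w \<tau>)) (at \<tau>)" using w \<tau> by auto
    have s: "0 < t - \<tau>" using \<tau> by simp
    have near: "\<forall>\<^sub>F s in at \<tau>. s \<in> {0<..<t}" using \<tau> eventually_at_in_open'[of "{0<..<t}" \<tau>] by simp
    have dU: "((\<lambda>\<sigma>. U (t - \<sigma>) x) has_vector_derivative Phi (E 1 (\<lambda>z. 1) (t - \<tau>)) x) (at \<tau>)" for x
    proof -
      have "((\<lambda>\<sigma>. t - \<sigma>) has_vector_derivative -1) (at \<tau>)" by (auto intro!: derivative_eq_intros)
      from vector_diff_chain_at[OF this U_derivative[OF s]] show ?thesis by (simp add: o_def)
    qed
    \<comment> \<open>The operators vary only strongly, so the product rule is done on the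
      difference quotient: one part moves the vector under equibounded operators, the other moves
      the operator at the fixed vector w \<tau>. The two limits cancel.\<close>
    have 1: "((\<lambda>\<sigma>. U (t - \<sigma>) ((w \<sigma> - w \<tau>) /\<^sub>R (\<sigma> - \<tau>))) \<longlongrightarrow> U (t - \<tau>) (- A (w \<tau>))) (at \<tau>)"
    proof (rule strong_tendsto[OF U_linear])
      show "\<forall>\<^sub>F s in at \<tau>. \<forall>y. norm (U (t - s) y) \<le> K * norm y"
        using near by eventually_elim (use K(2) in auto)
      show "((\<lambda>s. U (t - s) (- A (w \<tau>))) \<longlongrightarrow> U (t - \<tau>) (- A (w \<tau>))) (at \<tau>)"
        using has_vector_derivative_continuous[OF dU] by (simp add: isCont_def)
      show "((\<lambda>\<sigma>. (w \<sigma> - w \<tau>) /\<^sub>R (\<sigma> - \<tau>)) \<longlongrightarrow> - A (w \<tau>)) (at \<tau>)"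
        using w\<tau>(2) unfolding has_vector_derivative_iff_quotient .
    qed
    have 2: "((\<lambda>\<sigma>. (U (t - \<sigma>) (w \<tau>) - U (t - \<tau>) (w \<tau>)) /\<^sub>R (\<sigma> - \<tau>)) \<longlongrightarrow> U (t - \<tau>) (A (w \<tau>))) (at \<tau>)"
      using dU[of "w \<tau>"] unfolding has_vector_derivative_iff_quotient U_A[OF s w\<tau>(1)] .
    have "(g \<sigma> - g \<tau>) /\<^sub>R (\<sigma> - \<tau>) = U (t - \<sigma>) ((w \<sigma> - w \<tau>) /\<^sub>R (\<sigma> - \<tau>)) +
        (U (t - \<sigma>) (w \<tau>) - U (t - \<tau>) (w \<tau>)) /\<^sub>R (\<sigma> - \<tau>)" for \<sigma>
      by (simp add: g_def linear_diff[OF U_linear] linear_scale[OF U_linear] scaleR_diff_right)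
    then show "((\<lambda>\<sigma>. (g \<sigma> - g \<tau>) /\<^sub>R (\<sigma> - \<tau>)) \<longlongrightarrow> 0) (at \<tau>)"
      using tendsto_add[OF 1 2] by (simp add: linear_neg[OF U_linear])
  qed
  ultimately have "((\<lambda>_. 0) has_integral g t - g 0) {0..t}"
    using t by (intro fundamental_theorem_of_calculus_interior) auto
  then have "g t = g 0" using has_integral_unique[OF _ has_integral_0] by fastforce
  then show ?thesis by (simp add: g_def U_def)
qed

text \<open>\<tau> \<mapsto> U(\<tau> + t) x solves the same Cauchy problem, with initial value U(t)
  x.\<close>

lemma U_semigroup: "0 \<le> s \<Longrightarrow> 0 \<le> t \<Longrightarrow> U (s + t) x = U s (U t x)"
proof (cases "s = 0 \<or> t = 0")
  case True
  assume "0 \<le> s" "0 \<le> t"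
  with True show ?thesis by (auto simp: U_def)
next
  case False
  assume "0 \<le> s" "0 \<le> t"
  with False have st: "0 < s" "0 < t" by auto
  define w where "w \<tau> = U (\<tau> + t) x" for \<tau>
  have "w s = U s (w 0)"
  proof (rule Cauchy_problem_unique[OF st(1)])
    show "continuous_on {0..s} w" unfolding w_def
      by (rule continuous_on_compose2[OF U_continuous]) (use st in \<open>auto intro!: continuous_intros\<close>)
    fix \<tau> assume "0 < \<tau>" "\<tau> < s"
    then have \<tau>: "0 < \<tau> + t" using st by simp
    have "((\<lambda>\<tau>. \<tau> + t) has_vector_derivative 1) (at \<tau>)" by (auto intro!: derivative_eq_intros)
    from vector_diff_chain_at[OF this U_derivative[OF \<tau>]]
    have "(w has_vector_derivative - A (w \<tau>)) (at \<tau>)" by (simp add: o_def w_def[abs_def] A_U[OF \<tau>])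
    then show "w \<tau> \<in> D \<and> (w has_vector_derivative - A (w \<tau>)) (at \<tau>)"
      using U_domain[OF \<tau>] by (simp add: w_def)
  qed
  then show ?thesis by (simp add: w_def)
qed

lemma U_C0_semigroup: "C0_semigroup U"
  unfolding C0_semigroup_def
  using U_bounded_linear U_scaleC U_semigroup U_tendsto by (auto simp: U_def[of 0])

text \<open>F(s) = U(s) x + s A x has derivative A x - U(s) A x, which is small near 0 by strong
  continuity. Integrating it over [0, h] bounds the difference quotient.\<close>

lemma U_right_derivative:
  assumes x: "x \<in> D"
  shows "((\<lambda>h. (U h x - x) /\<^sub>R h) \<longlongrightarrow> - A x) (at_right 0)"
proof (rule tendstoI)
  fix e :: real assume e: "0 < e"
  have "\<forall>\<^sub>F h in at_right 0. dist (U h (A x)) (A x) < e / 2"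
    using tendstoD[OF U_tendsto, of "e / 2"] e by simp
  then obtain b where b: "0 < b" "\<And>h. 0 < h \<Longrightarrow> h < b \<Longrightarrow> dist (U h (A x)) (A x) < e / 2"
    unfolding eventually_at_right_field by blast
  have "dist ((U h x - x) /\<^sub>R h) (- A x) < e" if h: "0 < h" "h < b" for h
  proof -
    define F where "F s = U s x + s *\<^sub>R A x" for s
    have "((\<lambda>s. A x - U s (A x)) has_integral F h - F 0) {0..h}"
    proof (rule fundamental_theorem_of_calculus_interior)
      show "continuous_on {0..h} F" unfolding F_def
        by (intro continuous_intros continuous_on_subset[OF U_continuous]) auto
      fix s assume "s \<in> {0<..<h}"
      then have s: "0 < s" by simp
      show "(F has_vector_derivative A x - U s (A x)) (at s)"
      proof -
        have "((\<lambda>s. s *\<^sub>R A x) has_vector_derivative A x) (at s)"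
          by (auto intro!: derivative_eq_intros simp: has_vector_derivative_def)
        from has_vector_derivative_add[OF U_derivative[OF s] this] show ?thesis
          unfolding F_def U_A[OF s x] by simp
      qed
    qed (use h in auto)
    then have "norm (F h - F 0) \<le> e / 2 * measure lborel (cbox 0 h)"
      unfolding box_real(2)[symmetric]
    proof (rule has_integral_bound[rotated])
      fix s assume "s \<in> cbox 0 h"
      then show "norm (A x - U s (A x)) \<le> e / 2"
        using b(2)[of s] e h by (cases "s = 0") (auto simp: U_def dist_norm norm_minus_commute)
    qed (use e in auto)
    then have "norm (F h - F 0) \<le> e / 2 * h" using h by simp
    then have "norm (F h - F 0) / h \<le> (e / 2 * h) / h" using h by (intro divide_right_mono) auto
    moreover have "(U h x - x) /\<^sub>R h - - A x = (F h - F 0) /\<^sub>R h"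
      using h by (simp add: F_def U_def[of 0] algebra_simps)
    moreover have "norm ((F h - F 0) /\<^sub>R h) = norm (F h - F 0) / h"
      using h by (simp add: divide_inverse mult.commute)
    ultimately have "norm ((U h x - x) /\<^sub>R h - - A x) \<le> (e / 2 * h) / h"
      by (simp only:)
    also have "\<dots> < e" using h e by simp
    finally show ?thesis by (simp only: dist_norm)
  qed
  then show "\<forall>\<^sub>F h in at_right 0. dist ((U h x - x) /\<^sub>R h) (- A x) < e"
    using b(1) by (intro eventually_at_rightI[of 0 b]) auto
qed

lemma U_generator: "has_generator U D (\<lambda>x. - A x)"
  unfolding has_generator_def
proof (intro allI iffI)
  fix x y assume "x \<in> D \<and> y = - A x"
  then show "((\<lambda>h. (U h x - x) /\<^sub>R h) \<longlongrightarrow> y) (at_right 0)" using U_right_derivative by simp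
next
  fix x y assume lim: "((\<lambda>h. (U h x - x) /\<^sub>R h) \<longlongrightarrow> y) (at_right 0)"
  define w where "w = complex_of_real (\<rho> - 1)"
  have wW: "w \<in> W" unfolding w_def using left_real[of 1] by simp
  note w = W_resolvent[OF wW]
  have comm: "R w (U h x) = U h (R w x)" if "0 < h" for h
    using R_Phi(2)[OF E_decay[OF bounded_analytic_one] w] that by (simp add: U_def)
  have "((\<lambda>h. R w ((U h x - x) /\<^sub>R h)) \<longlongrightarrow> R w y) (at_right 0)"
    by (rule bounded_linear.tendsto[OF resolvent_facts(3)[OF lin w] lim])
  moreover have "\<forall>\<^sub>F h in at_right 0. R w ((U h x - x) /\<^sub>R h) = (U h (R w x) - R w x) /\<^sub>R h"
    unfolding eventually_at_filter
    by (auto simp: linear_scale[OF R_linear[OF wW]] linear_diff[OF R_linear[OF wW]] comm)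
  ultimately have "((\<lambda>h. (U h (R w x) - R w x) /\<^sub>R h) \<longlongrightarrow> R w y) (at_right 0)"
    by (simp add: tendsto_cong)
  moreover have "((\<lambda>h. (U h (R w x) - R w x) /\<^sub>R h) \<longlongrightarrow> - A (R w x)) (at_right 0)"
    by (rule U_right_derivative[OF resolvent_facts(1)[OF lin w]])
  \<comment> \<open>The quotient is known to converge only after smoothing by R(w, A). Comparing
    limits there gives x = R(w, A) (w x + y), which places x in D.\<close>
  ultimately have "R w y = - A (R w x)" by (rule tendsto_unique[rotated]) simp
  then have "x = R w (w *\<^sub>C x + y)"
    using resolvent_facts(2)[OF lin w, of x]
    by (simp add: linear_add[OF R_linear[OF wW]] resolvent_facts(5)[OF lin w])
  then have x: "x \<in> D" using resolvent_facts(1)[OF lin w] by metis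
  moreover have "y = - A x"
    by (rule tendsto_unique[OF _ lim U_right_derivative[OF x]]) simp
  ultimately show "x \<in> D \<and> y = - A x" ..
qed

end

section \<open>Local boundedness and uniqueness of semigroups\<close>

text \<open>Banach-Steinhaus: without a common bound, every set G m is open and dense, because a
  bound on a ball scales to a bound on the space. By Baire some point lies in all G m, and its orbit
  is unbounded.\<close>

lemma uniform_boundedness_sequence:
  fixes T :: "nat \<Rightarrow> 'a::banach \<Rightarrow> 'b::real_normed_vector"
  assumes lin: "\<And>n. bounded_linear (T n)" and bd: "\<And>x. bounded (range (\<lambda>n. T n x))"
  obtains K where "\<And>n x. norm (T n x) \<le> K * norm x"
proof (rule ccontr)
  assume "\<not> thesis"
  with that have unb: "\<And>K. \<exists>n x. K * norm x < norm (T n x)" by (meson not_less)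
  note linT = bounded_linear.linear[OF lin]
  define G where "G m = {x. \<exists>n. real m < norm (T n x)}" for m :: nat
  have "open (G m)" for m
  proof -
    have "G m = (\<Union>n. {x. real m < norm (T n x)})" by (auto simp: G_def)
    moreover have "open {x. real m < norm (T n x)}" for n
      by (intro open_Collect_less continuous_intros bounded_linear.continuous_on[OF lin])
    ultimately show ?thesis by auto
  qed
  moreover have "closure (G m) = UNIV" for m
  proof (rule ccontr)
    assume "closure (G m) \<noteq> UNIV"
    then obtain x0 where "x0 \<in> - closure (G m)" by auto
    then obtain e where e: "0 < e" "ball x0 e \<subseteq> - closure (G m)"
      by (metis open_Compl closed_closure open_contains_ball)
    have le: "norm (T n x) \<le> m" if "x \<in> ball x0 e" for n x
    proof -
      have "x \<notin> G m" using e(2) closure_subset[of "G m"] that by blast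
      then show ?thesis by (simp add: G_def not_less)
    qed
    obtain n x where x: "(4 * m / e) * norm x < norm (T n x)" using unb by blast
    then have "x \<noteq> 0" by (auto simp: linear_0[OF linT])
    define y where "y = (e / (2 * norm x)) *\<^sub>R x"
    have ny: "norm y = e / 2" using \<open>x \<noteq> 0\<close> e(1) by (simp add: y_def)
    then have "x0 + y \<in> ball x0 e" "x0 \<in> ball x0 e" using e(1) by (auto simp: dist_norm)
    then have "norm (T n (x0 + y) - T n x0) \<le> real m + real m"
      by (intro order_trans[OF norm_triangle_ineq4] add_mono le)
    then have "norm (T n y) \<le> 2 * m" by (simp add: linear_add[OF linT])
    moreover have "norm (T n y) = e / (2 * norm x) * norm (T n x)"
      using e(1) by (simp add: y_def linear_scale[OF linT])
    moreover have "2 * m < e / (2 * norm x) * norm (T n x)"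
      using x e(1) \<open>x \<noteq> 0\<close> by (simp add: field_simps)
    ultimately show False by simp
  qed
  ultimately have "closure (\<Inter>(range G)) = UNIV"
    using Met_TC.metric_Baire_category[where 'a = 'a, of "range G"] by (auto simp: complete_UNIV)
  then obtain x where "x \<in> \<Inter>(range G)" by (metis closure_empty empty_not_UNIV ex_in_conv)
  then have x: "\<exists>n. real m < norm (T n x)" for m by (auto simp: G_def)
  obtain B where B: "\<And>n. norm (T n x) \<le> B" using bd[of x] by (auto simp: bounded_iff)
  obtain m where "B < real m" using reals_Archimedean2 by blast
  then show False using x[of m] B by (meson less_trans not_less)
qed

text \<open>Otherwise there are t_n -> 0 for which S(t_n) has no common norm bound, although every
  orbit S(t_n) y converges.\<close>

lemma C0_semigroup_locally_bounded:
  assumes S: "C0_semigroup S"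
  obtains \<delta> K where "0 < \<delta>" "\<And>t x. 0 \<le> t \<Longrightarrow> t \<le> \<delta> \<Longrightarrow> norm (S t x) \<le> K * norm x"
proof (rule ccontr)
  assume "\<not> thesis"
  with that have unb: "\<exists>t x. 0 \<le> t \<and> t \<le> \<delta> \<and> K * norm x < norm (S t x)" if "0 < \<delta>" for \<delta> K :: real
    using \<open>0 < \<delta>\<close> by (meson not_less)
  have "\<exists>t x. 0 \<le> t \<and> t \<le> 1 / real (Suc n) \<and> real n * norm x < norm (S t x)" for n
    using unb[of "1 / real (Suc n)" "real n"] by simp
  then obtain t x where tx: "\<And>n. 0 \<le> t n" "\<And>n. t n \<le> 1 / real (Suc n)"
    "\<And>n. real n * norm (x n) < norm (S (t n) (x n))"
    by metis
  have "t \<longlonglongrightarrow> 0"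
    by (rule tendsto_sandwich[OF _ _ tendsto_const LIMSEQ_inverse_real_of_nat[unfolded inverse_eq_divide]])
      (use tx in auto)
  have "bounded (range (\<lambda>n. S (t n) y))" for y
  proof (rule convergent_imp_bounded)
    have "((\<lambda>s. S s y) \<longlongrightarrow> S 0 y) (at 0 within {0..})"
      using S by (simp add: C0_semigroup_def at_within_Ici_at_right)
    then show "(\<lambda>n. S (t n) y) \<longlonglongrightarrow> S 0 y"
      using \<open>t \<longlonglongrightarrow> 0\<close> tx(1) by (intro continuous_within_tendsto_compose[of 0 "{0..}" "\<lambda>s. S s y"])
        (auto simp: continuous_within)
  qed
  moreover have "bounded_linear (S (t n))" for n using S tx(1) by (auto simp: C0_semigroup_def)
  ultimately obtain K where K: "\<And>n x. norm (S (t n) x) \<le> K * norm x"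
    using uniform_boundedness_sequence[of "\<lambda>n. S (t n)"] by blast
  obtain n where n: "K < real n" using reals_Archimedean2 by blast
  have "norm (S (t n) (x n)) \<le> K * norm (x n)" by (rule K)
  also have "\<dots> \<le> real n * norm (x n)" using n by (intro mult_right_mono) auto
  finally show False using tx(3)[of n] by simp
qed

context sector_contour
begin

text \<open>The generator gives right derivatives of an orbit only. Local boundedness supplies the
  left ones on (0, \<delta>], so orbits starting in D solve the Cauchy problem there. Density
  extends equality to all x, and the semigroup law to all times.\<close>

lemma semigroup_unique:
  assumes S: "C0_semigroup S" and gen: "has_generator S D (\<lambda>x. - A x)" and t: "0 \<le> t"
  shows "S t x = U t x"
proof -
  obtain \<delta> K where \<delta>: "0 < \<delta>" and K: "\<And>t x. 0 \<le> t \<Longrightarrow> t \<le> \<delta> \<Longrightarrow> norm (S t x) \<le> K * norm x"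
    using C0_semigroup_locally_bounded[OF S] by blast
  have S_lin: "linear (S t)" and S_bl: "bounded_linear (S t)" if "0 \<le> t" for t
    using S that bounded_linear.linear by (auto simp: C0_semigroup_def)
  have S0: "S 0 x = x" for x using S by (simp add: C0_semigroup_def)
  have S_add: "S (a + b) x = S a (S b x)" if "0 \<le> a" "0 \<le> b" for a b x
    using S that by (simp add: C0_semigroup_def)
  have S_lim: "((\<lambda>t. S t x) \<longlongrightarrow> x) (at_right 0)" for x
    using S by (simp add: C0_semigroup_def)
  have S_deriv: "((\<lambda>h. (S h x - x) /\<^sub>R h) \<longlongrightarrow> - A x) (at_right 0)" if "x \<in> D" for x
    using gen that by (simp add: has_generator_def)
  have S_dom: "S \<tau> x \<in> D \<and> - A (S \<tau> x) = S \<tau> (- A x)" if x: "x \<in> D" and \<tau>: "0 \<le> \<tau>" for x \<tau>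
  proof -
    have "((\<lambda>h. S \<tau> ((S h x - x) /\<^sub>R h)) \<longlongrightarrow> S \<tau> (- A x)) (at_right 0)"
      by (rule bounded_linear.tendsto[OF S_bl[OF \<tau>] S_deriv[OF x]])
    moreover have "\<forall>\<^sub>F h in at_right 0. S \<tau> ((S h x - x) /\<^sub>R h) = (S h (S \<tau> x) - S \<tau> x) /\<^sub>R h"
    proof -
      have "S \<tau> (S h x) = S h (S \<tau> x)" if "0 \<le> h" for h
        using S_add[OF \<tau> that] S_add[OF that \<tau>] by (simp add: add.commute)
      then show ?thesis unfolding eventually_at_filter
        by (auto simp: linear_scale[OF S_lin[OF \<tau>]] linear_diff[OF S_lin[OF \<tau>]])
    qed
    ultimately have "((\<lambda>h. (S h (S \<tau> x) - S \<tau> x) /\<^sub>R h) \<longlongrightarrow> S \<tau> (- A x)) (at_right 0)"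
      by (simp add: tendsto_cong)
    then show ?thesis using gen by (auto simp: has_generator_def)
  qed
  have small_dom: "S t x = U t x" if x: "x \<in> D" and t: "0 < t" "t \<le> \<delta>" for t x
  proof -
    define w where "w \<tau> = S \<tau> x" for \<tau>
    have right: "((\<lambda>h. (w (\<tau> + h) - w \<tau>) /\<^sub>R h) \<longlongrightarrow> - A (w \<tau>)) (at_right 0)" if \<tau>: "0 \<le> \<tau>" for \<tau>
    proof -
      have w\<tau>: "w \<tau> \<in> D" using S_dom[OF x \<tau>] by (simp add: w_def)
      have "\<forall>\<^sub>F h in at_right 0. (S h (w \<tau>) - w \<tau>) /\<^sub>R h = (w (\<tau> + h) - w \<tau>) /\<^sub>R h"
        unfolding eventually_at_filter w_def using S_add[OF _ \<tau>] by (auto simp: add.commute)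
      then show ?thesis by (rule Lim_transform_eventually[OF S_deriv[OF w\<tau>]])
    qed
    have left: "((\<lambda>h. (w \<tau> - w (\<tau> - h)) /\<^sub>R h) \<longlongrightarrow> - A (w \<tau>)) (at_right 0)" if \<tau>: "0 < \<tau>" "\<tau> \<le> \<delta>" for \<tau>
    proof -
      \<comment> \<open>The maximum keeps the argument nonnegative, so that F h is linear for every
        h and not only for small ones.\<close>
      define F where "F h = S (max 0 (\<tau> - h))" for h
      have near: "\<forall>\<^sub>F h in at_right 0. 0 < h \<and> h < \<tau>"
        using \<tau> by (auto intro: eventually_at_rightI[of 0 \<tau>])
      have le: "\<forall>\<^sub>F h in at_right 0. \<forall>y. norm (F h y) \<le> K * norm y"
        using near by eventually_elim (use K \<tau> in \<open>auto simp: F_def\<close>)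
      have F_lin: "linear (F h)" for h unfolding F_def by (intro S_lin) simp
      \<comment> \<open>Strong left continuity at \<tau>: F(h) y differs from S(\<tau>) y = F(h)
        S(h) y by F(h) applied to y - S(h) y, which tends to 0.\<close>
      have lim: "((\<lambda>h. F h y) \<longlongrightarrow> S \<tau> y) (at_right 0)" for y
      proof -
        have "((\<lambda>h. F h (y - S h y)) \<longlongrightarrow> 0) (at_right 0)"
        proof (rule strong_tendsto[OF F_lin le, where ?v0.0 = 0])
          show "((\<lambda>h. F h 0) \<longlongrightarrow> 0) (at_right 0)" by (simp add: linear_0[OF F_lin])
          have "((\<lambda>h. y - S h y) \<longlongrightarrow> y - y) (at_right 0)" by (intro tendsto_intros S_lim)
          then show "((\<lambda>h. y - S h y) \<longlongrightarrow> 0) (at_right 0)" by simp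
        qed
        then have "((\<lambda>h. F h (y - S h y) + S \<tau> y) \<longlongrightarrow> 0 + S \<tau> y) (at_right 0)" by (intro tendsto_intros)
        moreover have "\<forall>\<^sub>F h in at_right 0. F h (y - S h y) + S \<tau> y = F h y"
          using near
        proof eventually_elim
          case (elim h)
          have "S \<tau> y = F h (S h y)" using S_add[of "\<tau> - h" h y] elim by (simp add: F_def)
          then show ?case by (simp add: linear_diff[OF F_lin])
        qed
        ultimately show ?thesis by (simp add: tendsto_cong)
      qed
      have "((\<lambda>h. F h ((S h x - x) /\<^sub>R h)) \<longlongrightarrow> S \<tau> (- A x)) (at_right 0)"
        by (rule strong_tendsto[OF F_lin le lim S_deriv[OF x]])
      moreover have "\<forall>\<^sub>F h in at_right 0. F h ((S h x - x) /\<^sub>R h) = (w \<tau> - w (\<tau> - h)) /\<^sub>R h"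
        using near
      proof eventually_elim
        case (elim h)
        have "w \<tau> = F h (S h x)" using S_add[of "\<tau> - h" h x] elim by (simp add: F_def w_def)
        moreover have "w (\<tau> - h) = F h x" using elim by (simp add: F_def w_def)
        ultimately show ?case by (simp add: linear_diff[OF F_lin] linear_scale[OF F_lin])
      qed
      ultimately show ?thesis using S_dom[OF x, of \<tau>] \<tau> by (simp add: tendsto_cong w_def)
    qed
    have deriv_r: "(w has_vector_derivative - A (w \<tau>)) (at \<tau> within {\<tau>..})" if \<tau>: "0 \<le> \<tau>" for \<tau>
      unfolding has_vector_derivative_iff_quotient at_within_Ici_at_right
      using right[OF \<tau>] unfolding filterlim_at_right_to_0[of _ _ \<tau>] by (simp add: add.commute)
    have deriv_l: "(w has_vector_derivative - A (w \<tau>)) (at \<tau> within {..\<tau>})" if \<tau>: "0 < \<tau>" "\<tau> \<le> \<delta>" for \<tau>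
    proof -
      have eq: "(w (- (h + - \<tau>)) - w \<tau>) /\<^sub>R (- (h + - \<tau>) - \<tau>) = (w \<tau> - w (\<tau> - h)) /\<^sub>R h" for h
      proof -
        have 1: "- (h + - \<tau>) = \<tau> - h" by simp
        show ?thesis unfolding 1 by (simp add: scaleR_diff_right)
      qed
      have "((\<lambda>y. (w y - w \<tau>) /\<^sub>R (y - \<tau>)) \<longlongrightarrow> - A (w \<tau>)) (at_left \<tau>)"
        unfolding filterlim_at_left_to_right filterlim_at_right_to_0[of _ _ "- \<tau>"] eq
        by (rule left[OF \<tau>])
      then show ?thesis unfolding has_vector_derivative_iff_quotient at_within_Iic_at_left .
    qed
    have "w t = U t (w 0)"
    proof (rule Cauchy_problem_unique[OF t(1)])
      fix \<tau> assume \<tau>: "0 < \<tau>" "\<tau> < t"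
      have "((\<lambda>y. (w y - w \<tau>) /\<^sub>R (y - \<tau>)) \<longlongrightarrow> - A (w \<tau>)) (at \<tau>)"
        using deriv_l[of \<tau>] deriv_r[of \<tau>] \<tau> t
        unfolding has_vector_derivative_iff_quotient at_within_Ici_at_right at_within_Iic_at_left
        by (simp add: filterlim_at_split)
      then show "w \<tau> \<in> D \<and> (w has_vector_derivative - A (w \<tau>)) (at \<tau>)"
        using S_dom[OF x, of \<tau>] \<tau> by (simp add: w_def[of \<tau>] has_vector_derivative_iff_quotient)
    next
      have "continuous (at \<tau> within {0..t}) w" if \<tau>: "\<tau> \<in> {0..t}" for \<tau>
      proof -
        have r: "continuous (at \<tau> within {\<tau>..}) w"
          using deriv_r \<tau> by (intro has_vector_derivative_continuous) auto
        show ?thesis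
        proof (cases "\<tau> = 0")
          case True
          then show ?thesis using r by (intro continuous_within_subset[OF r]) auto
        next
          case False
          then have l: "continuous (at \<tau> within {..\<tau>}) w"
            using \<tau> t by (intro has_vector_derivative_continuous[OF deriv_l]) auto
          have "continuous (at \<tau>) w"
            using l r unfolding continuous_within at_within_Ici_at_right at_within_Iic_at_left
            by (simp add: filterlim_at_split)
          then show ?thesis by (rule continuous_at_imp_continuous_at_within)
        qed
      qed
      then show "continuous_on {0..t} w" by (simp add: continuous_on_eq_continuous_within)
    qed
    then show ?thesis by (simp add: w_def S0)
  qed
  have small: "S t x = U t x" if t: "0 \<le> t" "t \<le> \<delta>" for t x
  proof (cases "t = 0")
    case True
    then show ?thesis by (simp add: S0 U_def)
  next
    case False
    have "closed {x. S t x = U t x}"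
      using t by (intro closed_Collect_eq linear_continuous_on S_bl U_bounded_linear)
    moreover have "D \<subseteq> {x. S t x = U t x}" using small_dom t False by auto
    ultimately have "closure D \<subseteq> {x. S t x = U t x}" by (rule closure_minimal[rotated])
    then show ?thesis using dense by auto
  qed
  \<comment> \<open>Times beyond \<delta> are reached in n equal steps of length at most
    \<delta>.\<close>
  have multiple: "S (real n * s) x = U (real n * s) x" if s: "0 \<le> s" "s \<le> \<delta>" for n s x
  proof (induction n)
    case (Suc n)
    have "S (s + real n * s) x = U (s + real n * s) x"
      using s Suc small[OF s] by (simp add: S_add U_semigroup)
    then show ?case by (simp add: algebra_simps)
  qed (simp add: S0 U_def)
  obtain n where n: "t / \<delta> < real n" using reals_Archimedean2 by blast
  have "0 \<le> t / \<delta>" using t \<delta> by simp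
  with n have "0 < real n" by linarith
  then show ?thesis using multiple[of "t / real n" n x] n t \<delta> by (simp add: field_simps)
qed

lemma opexp_eq_U: "0 \<le> t \<Longrightarrow> opexp D A t x = U t x"
proof -
  have "C0_semigroup (opexp D A) \<and> has_generator (opexp D A) D (\<lambda>x. - A x)"
    unfolding opexp_def by (rule someI[of _ U]) (use U_C0_semigroup U_generator in blast)
  then show "0 \<le> t \<Longrightarrow> opexp D A t x = U t x" using semigroup_unique by blast
qed

text \<open>Again uniqueness: \<tau> \<mapsto> \<open>Phi (E 0 h (\<tau> + s)) x\<close> is a
  solution. The shift s > 0 makes it differentiable up to \<tau> = 0.\<close>

lemma U_Phi_E:
  assumes h: "bounded_analytic h" and s: "0 < s" and t: "0 \<le> t"
  shows "U t (Phi (E 0 h s) x) = Phi (E 0 h (t + s)) x"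
proof (cases "t = 0")
  case False
  define w where "w \<tau> = Phi (E 0 h (\<tau> + s)) x" for \<tau>
  have deriv: "w \<tau> \<in> D" "(w has_vector_derivative - A (w \<tau>)) (at \<tau>)" if \<tau>: "0 \<le> \<tau>" for \<tau>
  proof -
    have \<tau>s: "0 < \<tau> + s" using \<tau> s by simp
    show "w \<tau> \<in> D" unfolding w_def by (rule Phi_E_domain[OF h \<tau>s])
    have "((\<lambda>\<tau>. \<tau> + s) has_vector_derivative 1) (at \<tau>)" by (auto intro!: derivative_eq_intros)
    from vector_diff_chain_at[OF this Phi_E_derivative[OF h \<tau>s]]
    show "(w has_vector_derivative - A (w \<tau>)) (at \<tau>)"
      by (simp add: o_def w_def[abs_def] Phi_E_domain(2)[OF h \<tau>s])
  qed
  have "w t = U t (w 0)"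
  proof (rule Cauchy_problem_unique)
    show "continuous_on {0..t} w"
      using has_vector_derivative_continuous[OF deriv(2)]
      by (intro continuous_at_imp_continuous_on) auto
  qed (use False t deriv in auto)
  then show ?thesis by (simp add: w_def)
qed (simp add: U_def)

end

section \<open>Bochner integrability of the convolution\<close>

lemma has_bochner_int_cong_AE:
  assumes "has_bochner_int M f y" "AE x in M. f x = g x"
  shows "has_bochner_int M g y"
proof -
  obtain s where s: "\<And>i. Bochner_Integration.simple_bochner_integrable M (s i)" "AE x in M. (\<lambda>i. s i x) \<longlonglongrightarrow> f x"
    "(\<lambda>i. \<integral>\<^sup>+x. ennreal (norm (f x - s i x)) \<partial>M) \<longlonglongrightarrow> 0"
    "(\<lambda>i. Bochner_Integration.simple_bochner_integral M (s i)) \<longlonglongrightarrow> y"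
    using assms(1) unfolding has_bochner_int_def by blast
  have "(\<integral>\<^sup>+x. ennreal (norm (f x - s i x)) \<partial>M) = (\<integral>\<^sup>+x. ennreal (norm (g x - s i x)) \<partial>M)" for i
    using assms(2) by (intro nn_integral_cong_AE) auto
  moreover have "AE x in M. (\<lambda>i. s i x) \<longlonglongrightarrow> g x" using s(2) assms(2) by eventually_elim simp
  ultimately show ?thesis using s unfolding has_bochner_int_def by auto
qed

lemma simple_function_restrict:
  assumes "simple_function M f"
  shows "simple_function (restrict_space M \<Omega>) f"
  unfolding simple_function_def
proof (intro conjI ballI)
  have "f ` space (restrict_space M \<Omega>) \<subseteq> f ` space M" by (auto simp: space_restrict_space)
  then show "finite (f ` space (restrict_space M \<Omega>))"
    using assms finite_subset by (auto simp: simple_function_def)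
  fix x assume "x \<in> f ` space (restrict_space M \<Omega>)"
  then have "f -` {x} \<inter> space M \<in> sets M" using assms by (auto simp: simple_function_def space_restrict_space)
  moreover have "f -` {x} \<inter> space (restrict_space M \<Omega>) = \<Omega> \<inter> (f -` {x} \<inter> space M)"
    by (auto simp: space_restrict_space)
  ultimately show "f -` {x} \<inter> space (restrict_space M \<Omega>) \<in> sets (restrict_space M \<Omega>)"
    by (auto simp: sets_restrict_space)
qed

lemma bochner_integrable_approx_restrict:
  assumes f: "bochner_integrable M f" and \<Omega>: "\<Omega> \<inter> space M \<in> sets M"
  obtains s where "\<And>i::nat. simple_function (restrict_space M \<Omega>) (s i)"
    "AE x in restrict_space M \<Omega>. (\<lambda>i. s i x) \<longlonglongrightarrow> f x"
    "(\<lambda>i. \<integral>\<^sup>+x. ennreal (norm (f x - s i x)) \<partial>restrict_space M \<Omega>) \<longlonglongrightarrow> 0"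
proof -
  obtain s where s: "\<And>i::nat. Bochner_Integration.simple_bochner_integrable M (s i)" "AE x in M. (\<lambda>i. s i x) \<longlonglongrightarrow> f x"
    "(\<lambda>i. \<integral>\<^sup>+x. ennreal (norm (f x - s i x)) \<partial>M) \<longlonglongrightarrow> 0"
    using f unfolding bochner_integrable_def has_bochner_int_def by blast
  show ?thesis
  proof
    show "simple_function (restrict_space M \<Omega>) (s i)" for i
      using s(1)[of i] by (auto intro: simple_function_restrict elim: simple_bochner_integrable.cases)
    show "AE x in restrict_space M \<Omega>. (\<lambda>i. s i x) \<longlonglongrightarrow> f x"
      unfolding AE_restrict_space_iff[OF \<Omega>] using s(2) by eventually_elim simp
    have "(\<integral>\<^sup>+x. ennreal (norm (f x - s i x)) \<partial>restrict_space M \<Omega>) \<le> (\<integral>\<^sup>+x. ennreal (norm (f x - s i x)) \<partial>M)" for i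
      unfolding nn_integral_restrict_space[OF \<Omega>] by (intro nn_integral_mono) (auto simp: indicator_def)
    then show "(\<lambda>i. \<integral>\<^sup>+x. ennreal (norm (f x - s i x)) \<partial>restrict_space M \<Omega>) \<longlonglongrightarrow> 0"
      by (intro tendsto_sandwich[OF _ _ tendsto_const s(3)]) auto
  qed
qed

lemma simple_bochner_integral_diff_le:
  fixes g :: "'b \<Rightarrow> 'a::real_normed_vector"
  assumes s: "Bochner_Integration.simple_bochner_integrable M s" and t: "Bochner_Integration.simple_bochner_integrable M t"
    and meas: "(\<lambda>x. norm (g x - s x)) \<in> borel_measurable M" "(\<lambda>x. norm (g x - t x)) \<in> borel_measurable M"
  shows "ennreal (norm (Bochner_Integration.simple_bochner_integral M s - Bochner_Integration.simple_bochner_integral M t)) \<le>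
    (\<integral>\<^sup>+ x. norm (g x - s x) \<partial>M) + (\<integral>\<^sup>+ x. norm (g x - t x) \<partial>M)"
proof -
  have "ennreal (norm (Bochner_Integration.simple_bochner_integral M s - Bochner_Integration.simple_bochner_integral M t)) =
      norm (Bochner_Integration.simple_bochner_integral M (\<lambda>x. s x - t x))"
    using s t by (subst simple_bochner_integral_diff) auto
  also have "\<dots> \<le> Bochner_Integration.simple_bochner_integral M (\<lambda>x. norm (s x - t x))"
    using simple_bochner_integrable_compose2[of "(-)" M "s" "t"] s t
    by (auto intro!: simple_bochner_integral_norm_bound)
  also have "\<dots> = (\<integral>\<^sup>+x. norm (s x - t x) \<partial>M)"
    using simple_bochner_integrable_compose2[of "\<lambda>x y. norm (x - y)" M "s" "t"] s t
    by (auto intro!: simple_bochner_integral_eq_nn_integral)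
  also have "\<dots> \<le> (\<integral>\<^sup>+x. ennreal (norm (g x - s x)) + ennreal (norm (g x - t x)) \<partial>M)"
  proof (rule nn_integral_mono)
    fix x
    have "norm (s x - t x) \<le> norm (g x - s x) + norm (g x - t x)"
      using norm_triangle_ineq4[of "g x - t x" "g x - s x"] by (simp add: norm_minus_commute)
    then show "ennreal (norm (s x - t x)) \<le> ennreal (norm (g x - s x)) + ennreal (norm (g x - t x))"
      by (metis ennreal_leI ennreal_plus norm_ge_zero)
  qed
  also have "\<dots> = (\<integral>\<^sup>+ x. norm (g x - s x) \<partial>M) + (\<integral>\<^sup>+ x. norm (g x - t x) \<partial>M)"
    using meas by (intro nn_integral_add) auto
  finally show ?thesis .
qed

text \<open>The L^1 errors make the simple integrals a Cauchy sequence, whose limit is the integral.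
  Convergence at every point, not merely almost everywhere, makes the norm of each error function
  measurable as a limit of simple functions.\<close>

lemma bochner_integrableI:
  fixes g :: "'b \<Rightarrow> 'a::banach"
  assumes h: "\<And>i. Bochner_Integration.simple_bochner_integrable M (h i)"
    and lim: "\<And>x. x \<in> space M \<Longrightarrow> (\<lambda>i. h i x) \<longlonglongrightarrow> g x"
    and L1: "(\<lambda>i. \<integral>\<^sup>+x. ennreal (norm (g x - h i x)) \<partial>M) \<longlonglongrightarrow> 0"
  shows "bochner_integrable M g"
proof -
  have h_simple: "simple_function M (h i)" for i using h by (auto elim: simple_bochner_integrable.cases)
  have meas: "(\<lambda>x. norm (g x - h i x)) \<in> borel_measurable M" for i
  proof (rule borel_measurable_LIMSEQ_real)
    show "(\<lambda>j. norm (h j x - h i x)) \<longlonglongrightarrow> norm (g x - h i x)" if "x \<in> space M" for x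
      by (intro tendsto_intros lim that)
    show "(\<lambda>x. norm (h j x - h i x)) \<in> borel_measurable M" for j
      by (rule borel_measurable_simple_function, rule simple_function_compose2[OF h_simple h_simple])
  qed
  have "Cauchy (\<lambda>i. Bochner_Integration.simple_bochner_integral M (h i))"
  proof (rule metric_CauchyI)
    fix e :: real assume e: "0 < e"
    then have "\<forall>\<^sub>F i in sequentially. (\<integral>\<^sup>+x. ennreal (norm (g x - h i x)) \<partial>M) < ennreal (e / 2)"
      using order_tendstoD(2)[OF L1] by simp
    then obtain N where N: "\<And>i. N \<le> i \<Longrightarrow> (\<integral>\<^sup>+x. ennreal (norm (g x - h i x)) \<partial>M) < ennreal (e / 2)"
      by (auto simp: eventually_sequentially)
    have "dist (Bochner_Integration.simple_bochner_integral M (h i)) (Bochner_Integration.simple_bochner_integral M (h j)) < e" if "N \<le> i" "N \<le> j" for i j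
    proof -
      have "ennreal (norm (Bochner_Integration.simple_bochner_integral M (h i) - Bochner_Integration.simple_bochner_integral M (h j))) \<le>
          (\<integral>\<^sup>+x. norm (g x - h i x) \<partial>M) + (\<integral>\<^sup>+x. norm (g x - h j x) \<partial>M)"
        by (rule simple_bochner_integral_diff_le[OF h h meas meas])
      also have "\<dots> < ennreal (e / 2) + ennreal (e / 2)" by (intro add_strict_mono N that)
      also have "\<dots> = ennreal e" using e by (simp flip: ennreal_plus)
      finally show ?thesis using e by (simp add: dist_norm ennreal_less_iff)
    qed
    then show "\<exists>M'. \<forall>m\<ge>M'. \<forall>n\<ge>M'. dist (Bochner_Integration.simple_bochner_integral M (h m)) (Bochner_Integration.simple_bochner_integral M (h n)) < e"
      by blast
  qed
  then obtain y where "(\<lambda>i. Bochner_Integration.simple_bochner_integral M (h i)) \<longlonglongrightarrow> y"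
    using Cauchy_convergent convergent_def by blast
  then have "has_bochner_int M g y"
    unfolding has_bochner_int_def using h lim L1 by (auto intro!: exI[of _ h])
  then show ?thesis unfolding bochner_integrable_def by blast
qed

text \<open>
  The operators \<open>G \<tau>\<close> depend on \<open>\<tau>\<close> only strongly continuously. They are sampled at the values of
  simple functions \<open>\<kappa> i\<close> that converge to \<open>\<tau>\<close>.
\<close>

lemma bochner_integrable_operator:
  fixes f :: "real \<Rightarrow> 'a::banach" and G :: "real \<Rightarrow> 'a \<Rightarrow> 'a"
  assumes fin: "emeasure M (space M) < \<infinity>"
    and s: "\<And>i. simple_function M (s i)" and s_lim: "\<And>x. x \<in> space M \<Longrightarrow> (\<lambda>i. s i x) \<longlonglongrightarrow> f x"
    and s_L1: "(\<lambda>i. \<integral>\<^sup>+x. ennreal (norm (f x - s i x)) \<partial>M) \<longlonglongrightarrow> 0"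
    and \<kappa>: "\<And>i. simple_function M (\<kappa> i)"
    and G_lin: "\<And>\<tau>. linear (G \<tau>)" and K: "0 \<le> K"
    and G_le: "\<And>\<tau> v. \<tau> \<in> space M \<Longrightarrow> norm (G \<tau> v) \<le> K * norm v"
    and G\<kappa>_le: "\<And>i \<tau> v. \<tau> \<in> space M \<Longrightarrow> norm (G (\<kappa> i \<tau>) v) \<le> K * norm v"
    and G_lim: "\<And>\<tau> v. \<tau> \<in> space M \<Longrightarrow> (\<lambda>i. G (\<kappa> i \<tau>) v) \<longlonglongrightarrow> G \<tau> v"
  shows "bochner_integrable M (\<lambda>\<tau>. G \<tau> (f \<tau>))"
proof (rule bochner_integrableI)
  define h where "h i \<tau> = G (\<kappa> i \<tau>) (s i \<tau>)" for i \<tau>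
  have h_simple: "simple_function M (h i)" for i
    unfolding h_def by (rule simple_function_compose2[OF \<kappa> s])
  show "Bochner_Integration.simple_bochner_integrable M (h i)" for i
  proof
    have "emeasure M {y \<in> space M. h i y \<noteq> 0} \<le> emeasure M (space M)" by (intro emeasure_mono) auto
    then show "emeasure M {y \<in> space M. h i y \<noteq> 0} \<noteq> \<infinity>" using fin by (auto simp: top_unique)
  qed (rule h_simple)
  show h_lim: "(\<lambda>i. h i \<tau>) \<longlonglongrightarrow> G \<tau> (f \<tau>)" if "\<tau> \<in> space M" for \<tau>
    unfolding h_def by (rule strong_tendsto[OF G_lin _ G_lim s_lim, where K = K]) (use that G\<kappa>_le in auto)
  \<comment> \<open>The error of \<open>h i\<close> splits into K times the error of
    \<open>s i\<close>, which tends to 0 in L^1, and \<psi> i, which tends to 0 by dominated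
    convergence with majorant 2 K |f|.\<close>
  define \<psi> where "\<psi> i \<tau> = norm (G (\<kappa> i \<tau>) (f \<tau>) - G \<tau> (f \<tau>))" for i \<tau>
  have meas_fs: "(\<lambda>x. norm (f x - s i x)) \<in> borel_measurable M" for i
  proof (rule borel_measurable_LIMSEQ_real)
    show "(\<lambda>j. norm (s j x - s i x)) \<longlonglongrightarrow> norm (f x - s i x)" if "x \<in> space M" for x
      by (intro tendsto_intros s_lim that)
    show "(\<lambda>x. norm (s j x - s i x)) \<in> borel_measurable M" for j
      by (rule borel_measurable_simple_function, rule simple_function_compose2[OF s s])
  qed
  have meas_f: "(\<lambda>x. norm (f x)) \<in> borel_measurable M"
  proof (rule borel_measurable_LIMSEQ_real)
    show "(\<lambda>j. norm (s j x)) \<longlonglongrightarrow> norm (f x)" if "x \<in> space M" for x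
      by (intro tendsto_intros s_lim that)
    show "(\<lambda>x. norm (s j x)) \<in> borel_measurable M" for j
      by (rule borel_measurable_simple_function, rule simple_function_compose1[OF s])
  qed
  have meas_\<psi>: "\<psi> i \<in> borel_measurable M" for i
    unfolding \<psi>_def
  proof (rule borel_measurable_LIMSEQ_real)
    show "(\<lambda>j. norm (G (\<kappa> i \<tau>) (s j \<tau>) - h j \<tau>)) \<longlonglongrightarrow> norm (G (\<kappa> i \<tau>) (f \<tau>) - G \<tau> (f \<tau>))"
      if \<tau>: "\<tau> \<in> space M" for \<tau>
    proof (intro tendsto_intros h_lim \<tau>)
      show "(\<lambda>j. G (\<kappa> i \<tau>) (s j \<tau>)) \<longlonglongrightarrow> G (\<kappa> i \<tau>) (f \<tau>)"
        by (rule strong_tendsto[OF G_lin _ tendsto_const s_lim[OF \<tau>], where K = K]) (use \<tau> G\<kappa>_le in auto)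
    qed
    show "(\<lambda>\<tau>. norm (G (\<kappa> i \<tau>) (s j \<tau>) - h j \<tau>)) \<in> borel_measurable M" for j
      by (rule borel_measurable_simple_function,
          rule simple_function_compose2[OF simple_function_compose2[OF \<kappa> s] h_simple])
  qed
  have int_f: "(\<integral>\<^sup>+x. ennreal (norm (f x)) \<partial>M) < \<infinity>"
  proof -
    have "\<forall>\<^sub>F i in sequentially. (\<integral>\<^sup>+x. ennreal (norm (f x - s i x)) \<partial>M) < 1"
      by (rule order_tendstoD(2)[OF s_L1]) simp
    then obtain i where i: "(\<integral>\<^sup>+x. ennreal (norm (f x - s i x)) \<partial>M) < 1"
      using eventually_happens trivial_limit_sequentially by blast
    define B where "B = Max (insert 0 ((\<lambda>x. norm (s i x)) ` space M))"
    have "finite ((\<lambda>x. norm (s i x)) ` space M)"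
      using s[of i] by (metis finite_imageI image_image simple_function_def)
    then have B: "norm (s i x) \<le> B" if "x \<in> space M" for x
      unfolding B_def using that by (intro Max_ge) auto
    have "(\<integral>\<^sup>+x. ennreal (norm (f x)) \<partial>M) \<le> (\<integral>\<^sup>+x. ennreal (norm (f x - s i x)) + ennreal B \<partial>M)"
    proof (rule nn_integral_mono)
      fix x assume x: "x \<in> space M"
      have "norm (f x) \<le> norm (f x - s i x) + B"
        using norm_triangle_ineq[of "f x - s i x" "s i x"] B[OF x] by simp
      moreover have "0 \<le> B" using B[OF x] by (rule order_trans[OF norm_ge_zero])
      ultimately show "ennreal (norm (f x)) \<le> ennreal (norm (f x - s i x)) + ennreal B"
        by (metis ennreal_leI ennreal_plus norm_ge_zero)
    qed
    also have "\<dots> = (\<integral>\<^sup>+x. ennreal (norm (f x - s i x)) \<partial>M) + ennreal B * emeasure M (space M)"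
      using meas_fs by (subst nn_integral_add) auto
    also have "\<dots> < \<infinity>" using i fin by (auto simp: ennreal_mult_less_top intro: order.strict_trans)
    finally show ?thesis .
  qed
  have \<psi>_L1: "(\<lambda>i. \<integral>\<^sup>+\<tau>. ennreal (\<psi> i \<tau>) \<partial>M) \<longlonglongrightarrow> (\<integral>\<^sup>+\<tau>. 0 \<partial>M)"
  proof (rule nn_integral_dominated_convergence)
    show "(\<lambda>\<tau>. ennreal (\<psi> i \<tau>)) \<in> borel_measurable M" for i using meas_\<psi> by measurable
    show "(\<lambda>\<tau>. ennreal (2 * K) * ennreal (norm (f \<tau>))) \<in> borel_measurable M" using meas_f by measurable
    show "AE \<tau> in M. ennreal (\<psi> i \<tau>) \<le> ennreal (2 * K) * ennreal (norm (f \<tau>))" for i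
    proof (rule AE_I2)
      fix \<tau> assume \<tau>: "\<tau> \<in> space M"
      have "\<psi> i \<tau> \<le> K * norm (f \<tau>) + K * norm (f \<tau>)"
        unfolding \<psi>_def by (intro order_trans[OF norm_triangle_ineq4] add_mono G_le G\<kappa>_le \<tau>)
      then have "\<psi> i \<tau> \<le> (2 * K) * norm (f \<tau>)" by simp
      then show "ennreal (\<psi> i \<tau>) \<le> ennreal (2 * K) * ennreal (norm (f \<tau>))"
        using K by (simp add: ennreal_leI flip: ennreal_mult)
    qed
    show "(\<integral>\<^sup>+\<tau>. ennreal (2 * K) * ennreal (norm (f \<tau>)) \<partial>M) < \<infinity>"
      using int_f meas_f by (subst nn_integral_cmult) (auto simp: ennreal_mult_less_top)
    show "AE \<tau> in M. (\<lambda>i. ennreal (\<psi> i \<tau>)) \<longlonglongrightarrow> 0"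
    proof (rule AE_I2)
      fix \<tau> assume \<tau>: "\<tau> \<in> space M"
      have "(\<lambda>i. \<psi> i \<tau>) \<longlonglongrightarrow> norm (G \<tau> (f \<tau>) - G \<tau> (f \<tau>))"
        unfolding \<psi>_def by (intro tendsto_intros G_lim \<tau>)
      then show "(\<lambda>i. ennreal (\<psi> i \<tau>)) \<longlonglongrightarrow> 0" using tendsto_ennrealI by fastforce
    qed
  qed simp
  show "(\<lambda>i. \<integral>\<^sup>+\<tau>. ennreal (norm (G \<tau> (f \<tau>) - h i \<tau>)) \<partial>M) \<longlonglongrightarrow> 0"
  proof (rule tendsto_sandwich[OF _ _ tendsto_const])
    show "\<forall>\<^sub>F i in sequentially. (\<integral>\<^sup>+\<tau>. ennreal (norm (G \<tau> (f \<tau>) - h i \<tau>)) \<partial>M) \<le>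
        ennreal K * (\<integral>\<^sup>+\<tau>. ennreal (norm (f \<tau> - s i \<tau>)) \<partial>M) + (\<integral>\<^sup>+\<tau>. ennreal (\<psi> i \<tau>) \<partial>M)"
    proof (rule always_eventually, rule allI)
      fix i
      have "(\<integral>\<^sup>+\<tau>. ennreal (norm (G \<tau> (f \<tau>) - h i \<tau>)) \<partial>M) \<le>
          (\<integral>\<^sup>+\<tau>. ennreal K * ennreal (norm (f \<tau> - s i \<tau>)) + ennreal (\<psi> i \<tau>) \<partial>M)"
      proof (rule nn_integral_mono)
        fix \<tau> assume \<tau>: "\<tau> \<in> space M"
        have "G \<tau> (f \<tau>) - h i \<tau> = G (\<kappa> i \<tau>) (f \<tau> - s i \<tau>) - (G (\<kappa> i \<tau>) (f \<tau>) - G \<tau> (f \<tau>))"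
          by (simp add: h_def linear_diff[OF G_lin])
        then have "norm (G \<tau> (f \<tau>) - h i \<tau>) \<le> norm (G (\<kappa> i \<tau>) (f \<tau> - s i \<tau>)) + \<psi> i \<tau>"
          unfolding \<psi>_def by (metis norm_triangle_ineq4)
        also have "\<dots> \<le> K * norm (f \<tau> - s i \<tau>) + \<psi> i \<tau>" by (intro add_right_mono G\<kappa>_le \<tau>)
        finally have "ennreal (norm (G \<tau> (f \<tau>) - h i \<tau>)) \<le> ennreal (K * norm (f \<tau> - s i \<tau>) + \<psi> i \<tau>)"
          by (rule ennreal_leI)
        then show "ennreal (norm (G \<tau> (f \<tau>) - h i \<tau>)) \<le> ennreal K * ennreal (norm (f \<tau> - s i \<tau>)) + ennreal (\<psi> i \<tau>)"
          using K by (simp add: \<psi>_def ennreal_plus ennreal_mult)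
      qed
      also have "\<dots> = ennreal K * (\<integral>\<^sup>+\<tau>. ennreal (norm (f \<tau> - s i \<tau>)) \<partial>M) + (\<integral>\<^sup>+\<tau>. ennreal (\<psi> i \<tau>) \<partial>M)"
        using meas_fs[of i] meas_\<psi>[of i] by (subst nn_integral_add) (auto simp: nn_integral_cmult)
      finally show "(\<integral>\<^sup>+\<tau>. ennreal (norm (G \<tau> (f \<tau>) - h i \<tau>)) \<partial>M) \<le>
          ennreal K * (\<integral>\<^sup>+\<tau>. ennreal (norm (f \<tau> - s i \<tau>)) \<partial>M) + (\<integral>\<^sup>+\<tau>. ennreal (\<psi> i \<tau>) \<partial>M)" .
    qed
    have "(\<lambda>i. ennreal K * (\<integral>\<^sup>+\<tau>. ennreal (norm (f \<tau> - s i \<tau>)) \<partial>M)) \<longlonglongrightarrow> ennreal K * 0"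
      by (intro ennreal_tendsto_cmult s_L1) simp
    from tendsto_add[OF this \<psi>_L1]
    show "(\<lambda>i. ennreal K * (\<integral>\<^sup>+\<tau>. ennreal (norm (f \<tau> - s i \<tau>)) \<partial>M) + (\<integral>\<^sup>+\<tau>. ennreal (\<psi> i \<tau>) \<partial>M)) \<longlonglongrightarrow> 0"
      by simp
  qed simp
qed

context sector_contour
begin

lemma U_convolution_integrable:
  assumes f: "bochner_integrable (lebesgue_on {0<..<T}) f" and s: "0 \<le> s" "s \<le> T"
  shows "bochner_integrable (lebesgue_on {0<..<s}) (\<lambda>\<tau>. opexp D A (s - \<tau>) (f \<tau>))"
proof -
  define M where "M = lebesgue_on {0<..<s}"
  have sub: "{0<..<T} \<inter> {0<..<s} = {0<..<s}" using s by auto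
  have M_eq: "restrict_space (lebesgue_on {0<..<T}) {0<..<s} = M"
    using s by (simp add: M_def restrict_restrict_space min_absorb2)
  have space_M: "space M = {0<..<s}" by (simp add: M_def space_restrict_space)
  have "{0<..<s} \<inter> space (lebesgue_on {0<..<T}) \<in> sets (lebesgue_on {0<..<T})"
    by (auto simp: space_restrict_space sets_restrict_space sub Int_commute intro!: image_eqI[of _ _ "{0<..<s}"])
  then obtain \<sigma> where \<sigma>: "\<And>i::nat. simple_function M (\<sigma> i)" "AE x in M. (\<lambda>i. \<sigma> i x) \<longlonglongrightarrow> f x"
    "(\<lambda>i. \<integral>\<^sup>+x. ennreal (norm (f x - \<sigma> i x)) \<partial>M) \<longlonglongrightarrow> 0"
    using bochner_integrable_approx_restrict[OF f, of "{0<..<s}"] unfolding M_eq by blast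
  obtain N where N: "{x \<in> space M. \<not> (\<lambda>i. \<sigma> i x) \<longlonglongrightarrow> f x} \<subseteq> N" "emeasure M N = 0" "N \<in> sets M"
    using AE_E[OF \<sigma>(2)] by blast
  have AE_N: "AE x in M. x \<notin> N" using N by (intro AE_not_in) (auto simp: null_sets_def)
  \<comment> \<open>Setting f and its approximants to 0 on the exceptional null set yields
    convergence at every point.\<close>
  define f0 where "f0 x = (if x \<in> N then 0 else f x)" for x
  define \<sigma>0 where "\<sigma>0 i x = (if x \<in> N then 0 else \<sigma> i x)" for i x
  obtain K where K: "1 \<le> K" "\<And>t x. 0 \<le> t \<Longrightarrow> t \<le> s \<Longrightarrow> norm (U t x) \<le> K * norm x"
    using U_bound_local[of s] by blast
  \<comment> \<open>\<tau> is rounded down to a multiple of 1 / (i + 1). Rounding down, for \<tau>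
    in (0, s), keeps s - \<kappa> i \<tau> in [0, s], where the operators are equibounded.\<close>
  define \<kappa> where "\<kappa> i \<tau> = of_int \<lfloor>real (Suc i) * \<tau>\<rfloor> / real (Suc i)" for i and \<tau> :: real
  have \<kappa>_le: "\<kappa> i \<tau> \<le> \<tau>" "\<tau> - 1 / real (Suc i) \<le> \<kappa> i \<tau>" for i \<tau>
  proof -
    have "of_int \<lfloor>real (Suc i) * \<tau>\<rfloor> \<le> real (Suc i) * \<tau>" "real (Suc i) * \<tau> - 1 \<le> of_int \<lfloor>real (Suc i) * \<tau>\<rfloor>"
      by linarith+
    then have "\<kappa> i \<tau> \<le> real (Suc i) * \<tau> / real (Suc i)" "(real (Suc i) * \<tau> - 1) / real (Suc i) \<le> \<kappa> i \<tau>"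
      unfolding \<kappa>_def by (intro divide_right_mono; simp)+
    then show "\<kappa> i \<tau> \<le> \<tau>" "\<tau> - 1 / real (Suc i) \<le> \<kappa> i \<tau>"
      by (simp_all add: diff_divide_distrib del: of_nat_Suc)
  qed
  have \<kappa>_ge: "0 \<le> \<kappa> i \<tau>" if "0 < \<tau>" for i \<tau> using that by (simp add: \<kappa>_def)
  have "bochner_integrable M (\<lambda>\<tau>. U (s - \<tau>) (f0 \<tau>))"
  proof (rule bochner_integrable_operator[where f = f0 and G = "\<lambda>\<tau>. U (s - \<tau>)" and s = \<sigma>0 and \<kappa> = \<kappa> and K = K])
    show "emeasure M (space M) < \<infinity>"
      unfolding space_M unfolding M_def using s by (subst emeasure_restrict_space) auto
    show "simple_function M (\<sigma>0 i)" for i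
      unfolding \<sigma>0_def using N(3) sets.sets_into_space[OF N(3)]
      by (intro simple_function_If_set \<sigma>(1) simple_function_const) (auto simp: Int_absorb2)
    show "(\<lambda>i. \<sigma>0 i x) \<longlonglongrightarrow> f0 x" if "x \<in> space M" for x
      using N(1) that by (auto simp: \<sigma>0_def f0_def)
    have "(\<integral>\<^sup>+x. ennreal (norm (f0 x - \<sigma>0 i x)) \<partial>M) = (\<integral>\<^sup>+x. ennreal (norm (f x - \<sigma> i x)) \<partial>M)" for i
    proof (rule nn_integral_cong_AE)
      show "AE x in M. ennreal (norm (f0 x - \<sigma>0 i x)) = ennreal (norm (f x - \<sigma> i x))"
        using AE_N by eventually_elim (simp add: f0_def \<sigma>0_def)
    qed
    then show "(\<lambda>i. \<integral>\<^sup>+x. ennreal (norm (f0 x - \<sigma>0 i x)) \<partial>M) \<longlonglongrightarrow> 0" using \<sigma>(3) by simp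
    show "simple_function M (\<kappa> i)" for i
    proof (rule simple_function_borel_measurable)
      have "\<kappa> i \<in> borel_measurable borel" unfolding \<kappa>_def by measurable
      then show "\<kappa> i \<in> borel_measurable M"
        unfolding M_def by (intro measurable_restrict_space1 measurable_completion) simp
      have "\<kappa> i ` space M \<subseteq> (\<lambda>k. of_int k / real (Suc i)) ` {0..\<lfloor>real (Suc i) * s\<rfloor>}"
        by (auto simp: \<kappa>_def space_M intro!: imageI floor_mono mult_left_mono)
      then show "finite (\<kappa> i ` space M)" by (rule finite_subset) auto
    qed
    show "linear (U (s - \<tau>))" for \<tau> by (rule U_linear)
    show "0 \<le> K" using K(1) by simp
    show "norm (U (s - \<tau>) v) \<le> K * norm v" if "\<tau> \<in> space M" for \<tau> v
      using that by (intro K(2)) (auto simp: space_M)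
    show "norm (U (s - \<kappa> i \<tau>) v) \<le> K * norm v" if "\<tau> \<in> space M" for i \<tau> v
      using that \<kappa>_le(1)[of i \<tau>] \<kappa>_ge[of \<tau> i] by (intro K(2)) (auto simp: space_M)
    show "(\<lambda>i. U (s - \<kappa> i \<tau>) v) \<longlonglongrightarrow> U (s - \<tau>) v" if \<tau>: "\<tau> \<in> space M" for \<tau> v
    proof (rule continuous_on_tendsto_compose[OF U_continuous])
      have "(\<lambda>i. \<tau> - 1 / real (Suc i)) \<longlonglongrightarrow> \<tau> - 0"
        by (intro tendsto_intros LIMSEQ_inverse_real_of_nat[unfolded inverse_eq_divide])
      then have lim: "(\<lambda>i. \<tau> - 1 / real (Suc i)) \<longlonglongrightarrow> \<tau>" by simp
      have "(\<lambda>i. \<kappa> i \<tau>) \<longlonglongrightarrow> \<tau>"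
        by (rule tendsto_sandwich[OF _ _ lim tendsto_const]) (use \<kappa>_le in \<open>auto intro!: always_eventually simp del: of_nat_Suc\<close>)
      then show "(\<lambda>i. s - \<kappa> i \<tau>) \<longlonglongrightarrow> s - \<tau>" by (intro tendsto_intros)
      show "s - \<tau> \<in> {0..}" using \<tau> by (simp add: space_M)
      have "s - \<kappa> i \<tau> \<in> {0..}" for i using \<tau> \<kappa>_le(1)[of i \<tau>] by (simp add: space_M)
      then show "\<forall>\<^sub>F i in sequentially. s - \<kappa> i \<tau> \<in> {0..}" by simp
    qed
  qed
  then obtain y where y: "has_bochner_int M (\<lambda>\<tau>. U (s - \<tau>) (f0 \<tau>)) y"
    unfolding bochner_integrable_def by blast
  have "AE \<tau> in M. U (s - \<tau>) (f0 \<tau>) = opexp D A (s - \<tau>) (f \<tau>)"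
    using AE_N AE_space
  proof eventually_elim
    case (elim \<tau>)
    then show ?case by (simp add: f0_def opexp_eq_U space_M)
  qed
  then have "has_bochner_int M (\<lambda>\<tau>. opexp D A (s - \<tau>) (f \<tau>)) y"
    by (rule has_bochner_int_cong_AE[OF y])
  then show ?thesis unfolding bochner_integrable_def M_def by blast
qed

end

text \<open>Over the empty interval all simple integrals are 0 and the almost-everywhere conditions
  are vacuous. So 0 is the only value of the integral, and the definite description picks
  it.\<close>

lemma duhamel_0:
  fixes A :: "'a::complex_banach \<Rightarrow> 'a"
  shows "duhamel D A f 0 = 0"
proof -
  define M where "M = lebesgue_on {0<..<0::real}"
  have sp: "space M = {}" by (simp add: M_def space_restrict_space)
  have "has_bochner_int M g y \<longleftrightarrow> y = 0" for g :: "real \<Rightarrow> 'a" and y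
  proof
    have 0: "Bochner_Integration.simple_bochner_integral M s = (0::'a)" for s by (simp add: simple_bochner_integral_def sp)
    {
      assume "has_bochner_int M g y"
      then obtain s where "(\<lambda>i::nat. Bochner_Integration.simple_bochner_integral M (s i)) \<longlonglongrightarrow> y"
        unfolding has_bochner_int_def by blast
      then show "y = 0" by (simp add: 0 LIMSEQ_const_iff)
    }
    assume "y = 0"
    then show "has_bochner_int M g y"
      unfolding has_bochner_int_def
      by (intro exI[of _ "\<lambda>i x. 0"])
        (auto simp: 0 sp simple_bochner_integrable.simps nn_integral_empty intro!: AE_I2)
  qed
  then have "bochner_integral M g = 0" for g :: "real \<Rightarrow> 'a"
    unfolding bochner_integral_def by (intro the_equality) auto
  then show ?thesis unfolding duhamel_def M_def .
qed

section \<open>The inverse of the nonlocal operator\<close>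

lemma closed_sector:
  assumes "0 \<le> \<theta>" "\<theta> < pi / 2"
  shows "closed (sector \<rho> \<theta>)"
proof -
  have "sector \<rho> \<theta> = {z. \<rho> \<le> Re z} \<inter> {z. \<bar>Im z\<bar> \<le> (Re z - \<rho>) * tan \<theta>}"
    using sector_iff[OF assms] by auto
  then show ?thesis by (auto intro!: closed_Int closed_Collect_le continuous_intros)
qed

text \<open>A point of the inner sector on such a ray has cos \<psi> > 0 and |sin \<psi>| < cos
  \<psi> tan \<theta>'. The range of \<psi> forces cos \<psi> \<le> cos \<theta>' and thus |sin
  \<psi>| \<ge> sin \<theta>', a contradiction.\<close>

lemma ray_notin_smaller_sector:
  assumes \<theta>: "0 \<le> \<theta>" "\<theta> < \<theta>'" "\<theta>' < pi / 2" and \<rho>: "\<rho>' < \<rho>"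
    and r: "0 \<le> r" and \<psi>: "\<psi> \<in> {\<theta>'..2 * pi - \<theta>'}"
  shows "of_real \<rho>' + of_real r * cis \<psi> \<notin> sector \<rho> \<theta>"
proof
  assume "of_real \<rho>' + of_real r * cis \<psi> \<in> sector \<rho> \<theta>"
  then have 1: "\<rho> \<le> \<rho>' + r * cos \<psi>" and 2: "\<bar>r * sin \<psi>\<bar> \<le> (\<rho>' + r * cos \<psi> - \<rho>) * tan \<theta>"
    using sector_iff[of \<theta>] \<theta> by auto
  have "0 < r * cos \<psi>" using 1 \<rho> by simp
  then have pos: "0 < r" "0 < cos \<psi>" using r by (auto simp: zero_less_mult_iff)
  have t: "0 \<le> tan \<theta>" "tan \<theta> < tan \<theta>'"
    using \<theta> by (auto intro: tan_pos_pi2_le tan_monotone)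
  have "r * \<bar>sin \<psi>\<bar> \<le> (\<rho>' + r * cos \<psi> - \<rho>) * tan \<theta>" using 2 r by (simp add: abs_mult)
  also have "\<dots> \<le> (r * cos \<psi>) * tan \<theta>" using \<rho> t by (intro mult_right_mono) auto
  also have "\<dots> < (r * cos \<psi>) * tan \<theta>'" using pos t by (intro mult_strict_left_mono) auto
  finally have sin: "\<bar>sin \<psi>\<bar> < cos \<psi> * tan \<theta>'" using pos by simp
  have c': "0 < cos \<theta>'" using \<theta> by (intro cos_gt_zero_pi) auto
  have c: "cos \<psi> \<le> cos \<theta>'" using \<psi> \<theta> by (intro cos_le_if_left) auto
  have "(cos \<psi>)\<^sup>2 \<le> (cos \<theta>')\<^sup>2" using c pos by (intro power_mono) auto
  then have "(sin \<theta>')\<^sup>2 \<le> (sin \<psi>)\<^sup>2" by (simp add: sin_squared_eq)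
  moreover have "0 \<le> sin \<theta>'" using \<theta> by (intro sin_ge_zero) auto
  ultimately have "sin \<theta>' \<le> \<bar>sin \<psi>\<bar>" by (simp add: abs_le_square_iff[symmetric])
  moreover have "sin \<theta>' = cos \<theta>' * tan \<theta>'" using c' by (simp add: tan_def)
  moreover have "cos \<psi> * tan \<theta>' \<le> cos \<theta>' * tan \<theta>'" using c t by (intro mult_right_mono) auto
  ultimately show False using sin by simp
qed

lemma strongly_positive_sector_contour:
  assumes A: "strongly_positive D A \<rho> \<theta>" and \<rho>': "\<rho>' < \<rho>" and \<theta>': "\<theta> < \<theta>'" "\<theta>' < pi / 2"
  obtains M where "sector_contour D A \<rho>' \<theta>' M (- sector \<rho> \<theta>)"
proof -
  have \<theta>: "0 \<le> \<theta>" "\<theta> < pi / 2" and lin: "linear_operator_on D A" and dense: "closure D = UNIV"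
    and sp: "spectrum D A \<subseteq> sector \<rho> \<theta>"
    using A by (auto simp: strongly_positive_def)
  obtain M0 where M0: "\<And>z. z \<notin> sector \<rho> \<theta> \<Longrightarrow> onorm (resolvent D A z) \<le> M0 / (1 + cmod z)"
    using A unfolding strongly_positive_def by blast
  define M where "M = max 1 M0"
  have res: "- sector \<rho> \<theta> \<subseteq> resolvent_set D A" using sp by (auto simp: spectrum_def)
  have "sector_contour D A \<rho>' \<theta>' M (- sector \<rho> \<theta>)"
  proof
    show "open (- sector \<rho> \<theta>)" using closed_sector[OF \<theta>] by (simp add: open_Compl)
    show "of_real \<rho>' + of_real r * cis \<psi> \<in> - sector \<rho> \<theta>" if "0 \<le> r" "\<psi> \<in> {\<theta>'..2 * pi - \<theta>'}" for r \<psi>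
      using ray_notin_smaller_sector[OF \<theta>(1) \<theta>' \<rho>' that] by simp
    show "norm (resolvent D A z x) \<le> M / (1 + cmod z) * norm x" if z: "z \<in> - sector \<rho> \<theta>" for z x
    proof -
      have "bounded_linear (resolvent D A z)" using res z by (auto simp: resolvent_set_def)
      then have "norm (resolvent D A z x) \<le> onorm (resolvent D A z) * norm x" by (rule onorm)
      also have "onorm (resolvent D A z) \<le> M0 / (1 + cmod z)" using M0 z by simp
      also have "\<dots> \<le> M / (1 + cmod z)" by (intro divide_right_mono) (auto simp: M_def)
      finally show ?thesis by (simp add: mult_right_mono)
    qed
  qed (use lin dense res \<theta> \<theta>' in \<open>auto simp: M_def\<close>)
  then show ?thesis by (rule that)
qed

text \<open>B is not identically 0, so a zero z_0 is isolated and B (1 / B) = 1 near it. Continuity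
  would give the same value at z_0, where the product is 0.\<close>

lemma B_fun_nonzero_if_analytic:
  assumes t: "\<And>k. k \<in> {1..n} \<Longrightarrow> 0 < t k" and an: "(\<lambda>z. 1 / B_fun n \<alpha> t z) analytic_on {z0}"
  shows "B_fun n \<alpha> t z0 \<noteq> 0"
proof
  assume 0: "B_fun n \<alpha> t z0 = 0"
  obtain R where R: "\<And>z. R \<le> Re z \<Longrightarrow> cmod (B_fun n \<alpha> t z - 1) \<le> 1 / 2"
    using B_fun_far[of n t \<alpha>, OF t] by blast
  have "B_fun n \<alpha> t (of_real R) \<noteq> 0" using R[of "of_real R"] by auto
  then obtain r where r: "0 < r" "\<And>z. z \<in> ball z0 r - {z0} \<Longrightarrow> B_fun n \<alpha> t z \<noteq> 0"
    using isolated_zeros[OF B_fun_holomorphic open_UNIV connected_UNIV _ 0] by (metis UNIV_I)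
  have "isCont (B_fun n \<alpha> t) z0"
    using holomorphic_on_imp_continuous_on[OF B_fun_holomorphic[of n \<alpha> t UNIV]]
    by (simp add: continuous_on_eq_continuous_at)
  moreover have "isCont (\<lambda>z. 1 / B_fun n \<alpha> t z) z0"
    using an by (simp add: analytic_at_imp_isCont)
  ultimately have "((\<lambda>z. B_fun n \<alpha> t z * (1 / B_fun n \<alpha> t z)) \<longlongrightarrow> B_fun n \<alpha> t z0 * (1 / B_fun n \<alpha> t z0)) (at z0)"
    unfolding isCont_def by (intro tendsto_mult)
  moreover have "\<forall>\<^sub>F z in at z0. B_fun n \<alpha> t z * (1 / B_fun n \<alpha> t z) = 1"
    unfolding eventually_at using r by (intro exI[of _ r]) (auto simp: dist_commute)
  ultimately have "((\<lambda>z. 1) \<longlongrightarrow> B_fun n \<alpha> t z0 * (1 / B_fun n \<alpha> t z0)) (at z0)"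
    by (rule Lim_transform_eventually)
  then have "(1::complex) = B_fun n \<alpha> t z0 * (1 / B_fun n \<alpha> t z0)"
    by (rule iffD1[OF tendsto_const_iff[OF at_neq_bot]])
  then show False using 0 by simp
qed

text \<open>Far to the right |B| \<ge> 1 / 2, and the rest of the sector is compact.\<close>

lemma inverse_B_fun_bounded:
  assumes \<theta>: "0 \<le> \<theta>" "\<theta> < pi / 2" and t: "\<And>k. k \<in> {1..n} \<Longrightarrow> 0 < t k"
    and nz: "\<And>z. z \<in> sector \<rho> \<theta> \<Longrightarrow> B_fun n \<alpha> t z \<noteq> 0"
  obtains C where "0 \<le> C" "\<And>z. z \<in> sector \<rho> \<theta> \<Longrightarrow> cmod (1 / B_fun n \<alpha> t z) \<le> C"
proof -
  obtain R where R: "\<And>z. R \<le> Re z \<Longrightarrow> cmod (B_fun n \<alpha> t z - 1) \<le> 1 / 2"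
    using B_fun_far[of n t \<alpha>, OF t] by blast
  define S where "S = sector \<rho> \<theta> \<inter> {z. Re z \<le> R}"
  have "closed S" unfolding S_def
    by (intro closed_Int closed_sector \<theta> closed_Collect_le continuous_intros)
  moreover have "bounded S"
  proof (rule boundedI)
    fix z assume z: "z \<in> S"
    then have z': "\<rho> \<le> Re z" "\<bar>Im z\<bar> \<le> (Re z - \<rho>) * tan \<theta>" "Re z \<le> R"
      by (auto simp: S_def sector_iff[OF \<theta>])
    have "0 \<le> tan \<theta>" using \<theta> by (intro tan_pos_pi2_le) auto
    then have "(Re z - \<rho>) * tan \<theta> \<le> (R - \<rho>) * tan \<theta>" using z' by (intro mult_right_mono) auto
    then show "norm z \<le> \<bar>\<rho>\<bar> + \<bar>R\<bar> + (R - \<rho>) * tan \<theta>"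
      using cmod_le[of z] z' by linarith
  qed
  ultimately have "compact S" by (simp add: compact_eq_bounded_closed)
  moreover have "continuous_on S (\<lambda>z. 1 / B_fun n \<alpha> t z)"
    using nz holomorphic_on_imp_continuous_on[OF B_fun_holomorphic]
    by (intro continuous_intros) (auto simp: S_def)
  ultimately have "compact ((\<lambda>z. 1 / B_fun n \<alpha> t z) ` S)" by (rule compact_continuous_image[rotated])
  then obtain C where C: "\<And>z. z \<in> S \<Longrightarrow> cmod (1 / B_fun n \<alpha> t z) \<le> C"
    using compact_imp_bounded bounded_iff by (metis imageI)
  show ?thesis
  proof
    show "0 \<le> max 2 C" by simp
    fix z assume z: "z \<in> sector \<rho> \<theta>"
    show "cmod (1 / B_fun n \<alpha> t z) \<le> max 2 C"
    proof (cases "R \<le> Re z")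
      case True
      have "1 / 2 \<le> cmod (B_fun n \<alpha> t z)"
        using R[OF True] norm_triangle_ineq2[of 1 "1 - B_fun n \<alpha> t z"] by (simp add: norm_minus_commute)
      then have "1 / cmod (B_fun n \<alpha> t z) \<le> 1 / (1 / 2)" by (intro divide_left_mono) auto
      then show ?thesis by (simp add: norm_divide)
    next
      case False
      then show ?thesis using C[of z] z by (auto simp: S_def)
    qed
  qed
qed

context sector_contour
begin

lemma Phi_cong:
  assumes "\<And>z. z \<in> \<Gamma> \<Longrightarrow> g z = h z"
  shows "Phi g x = Phi h x"
proof -
  have "sector_integral \<rho> \<theta> (\<lambda>z. g z *\<^sub>C R z x) = sector_integral \<rho> \<theta> (\<lambda>z. h z *\<^sub>C R z x)"
    by (rule sector_integral_cong) (simp add: assms)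
  then show ?thesis by (simp only: Phi_def)
qed

lemma Phi_sum:
  assumes "finite I" "\<And>i. i \<in> I \<Longrightarrow> ray_decay \<rho> \<theta> (g i)"
  shows "ray_decay \<rho> \<theta> (\<lambda>z. \<Sum>i\<in>I. c i * g i z) \<and>
    Phi (\<lambda>z. \<Sum>i\<in>I. c i * g i z) x = (\<Sum>i\<in>I. c i *\<^sub>C Phi (g i) x)"
  using assms
proof (induction I)
  case empty
  have "ray_decay \<rho> \<theta> (\<lambda>z. 0 :: complex)" unfolding ray_decay_def by (auto intro!: exI[of _ 0])
  then show ?case by (simp add: Phi_def sector_integral_def ray_integrand_def scaleC_simps)
next
  case (insert i I)
  then have d: "ray_decay \<rho> \<theta> (\<lambda>z. c i * g i z)" "ray_decay \<rho> \<theta> (\<lambda>z. \<Sum>i\<in>I. c i * g i z)"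
    by (auto intro: ray_decay_cmult)
  then show ?case using ray_decay_add[OF d] Phi_add[OF d, of x] insert by (simp add: Phi_cmult)
qed

lemma U_commutes_Phi:
  assumes "ray_decay \<rho> \<theta> h"
  shows "Phi h (U t x) = U t (Phi h x)"
proof -
  have comm: "R z (U t x) = U t (R z x)" if "z \<in> \<Gamma>" for z
  proof -
    have "z \<in> resolvent_set D A" using \<Gamma>_W W_resolvent that by blast
    then show ?thesis using R_Phi(2)[OF E_decay[OF bounded_analytic_one]] by (auto simp: U_def)
  qed
  have "U t (sector_integral \<rho> \<theta> (\<lambda>z. h z *\<^sub>C R z x)) = sector_integral \<rho> \<theta> (\<lambda>z. U t (h z *\<^sub>C R z x))"
    by (rule sector_integral_bounded_linear[symmetric, OF U_bounded_linear U_scaleC decay_R[OF assms]])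
  also have "\<dots> = sector_integral \<rho> \<theta> (\<lambda>z. h z *\<^sub>C R z (U t x))"
    by (intro sector_integral_cong) (simp add: U_scaleC comm)
  finally show ?thesis by (simp add: Phi_def U_scaleC)
qed

lemma B_inv_inverse:
  assumes n: "1 \<le> n" and t1: "0 < t 1" and mono: "\<And>k. k \<in> {1..n} \<Longrightarrow> t 1 \<le> t k"
    and an: "(\<lambda>z. 1 / B_fun n \<alpha> t z) analytic_on sector \<rho> \<theta>"
  shows "sector_integrable \<rho> \<theta> (B_integrand D A n \<alpha> t x)"
    and "bounded_linear (B_inv D A n \<alpha> t \<rho> \<theta>)"
    and "B_op D A n \<alpha> t (B_inv D A n \<alpha> t \<rho> \<theta> x) = x"
    and "B_inv D A n \<alpha> t \<rho> \<theta> (B_op D A n \<alpha> t x) = x"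
proof -
  have t: "0 < t k" if "k \<in> {1..n}" for k using mono[OF that] t1 by simp
  have nz: "B_fun n \<alpha> t z \<noteq> 0" if "z \<in> sector \<rho> \<theta>" for z
    using B_fun_nonzero_if_analytic[of n t, OF t] an that analytic_on_subset[of _ _ "{z}"] by blast
  obtain C1 where C1: "0 \<le> C1" "\<And>z. z \<in> sector \<rho> \<theta> \<Longrightarrow> cmod (1 / B_fun n \<alpha> t z) \<le> C1"
    using inverse_B_fun_bounded[OF less_imp_le[OF \<theta>(1)] \<theta>(2) t nz] by blast
  define C2 where "C2 = (\<Sum>k=1..n. cmod (\<alpha> k) * exp (- (t k - t 1) * \<rho>))"
  \<comment> \<open>exp (t_1 z) is multiplied in so that \<open>E 0 h (t 1)\<close> is again 1 / B -
    1. As \<open>t 1\<close> is the smallest time, the decay of B - 1 compensates this factor and h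
    stays bounded.\<close>
  define h where "h z = exp (of_real (t 1) * z) * (1 / B_fun n \<alpha> t z - 1)" for z
  have "h analytic_on sector \<rho> \<theta>" unfolding h_def by (intro analytic_intros an)
  moreover have "cmod (h z) \<le> C2 * C1" if z: "z \<in> sector \<rho> \<theta>" for z
  proof -
    have "\<rho> \<le> Re z" using z \<theta> by (simp add: sector_iff)
    have le: "cmod (B_fun n \<alpha> t z - 1) \<le> exp (- t 1 * Re z) * C2"
      unfolding C2_def by (rule B_fun_norm_le[OF mono \<open>\<rho> \<le> Re z\<close>])
    have "h z = exp (of_real (t 1) * z) * ((1 - B_fun n \<alpha> t z) * (1 / B_fun n \<alpha> t z))"
      using nz[OF z] by (simp add: h_def field_simps)
    then have "cmod (h z) = cmod (exp (of_real (t 1) * z)) * (cmod (1 - B_fun n \<alpha> t z) * cmod (1 / B_fun n \<alpha> t z))"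
      by (simp only: norm_mult)
    also have "cmod (exp (of_real (t 1) * z)) = exp (t 1 * Re z)" by simp
    also have "cmod (1 - B_fun n \<alpha> t z) = cmod (B_fun n \<alpha> t z - 1)" by (rule norm_minus_commute)
    also have "exp (t 1 * Re z) * (cmod (B_fun n \<alpha> t z - 1) * cmod (1 / B_fun n \<alpha> t z)) \<le>
        exp (t 1 * Re z) * ((exp (- t 1 * Re z) * C2) * C1)"
      using le C1(2)[OF z] by (intro mult_left_mono mult_mono) (auto intro: order_trans[OF norm_ge_zero])
    also have "\<dots> = C2 * C1" by (simp add: exp_minus field_simps)
    finally show ?thesis .
  qed
  ultimately have h: "bounded_analytic h" unfolding bounded_analytic_def by blast
  define g where "g = E 0 h (t 1)"
  have g_eq: "g z = 1 / B_fun n \<alpha> t z - 1" for z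
    by (simp add: g_def E_def h_def mult_exp_exp flip: mult.assoc)
  have g: "ray_decay \<rho> \<theta> g" unfolding g_def by (rule E_decay[OF h t1])
  have "ray_decay \<rho> \<theta> (B_integrand D A n \<alpha> t x)"
    using decay_R[OF g] unfolding g_eq B_integrand_def[abs_def] .
  then show "sector_integrable \<rho> \<theta> (B_integrand D A n \<alpha> t x)" by (rule ray_decay_sector_integrable)
  have B_inv: "B_inv D A n \<alpha> t \<rho> \<theta> x = x + Phi g x" for x
    unfolding B_inv_def Phi_def g_eq B_integrand_def[abs_def] ..
  then have "B_inv D A n \<alpha> t \<rho> \<theta> = (\<lambda>x. x + Phi g x)" by auto
  then show "bounded_linear (B_inv D A n \<alpha> t \<rho> \<theta>)"
    using bounded_linear_add[OF bounded_linear_ident Phi_bounded_linear(1)[OF g]] by simp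
  have B_op: "B_op D A n \<alpha> t x = x + (\<Sum>k=1..n. \<alpha> k *\<^sub>C U (t k) x)" for x
    unfolding B_op_def using t by (intro arg_cong[where f = "\<lambda>y. x + y"] sum.cong) (auto simp: opexp_eq_U less_imp_le)
  have B_op_add: "B_op D A n \<alpha> t (x + y) = B_op D A n \<alpha> t x + B_op D A n \<alpha> t y" for x y
    by (simp add: B_op linear_add[OF U_linear] scaleC_add_right sum.distrib)
  show right: "B_op D A n \<alpha> t (B_inv D A n \<alpha> t \<rho> \<theta> x) = x" for x
  proof -
    define e where "e k = E 0 (\<lambda>z. 1) (t k)" for k
    \<comment> \<open>The function e k g with g = 1 / B - 1: the two exponentials combine to the
      time t k + t 1.\<close>
    define e' where "e' k = E 0 h (t k + t 1)" for k
    have e: "ray_decay \<rho> \<theta> (e k)" "ray_decay \<rho> \<theta> (e' k)" if "k \<in> {1..n}" for k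
      unfolding e_def e'_def using t[OF that] t1 by (auto intro!: E_decay bounded_analytic_one h)
    have S1: "ray_decay \<rho> \<theta> (\<lambda>z. \<Sum>k=1..n. \<alpha> k * e k z)"
      "Phi (\<lambda>z. \<Sum>k=1..n. \<alpha> k * e k z) x = (\<Sum>k=1..n. \<alpha> k *\<^sub>C Phi (e k) x)"
      using Phi_sum[of "{1..n}" e \<alpha> x] e by auto
    have S2: "ray_decay \<rho> \<theta> (\<lambda>z. \<Sum>k=1..n. \<alpha> k * e' k z)"
      "Phi (\<lambda>z. \<Sum>k=1..n. \<alpha> k * e' k z) x = (\<Sum>k=1..n. \<alpha> k *\<^sub>C Phi (e' k) x)"
      using Phi_sum[of "{1..n}" e' \<alpha> x] e by auto
    have Ue: "U (t k) x = Phi (e k) x" "U (t k) (Phi g x) = Phi (e' k) x" if "k \<in> {1..n}" for k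
      using t[OF that] U_Phi_E[OF h t1, of "t k" x] by (auto simp: U_def e_def e'_def g_def)
    have "B_op D A n \<alpha> t (x + Phi g x) = x + ((\<Sum>k=1..n. \<alpha> k *\<^sub>C Phi (e k) x) + (Phi g x + (\<Sum>k=1..n. \<alpha> k *\<^sub>C Phi (e' k) x)))"
      unfolding B_op_add unfolding B_op by (simp add: Ue)
    also have "(\<Sum>k=1..n. \<alpha> k *\<^sub>C Phi (e k) x) + (Phi g x + (\<Sum>k=1..n. \<alpha> k *\<^sub>C Phi (e' k) x)) =
        Phi (\<lambda>z. (\<Sum>k=1..n. \<alpha> k * e k z) + (g z + (\<Sum>k=1..n. \<alpha> k * e' k z))) x"
      unfolding Phi_add[OF S1(1) ray_decay_add[OF g S2(1)]] Phi_add[OF g S2(1)] S1(2) S2(2) ..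
    also have "\<dots> = Phi (\<lambda>z. 0) x"
    proof (rule Phi_cong)
      fix z assume "z \<in> \<Gamma>"
      then have z: "B_fun n \<alpha> t z \<noteq> 0" using sector_boundary_subset[of \<theta> \<rho>] \<theta> nz by auto
      have S: "(\<Sum>k=1..n. \<alpha> k * e k z) = B_fun n \<alpha> t z - 1"
        by (simp add: e_def E_def B_fun_def)
      have "e' k z = e k z * g z" for k
        by (simp add: e_def e'_def g_def E_def distrib_right exp_add exp_minus exp_diff field_simps)
      then have "(\<Sum>k=1..n. \<alpha> k * e' k z) = (\<Sum>k=1..n. \<alpha> k * e k z) * g z"
        by (simp add: sum_distrib_right mult.assoc)
      then show "(\<Sum>k=1..n. \<alpha> k * e k z) + (g z + (\<Sum>k=1..n. \<alpha> k * e' k z)) = 0"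
        using z unfolding S g_eq by (simp add: field_simps)
    qed
    also have "\<dots> = 0" by (simp add: Phi_def sector_integral_def ray_integrand_def scaleC_simps)
    finally show ?thesis by (simp add: B_inv)
  qed
  \<comment> \<open>\<open>Phi g\<close> commutes with the semigroup and hence with B(A), so the
    right inverse is also a left inverse.\<close>
  have "Phi g (B_op D A n \<alpha> t x) = B_op D A n \<alpha> t (Phi g x)"
  proof -
    have "linear (Phi g)" using Phi_bounded_linear(1)[OF g] by (rule bounded_linear.linear)
    then show ?thesis
      by (simp add: B_op linear_add linear_sum Phi_bounded_linear(2)[OF g] U_commutes_Phi[OF g])
  qed
  then have "B_inv D A n \<alpha> t \<rho> \<theta> (B_op D A n \<alpha> t x) = B_op D A n \<alpha> t (B_inv D A n \<alpha> t \<rho> \<theta> x)"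
    by (simp add: B_inv B_op_add)
  then show "B_inv D A n \<alpha> t \<rho> \<theta> (B_op D A n \<alpha> t x) = x" by (simp add: right)
qed

section \<open>The generalized solution\<close>

text \<open>Since the Duhamel term vanishes at 0, u(0) is the bracket v, and the nonlocal condition
  becomes B(A) v = u_0 minus the weighted Duhamel terms.\<close>

lemma solution_formula_solves:
  assumes f: "bochner_integrable (lebesgue_on {0<..<T}) f"
    and t: "\<And>k. k \<in> {1..n} \<Longrightarrow> 0 < t k \<and> t k \<le> T"
    and Binv: "linear Binv" "\<And>x. B_op D A n \<alpha> t (Binv x) = x"
  shows "generalized_solution D A T f u0 n \<alpha> t (solution_formula D A f u0 n \<alpha> t Binv)"
proof -
  define v where "v = Binv u0 - Binv (\<Sum>i=1..n. \<alpha> i *\<^sub>C duhamel D A f (t i))"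
  define u where "u = solution_formula D A f u0 n \<alpha> t Binv"
  have u: "u s = opexp D A s v + duhamel D A f s" for s
    by (simp add: u_def solution_formula_def v_def)
  have u_0: "u 0 = v" by (simp add: u opexp_eq_U U_def duhamel_0)
  have "u 0 + (\<Sum>k=1..n. \<alpha> k *\<^sub>C u (t k)) =
      B_op D A n \<alpha> t v + (\<Sum>k=1..n. \<alpha> k *\<^sub>C duhamel D A f (t k))"
    unfolding u_0 unfolding u B_op_def by (simp add: scaleC_add_right sum.distrib)
  also have "v = Binv (u0 - (\<Sum>i=1..n. \<alpha> i *\<^sub>C duhamel D A f (t i)))"
    unfolding v_def linear_diff[OF Binv(1)] ..
  finally have nonlocal: "u 0 + (\<Sum>k=1..n. \<alpha> k *\<^sub>C u (t k)) = u0" by (simp add: Binv(2))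
  show ?thesis
    unfolding generalized_solution_def u_def[symmetric]
  proof (intro conjI ballI nonlocal)
    fix s assume "s \<in> {0..T}"
    then show "bochner_integrable (lebesgue_on {0<..<s}) (\<lambda>\<tau>. opexp D A (s - \<tau>) (f \<tau>))"
      by (intro U_convolution_integrable[OF f]) auto
    show "u s = opexp D A s (u 0) + duhamel D A f s" unfolding u_0 by (rule u)
  qed
qed

end

text \<open>\<phi>(z) is pulled back through the affine substitution of each case: into the closed
  unit disc for the two rescaled polynomials, and into the disc of radius r around 0 for the shifted
  one.\<close>

lemma B_fun_nonzero_on_sector:
  fixes \<rho> \<theta> :: real and lam :: "nat \<Rightarrow> int"
  assumes \<theta>: "0 \<le> \<theta>" "\<theta> < pi / 2"
    and t: "\<And>k. k \<in> {1..n} \<Longrightarrow> 0 < \<mu> k \<and> t k = real_of_int (lam k) / real (\<mu> k) \<and> 0 < t k"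
    and cases: "let Q = denom_lcm n \<mu>; P = assoc_poly n \<alpha> lam \<mu> in
         (let P\<^sub>0 = P \<circ>\<^sub>p [:0, phi Q (of_real \<rho>):]
          in schur_cohn P\<^sub>0 \<or> some_lower_bound_exceeds P\<^sub>0 1) \<or>
         (\<exists>x. is_x_d Q \<rho> \<theta> x \<and>
            (let P\<^sub>1 = P \<circ>\<^sub>p [:of_real (circle_center Q \<rho> \<theta> x), of_real (circle_radius Q \<rho> \<theta> x):]
             in schur_cohn P\<^sub>1 \<or> some_lower_bound_exceeds P\<^sub>1 1)) \<or>
         (\<exists>x. is_x_d Q \<rho> \<theta> x \<and>
            (let P\<^sub>2 = P \<circ>\<^sub>p [:of_real (circle_center Q \<rho> \<theta> x), 1:]
             in some_lower_bound_exceeds P\<^sub>2 (circle_radius Q \<rho> \<theta> x)))"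
    and z: "z \<in> sector \<rho> \<theta>"
  shows "B_fun n \<alpha> t z \<noteq> 0"
proof -
  define Q where "Q = denom_lcm n \<mu>"
  define P where "P = assoc_poly n \<alpha> lam \<mu>"
  have B: "B_fun n \<alpha> t z = poly P (phi Q z)" and Q: "0 < Q" and P0: "poly P 0 = 1"
    using poly_assoc_poly[of n \<mu> t lam, OF t] by (simp_all add: Q_def P_def)
  have P_nz: "P \<noteq> 0" using P0 by auto
  \<comment> \<open>Excludes the zero polynomial, for which the Schur-Cohn condition would hold
    vacuously.\<close>
  have comp: "P \<circ>\<^sub>p [:a, b:] \<noteq> 0" if "b \<noteq> 0" for a b
    using P_nz that by (simp add: pcompose_eq_0_iff)
  have no_root: "poly p w \<noteq> 0" if "schur_cohn p \<or> some_lower_bound_exceeds p 1" "p \<noteq> 0" "cmod w \<le> 1" for p w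
    using that no_root_if_schur_cohn no_root_if_lower_bound_exceeds by blast
  have disc: "cmod (phi Q z - of_real (circle_center Q \<rho> \<theta> x)) \<le> circle_radius Q \<rho> \<theta> x"
    "0 < circle_radius Q \<rho> \<theta> x" if "is_x_d Q \<rho> \<theta> x" for x
    using is_x_d_disc[OF Q \<theta> that z] circle_radius_eq(3)[OF Q] that by (auto simp: is_x_d_def is_arg_max_def)
  consider (0) "schur_cohn (P \<circ>\<^sub>p [:0, phi Q (of_real \<rho>):]) \<or> some_lower_bound_exceeds (P \<circ>\<^sub>p [:0, phi Q (of_real \<rho>):]) 1"
    | (1) x where "is_x_d Q \<rho> \<theta> x"
        "schur_cohn (P \<circ>\<^sub>p [:of_real (circle_center Q \<rho> \<theta> x), of_real (circle_radius Q \<rho> \<theta> x):]) \<or>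
         some_lower_bound_exceeds (P \<circ>\<^sub>p [:of_real (circle_center Q \<rho> \<theta> x), of_real (circle_radius Q \<rho> \<theta> x):]) 1"
    | (2) x where "is_x_d Q \<rho> \<theta> x"
        "some_lower_bound_exceeds (P \<circ>\<^sub>p [:of_real (circle_center Q \<rho> \<theta> x), 1:]) (circle_radius Q \<rho> \<theta> x)"
    using cases unfolding Let_def Q_def[symmetric] P_def[symmetric] by blast
  then have "poly P (phi Q z) \<noteq> 0"
  proof cases
    case 0
    have nz: "phi Q (of_real \<rho>) \<noteq> 0" by (simp add: phi_def)
    have "\<rho> \<le> Re z" using z \<theta> by (simp add: sector_iff)
    then have "cmod (phi Q z / phi Q (of_real \<rho>)) \<le> 1"
      using Q by (simp add: norm_divide norm_phi divide_right_mono)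
    with no_root[OF 0 comp[OF nz]] have "poly (P \<circ>\<^sub>p [:0, phi Q (of_real \<rho>):]) (phi Q z / phi Q (of_real \<rho>)) \<noteq> 0"
      by blast
    then show ?thesis using nz by (simp add: poly_pcompose)
  next
    case (1 x)
    define c r where cr: "c = circle_center Q \<rho> \<theta> x" "r = circle_radius Q \<rho> \<theta> x"
    have d: "cmod (phi Q z - of_real c) \<le> r" "0 < r" using disc[OF 1(1)] by (auto simp: cr)
    then have "cmod ((phi Q z - of_real c) / of_real r) \<le> 1" by (simp add: norm_divide)
    moreover have "complex_of_real r \<noteq> 0" using d by simp
    ultimately have "poly (P \<circ>\<^sub>p [:of_real c, of_real r:]) ((phi Q z - of_real c) / of_real r) \<noteq> 0"
      using no_root[OF 1(2)[folded cr] comp] by blast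
    then show ?thesis using d by (simp add: poly_pcompose)
  next
    case (2 x)
    have "poly (P \<circ>\<^sub>p [:of_real (circle_center Q \<rho> \<theta> x), 1:]) (phi Q z - of_real (circle_center Q \<rho> \<theta> x)) \<noteq> 0"
      by (rule no_root_if_lower_bound_exceeds[OF 2(2) disc(1)[OF 2(1)]])
    then show ?thesis by (simp add: poly_pcompose)
  qed
  then show ?thesis by (simp add: B)
qed

theorem theorem3:
  fixes A :: "'a::complex_banach \<Rightarrow> 'a" and D :: "'a set" and \<rho> \<theta> T :: real
    and f :: "real \<Rightarrow> 'a" and u0 :: 'a
    and n :: nat and \<alpha> :: "nat \<Rightarrow> complex" and t :: "nat \<Rightarrow> real"
    and lam :: "nat \<Rightarrow> int" and \<mu> :: "nat \<Rightarrow> nat"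
  assumes "strongly_positive D A \<rho> \<theta>"
    and "bochner_integrable (lebesgue_on {0<..<T}) f"
    and "1 \<le> n" and "0 < t 1" and "strict_mono_on {1..n} t" and "t n \<le> T"
    and "\<forall>k\<in>{1..n}. 0 < \<mu> k \<and> t k = real_of_int (lam k) / real (\<mu> k)"
    and "let Q = denom_lcm n \<mu>; P = assoc_poly n \<alpha> lam \<mu> in
         (let P\<^sub>0 = P \<circ>\<^sub>p [:0, phi Q (of_real \<rho>):]
          in schur_cohn P\<^sub>0 \<or> some_lower_bound_exceeds P\<^sub>0 1) \<or>
         (\<exists>x. is_x_d Q \<rho> \<theta> x \<and>
            (let P\<^sub>1 = P \<circ>\<^sub>p [:of_real (circle_center Q \<rho> \<theta> x), of_real (circle_radius Q \<rho> \<theta> x):]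
             in schur_cohn P\<^sub>1 \<or> some_lower_bound_exceeds P\<^sub>1 1)) \<or>
         (\<exists>x. is_x_d Q \<rho> \<theta> x \<and>
            (let P\<^sub>2 = P \<circ>\<^sub>p [:of_real (circle_center Q \<rho> \<theta> x), 1:]
             in some_lower_bound_exceeds P\<^sub>2 (circle_radius Q \<rho> \<theta> x)))"
  shows "(\<exists>\<rho>' \<theta>'. admissible_sector \<rho> \<theta> n \<alpha> t \<rho>' \<theta>') \<and>
    (\<forall>\<rho>' \<theta>'. admissible_sector \<rho> \<theta> n \<alpha> t \<rho>' \<theta>' \<longrightarrow>
       (let Binv = B_inv D A n \<alpha> t \<rho>' \<theta>' in
        (\<forall>x. sector_integrable \<rho>' \<theta>' (B_integrand D A n \<alpha> t x)) \<and>
        bounded_linear Binv \<and>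
        (\<forall>x. B_op D A n \<alpha> t (Binv x) = x \<and> Binv (B_op D A n \<alpha> t x) = x) \<and>
        generalized_solution D A T f u0 n \<alpha> t (solution_formula D A f u0 n \<alpha> t Binv)))"
proof -
  have \<theta>: "0 \<le> \<theta>" "\<theta> < pi / 2" using assms(1) by (auto simp: strongly_positive_def)
  have t_ge: "t 1 \<le> t k" and t_le: "t k \<le> T" if "k \<in> {1..n}" for k
  proof -
    have mono: "t i \<le> t j" if "i \<in> {1..n}" "j \<in> {1..n}" "i \<le> j" for i j
      using assms(5) that strict_mono_on_leD by metis
    show "t 1 \<le> t k" using mono[of 1 k] that by simp
    show "t k \<le> T" using mono[of k n] that assms(6) by simp
  qed
  have t_pos: "0 < t k" if "k \<in> {1..n}" for k using t_ge[OF that] assms(4) by simp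
  have t: "0 < \<mu> k \<and> t k = real_of_int (lam k) / real (\<mu> k) \<and> 0 < t k" if "k \<in> {1..n}" for k
    using assms(7) t_pos that by blast
  have "\<exists>\<rho>' \<theta>'. admissible_sector \<rho> \<theta> n \<alpha> t \<rho>' \<theta>'"
    by (rule admissible_sector_exists[OF \<theta> t_pos B_fun_nonzero_on_sector[OF \<theta> t assms(8)]])
  \<comment> \<open>Any admissible sector is treated here, not just the one found above; the zeros
    of B are excluded by the analyticity of 1 / B on it.\<close>
  moreover have "(\<forall>x. sector_integrable \<rho>' \<theta>' (B_integrand D A n \<alpha> t x)) \<and>
      bounded_linear (B_inv D A n \<alpha> t \<rho>' \<theta>') \<and>
      (\<forall>x. B_op D A n \<alpha> t (B_inv D A n \<alpha> t \<rho>' \<theta>' x) = x \<and> B_inv D A n \<alpha> t \<rho>' \<theta>' (B_op D A n \<alpha> t x) = x) \<and>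
      generalized_solution D A T f u0 n \<alpha> t (solution_formula D A f u0 n \<alpha> t (B_inv D A n \<alpha> t \<rho>' \<theta>'))"
    if adm: "admissible_sector \<rho> \<theta> n \<alpha> t \<rho>' \<theta>'" for \<rho>' \<theta>'
  proof -
    have adm': "\<rho>' < \<rho>" "\<theta> < \<theta>'" "\<theta>' < pi / 2" "(\<lambda>z. 1 / B_fun n \<alpha> t z) analytic_on sector \<rho>' \<theta>'"
      using adm by (auto simp: admissible_sector_def)
    obtain M where "sector_contour D A \<rho>' \<theta>' M (- sector \<rho> \<theta>)"
      using strongly_positive_sector_contour[OF assms(1) adm'(1-3)] .
    then interpret sector_contour D A \<rho>' \<theta>' M "- sector \<rho> \<theta>" .
    note B = B_inv_inverse[OF assms(3,4) t_ge adm'(4)]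
    have "generalized_solution D A T f u0 n \<alpha> t (solution_formula D A f u0 n \<alpha> t (B_inv D A n \<alpha> t \<rho>' \<theta>'))"
      using t_pos t_le by (intro solution_formula_solves[OF assms(2) _ bounded_linear.linear[OF B(2)] B(3)]) auto
    then show ?thesis using B by blast
  qed
  ultimately show ?thesis unfolding Let_def by blast
qed

end
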